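(* Let $M\in\mathbb{Z}^{k\times k}$ be nonsingular, $m\in\mathbb{R}^k$, and $S=(m+M(-1/2,1/2]^k)\cap\mathbb{Z}^k$. Let $T$ be a finite subset of $(M^T)^{-1}\mathbb{Z}^k/\mathbb{Z}^k$ with $\mathbf{0}\in T$, and let $\widehat{\mathbf{H}}:T\to\mathbb{C}$ with $\widehat{\mathbf{H}}(\mathbf{0})=1$, such that $\mathbf{H}:S\to\mathbb{R}$, $\mathbf{H}(x)=\frac{1}{|\det M|}\sum_{\xi\in T}e(-\xi\cdot x)\widehat{\mathbf{H}}(\xi)$, is real-valued (so $\mathbf{H}$ is a pseudo-distribution on $S$). Suppose there exists a probability distribution $\mathbf{P}$ on $S$ with $d_{\mathrm{TV}}(\mathbf{H},\mathbf{P})\le\epsilon/3$. Then there exists an $\epsilon$-sampler for $\mathbf{P}$, i.e. a randomized procedure, taking as input $M$, $T$, the values $\widehat{\mathbf{H}}(\xi)$ for $\xi\in T$, and a Smith-normal-form-type decomposition $M=UDV$ (with $U,D,V\in\mathbb{Z}^{k\times k}$, $D$ diagonal, $U,V$ unimodular), that uses uniform random bits and outputs a sample from a distribution $\mathbf{Q}$ with $d_{\mathrm{TV}}(\mathbf{P},\mathbf{Q})\le\epsilon$, running in time $O\big(\log(|\det M|)\log(|\det M|/\epsilon)\cdot|T|\cdot\mathrm{poly}(k)\big)$.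
   Context: $e(x)=\exp(-2\pi i x)$; for $\xi\in(M^T)^{-1}\mathbb{Z}^k$ and $x\in\mathbb{Z}^k$, $e(-\xi\cdot x)$ depends only on $\xi$ modulo $\mathbb{Z}^k$. A pseudo-distribution on a finite set $A$ is a function $A\to\mathbb{R}$ with total sum $1$ (possibly taking negative values). The total variation distance is $d_{\mathrm{TV}}(\mathbf{H},\mathbf{P})=\frac12\sum_{x\in S}|\mathbf{H}(x)-\mathbf{P}(x)|$. *)

theory Defs
  imports
    "HOL-Probability.Probability_Mass_Function"
    "HOL-Computational_Algebra.Polynomial"
    "Jordan_Normal_Form.Determinant"
begin

no_notation vec_nth (infixl \<open>$\<close> 90)

section \<open>Lattices, characters and the pseudo-distribution\<close>

definition e_char :: "real \<Rightarrow> complex" where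
  "e_char x = exp (- 2 * complex_of_real pi * \<i> * complex_of_real x)"

abbreviation rvec :: "int vec \<Rightarrow> real vec" where
  "rvec \<equiv> map_vec real_of_int"

abbreviation rmat :: "int mat \<Rightarrow> real mat" where
  "rmat \<equiv> map_mat real_of_int"

text \<open>The integer points of $m + M(-1/2,1/2]^k$.\<close>

definition fund_points :: "nat \<Rightarrow> int mat \<Rightarrow> real vec \<Rightarrow> int vec set" where
  "fund_points k M m =
     {x \<in> carrier_vec k.
        \<exists>y \<in> carrier_vec k. (\<forall>i<k. - 1/2 < y $ i \<and> y $ i \<le> 1/2) \<and> rvec x = m + rmat M *\<^sub>v y}"

text \<open>The dual lattice $(M^T)^{-1}\mathbf{Z}^k$ and its quotient by $\mathbf{Z}^k$; frequencies are
  cosets, that is, elements of the quotient.\<close>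

definition dual_lattice :: "nat \<Rightarrow> int mat \<Rightarrow> real vec set" where
  "dual_lattice k M =
     {\<xi> \<in> carrier_vec k. \<exists>z \<in> carrier_vec k. transpose_mat (rmat M) *\<^sub>v \<xi> = rvec z}"

definition Zvecs :: "nat \<Rightarrow> real vec set" where
  "Zvecs k = rvec ` carrier_vec k"

definition mod_Z :: "nat \<Rightarrow> (real vec \<times> real vec) set" where
  "mod_Z k = {(\<xi>, \<eta>). \<xi> \<in> carrier_vec k \<and> \<eta> \<in> carrier_vec k \<and> \<xi> - \<eta> \<in> Zvecs k}"

definition coset :: "nat \<Rightarrow> real vec \<Rightarrow> real vec set" where
  "coset k \<xi> = mod_Z k `` {\<xi>}"

definition freqs :: "nat \<Rightarrow> int mat \<Rightarrow> real vec set set" where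
  "freqs k M = coset k ` dual_lattice k M"

text \<open>The value of $e(-\xi\cdot x)$ is the same for all representatives \<open>\<xi>\<close> of a coset
  when \<open>x\<close> is integral, see \<open>e_coset_eq\<close> below.\<close>

definition e_coset :: "real vec set \<Rightarrow> int vec \<Rightarrow> complex" where
  "e_coset c x = the_elem ((\<lambda>\<xi>. e_char (- scalar_prod \<xi> (rvec x))) ` c)"

definition inverse_DFT ::
    "int mat \<Rightarrow> real vec set set \<Rightarrow> (real vec set \<Rightarrow> complex) \<Rightarrow> int vec \<Rightarrow> complex" where
  "inverse_DFT M T Hhat x =
     1 / of_int \<bar>Determinant.det M\<bar> * (\<Sum>c\<in>T. e_coset c x * Hhat c)"

definition dTV :: "'a set \<Rightarrow> ('a \<Rightarrow> real) \<Rightarrow> ('a \<Rightarrow> real) \<Rightarrow> real" where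
  "dTV S F G = 1/2 * (\<Sum>x\<in>S. \<bar>F x - G x\<bar>)"

text \<open>No divisibility or sign condition is imposed on the diagonal of \<open>D\<close>.\<close>

definition smith_decomp :: "nat \<Rightarrow> int mat \<Rightarrow> int mat \<Rightarrow> int mat \<Rightarrow> int mat \<Rightarrow> bool" where
  "smith_decomp k M U D V \<longleftrightarrow>
     U \<in> carrier_mat k k \<and> D \<in> carrier_mat k k \<and> V \<in> carrier_mat k k \<and>
     \<bar>Determinant.det U\<bar> = 1 \<and> \<bar>Determinant.det V\<bar> = 1 \<and> diagonal_mat D \<and> M = U * D * V"

lemma e_coset_eq:
  assumes \<xi>: "\<xi> \<in> carrier_vec k" and x: "x \<in> carrier_vec k"
  shows "e_coset (coset k \<xi>) x = e_char (- scalar_prod \<xi> (rvec x))"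
proof -
  have same: "e_char (- scalar_prod \<eta> (rvec x)) = e_char (- scalar_prod \<xi> (rvec x))"
    if "\<eta> \<in> coset k \<xi>" for \<eta>
  proof -
    have \<eta>: "\<eta> \<in> carrier_vec k" and "\<xi> - \<eta> \<in> Zvecs k"
      using that by (simp_all add: coset_def mod_Z_def)
    then obtain z where z: "z \<in> carrier_vec k" and d: "\<xi> - \<eta> = rvec z"
      unfolding Zvecs_def by blast
    have "scalar_prod \<xi> (rvec x) - scalar_prod \<eta> (rvec x) = scalar_prod (\<xi> - \<eta>) (rvec x)"
      using \<xi> \<eta> x by (simp add: minus_scalar_prod_distrib[of _ k])
    also have "\<dots> = real_of_int (scalar_prod z x)"
      using x z by (simp add: d scalar_prod_def)
    finally have "- scalar_prod \<eta> (rvec x) = - scalar_prod \<xi> (rvec x) + real_of_int (scalar_prod z x)"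
      by simp
    moreover have "e_char (t + real_of_int n) = e_char t" for t n
    proof -
      have c: "e_char r = cis (- (2 * pi * r))" for r
        by (simp add: e_char_def cis_conv_exp mult_ac)
      have "e_char (t + real_of_int n) = cis (- (2 * pi * t)) * cis (2 * pi * real_of_int (- n))"
        unfolding c cis_mult by (rule arg_cong[of _ _ cis]) (simp add: algebra_simps)
      also have "cis (2 * pi * real_of_int (- n)) = 1"
        by (rule cis_multiple_2pi) (rule Ints_of_int)
      finally show ?thesis by (simp add: c)
    qed
    ultimately show ?thesis by (simp only:)
  qed
  have "\<xi> \<in> coset k \<xi>"
    using \<xi> by (auto simp: coset_def mod_Z_def Zvecs_def intro!: image_eqI[of _ _ "0\<^sub>v k"])
  with same have "(\<lambda>\<eta>. e_char (- scalar_prod \<eta> (rvec x))) ` coset k \<xi> =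
      {e_char (- scalar_prod \<xi> (rvec x))}"
    by blast
  then show ?thesis by (simp add: e_coset_def)
qed

text \<open>In particular \<^const>\<open>dTV\<close> on \<^const>\<open>fund_points\<close> is a genuine finite sum.\<close>

lemma finite_fund_points:
  assumes M: "M \<in> carrier_mat k k" and m: "m \<in> carrier_vec k"
  shows "finite (fund_points k M m)"
proof -
  define B where "B = (\<Sum>i<k. \<lceil>\<bar>m $ i\<bar> + (\<Sum>j<k. \<bar>real_of_int (M $$ (i,j))\<bar>)\<rceil>)"
  have bound: "\<bar>x $ i\<bar> \<le> B" if x: "x \<in> fund_points k M m" and i: "i < k" for x i
  proof -
    obtain y where xk: "x \<in> carrier_vec k" and y: "y \<in> carrier_vec k"
      and yb: "\<And>j. j < k \<Longrightarrow> - 1/2 < y $ j \<and> y $ j \<le> 1/2" and eq: "rvec x = m + rmat M *\<^sub>v y"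
      using x by (auto simp: fund_points_def)
    let ?C = "\<lambda>i. \<bar>m $ i\<bar> + (\<Sum>j<k. \<bar>real_of_int (M $$ (i,j))\<bar>)"
    have "real_of_int (x $ i) = rvec x $ i" using xk i by simp
    also have "\<dots> = m $ i + (\<Sum>j<k. real_of_int (M $$ (i,j)) * y $ j)"
      unfolding eq using M m y i by (simp add: scalar_prod_def lessThan_atLeast0)
    finally have "\<bar>real_of_int (x $ i)\<bar> \<le> \<bar>m $ i\<bar> + \<bar>\<Sum>j<k. real_of_int (M $$ (i,j)) * y $ j\<bar>"
      by linarith
    also have "\<bar>\<Sum>j<k. real_of_int (M $$ (i,j)) * y $ j\<bar> \<le> (\<Sum>j<k. \<bar>real_of_int (M $$ (i,j)) * y $ j\<bar>)"
      by (rule sum_abs)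
    also have "\<dots> \<le> (\<Sum>j<k. \<bar>real_of_int (M $$ (i,j))\<bar>)"
    proof (rule sum_mono)
      fix j assume "j \<in> {..<k}"
      then have "\<bar>y $ j\<bar> \<le> 1" using yb[of j] by auto
      then show "\<bar>real_of_int (M $$ (i,j)) * y $ j\<bar> \<le> \<bar>real_of_int (M $$ (i,j))\<bar>"
        unfolding abs_mult by (simp add: mult_left_le)
    qed
    finally have "\<bar>real_of_int (x $ i)\<bar> \<le> ?C i" by simp
    then have "\<bar>x $ i\<bar> \<le> \<lceil>?C i\<rceil>" by linarith
    also have "\<dots> \<le> B" unfolding B_def
    proof (rule member_le_sum)
      fix j
      have "0 \<le> ?C j" by (intro add_nonneg_nonneg sum_nonneg) auto
      then show "0 \<le> \<lceil>?C j\<rceil>" by (rule ceiling_mono[of 0, unfolded ceiling_zero])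
    next
      show "i \<in> {..<k}" using i by simp
    qed simp
    finally show ?thesis .
  qed
  have "fund_points k M m \<subseteq> vec_of_list ` {xs. set xs \<subseteq> {-B..B} \<and> length xs = k}"
  proof
    fix x assume x: "x \<in> fund_points k M m"
    then have xk: "dim_vec x = k" by (auto simp: fund_points_def)
    have "set (list_of_vec x) \<subseteq> {-B..B}"
    proof
      fix a assume "a \<in> set (list_of_vec x)"
      then obtain i where "i < k" and a: "a = x $ i"
        using xk by (auto simp: in_set_conv_nth list_of_vec_index)
      with bound[OF x, of i] show "a \<in> {-B..B}" by (simp add: abs_le_iff minus_le_iff)
    qed
    then show "x \<in> vec_of_list ` {xs. set xs \<subseteq> {-B..B} \<and> length xs = k}"
      using xk by (intro image_eqI[of _ _ "list_of_vec x"]) (simp_all add: vec_list)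
  qed
  then show ?thesis
    by (rule finite_subset) (intro finite_imageI finite_lists_length_eq, simp)
qed


section \<open>A probabilistic real RAM\<close>

text \<open>Randomized procedures are programs for a real random access machine whose
  memory consists of (finitely many, per program) named arrays of reals.  Besides field arithmetic
  the machine has the usual analytic primitives floor, sine and cosine, and can read unbiased
  random bits. Integers are held as reals; an array index is rounded down to an integer.

  A step executes one command or evaluates one branching condition.  A program is a fixed
  syntactic object, so charging every arithmetic operation inside its expressions separately
  would change running times by a constant factor only.\<close>

type_synonym memory = "string \<Rightarrow> int \<Rightarrow> real"

datatype expr =
    Num int
  | Pi
  | Cell string expr
  | Add expr expr
  | Sub expr expr
  | Mul expr expr
  | Div expr expr
  | Floor expr
  | Sin expr
  | Cos expr

datatype cond = Less expr expr | Not cond | And cond cond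

datatype prog =
    Assign string expr expr
  | RandomBit string expr
  | Seq prog prog
  | If cond prog prog
  | While cond prog

fun aval :: "expr \<Rightarrow> memory \<Rightarrow> real" where
  "aval (Num n) s = real_of_int n"
| "aval Pi s = pi"
| "aval (Cell x i) s = s x \<lfloor>aval i s\<rfloor>"
| "aval (Add a b) s = aval a s + aval b s"
| "aval (Sub a b) s = aval a s - aval b s"
| "aval (Mul a b) s = aval a s * aval b s"
| "aval (Div a b) s = aval a s / aval b s"
| "aval (Floor a) s = real_of_int \<lfloor>aval a s\<rfloor>"
| "aval (Sin a) s = sin (aval a s)"
| "aval (Cos a) s = cos (aval a s)"

fun bval :: "cond \<Rightarrow> memory \<Rightarrow> bool" where
  "bval (Less a b) s \<longleftrightarrow> aval a s < aval b s"
| "bval (Not c) s \<longleftrightarrow> \<not> bval c s"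
| "bval (And c d) s \<longleftrightarrow> bval c s \<and> bval d s"

definition store :: "memory \<Rightarrow> string \<Rightarrow> int \<Rightarrow> real \<Rightarrow> memory" where
  "store s x i r = s(x := (s x)(i := r))"

text \<open>A configuration is the stack of commands still to be executed together with the memory;
  the machine has halted when the stack is empty.\<close>

type_synonym config = "prog list \<times> memory"

fun step :: "config \<Rightarrow> config pmf" where
  "step ([], s) = return_pmf ([], s)"
| "step (Assign x i a # ps, s) = return_pmf (ps, store s x \<lfloor>aval i s\<rfloor> (aval a s))"
| "step (RandomBit x i # ps, s) =
     map_pmf (\<lambda>b. (ps, store s x \<lfloor>aval i s\<rfloor> (of_bool b))) (bernoulli_pmf (1/2))"
| "step (Seq p q # ps, s) = return_pmf (p # q # ps, s)"
| "step (If c p q # ps, s) = return_pmf ((if bval c s then p else q) # ps, s)"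
| "step (While c p # ps, s) =
     return_pmf (if bval c s then p # While c p # ps else ps, s)"

primrec run :: "nat \<Rightarrow> config \<Rightarrow> config pmf" where
  "run 0 cf = return_pmf cf"
| "run (Suc n) cf = bind_pmf (step cf) (run n)"

definition output_vec :: "nat \<Rightarrow> config \<Rightarrow> real vec" where
  "output_vec k cf = vec k (\<lambda>i. snd cf ''out'' (int i))"

text \<open>Started on \<open>s\<close>, the program \<open>p\<close> halts within \<open>n\<close> steps, whatever the random bits, and leaves
  in the output array a sample from \<open>Q\<close>.\<close>

definition samples_within :: "prog \<Rightarrow> memory \<Rightarrow> nat \<Rightarrow> nat \<Rightarrow> int vec pmf \<Rightarrow> bool" where
  "samples_within p s n k Q \<longleftrightarrow>
     (\<forall>cf \<in> set_pmf (run n ([p], s)). fst cf = []) \<and>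
     map_pmf (output_vec k) (run n ([p], s)) = map_pmf rvec Q"


section \<open>Input of the sampler\<close>

definition arr :: "nat \<Rightarrow> (nat \<Rightarrow> real) \<Rightarrow> int \<Rightarrow> real" where
  "arr n f = (\<lambda>i. if 0 \<le> i \<and> i < int n then f (nat i) else 0)"

definition mat_arr :: "nat \<Rightarrow> int mat \<Rightarrow> int \<Rightarrow> real" where
  "mat_arr k A = arr (k * k) (\<lambda>i. real_of_int (A $$ (i div k, i mod k)))"

text \<open>A list of representatives of the cosets in \<open>T\<close>, each coset represented exactly once.\<close>

definition represents :: "nat \<Rightarrow> real vec list \<Rightarrow> real vec set set \<Rightarrow> bool" where
  "represents k \<xi>s T \<longleftrightarrow>
     set \<xi>s \<subseteq> carrier_vec k \<and> distinct (map (coset k) \<xi>s) \<and> coset k ` set \<xi>s = T"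

text \<open>Matrices are stored by rows, \<open>\<xi>s\<close> one vector after the other; all other cells are zero.\<close>

definition sampler_input ::
    "nat \<Rightarrow> int mat \<Rightarrow> real vec \<Rightarrow> real \<Rightarrow> real vec list \<Rightarrow> (real vec set \<Rightarrow> complex) \<Rightarrow>
     int mat \<Rightarrow> int mat \<Rightarrow> int mat \<Rightarrow> memory" where
  "sampler_input k M m \<epsilon> \<xi>s Hhat U D V = (\<lambda>_ _. 0)
     (''k'' := arr 1 (\<lambda>_. real k),
      ''eps'' := arr 1 (\<lambda>_. \<epsilon>),
      ''M'' := mat_arr k M,
      ''m'' := arr k (\<lambda>i. m $ i),
      ''card_T'' := arr 1 (\<lambda>_. real (length \<xi>s)),
      ''xi'' := arr (length \<xi>s * k) (\<lambda>i. (\<xi>s ! (i div k)) $ (i mod k)),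
      ''Hhat_re'' := arr (length \<xi>s) (\<lambda>i. Re (Hhat (coset k (\<xi>s ! i)))),
      ''Hhat_im'' := arr (length \<xi>s) (\<lambda>i. Im (Hhat (coset k (\<xi>s ! i)))),
      ''U'' := mat_arr k U,
      ''D'' := mat_arr k D,
      ''V'' := mat_arr k V)"

text \<open>The expression inside the $O(\cdot)$, up to the polynomial in the dimension.  Logarithms
  smaller than 1 are rounded up to 1; this is immaterial when \<open>|det M| \<ge> 2\<close> and \<open>\<epsilon> \<le> 1\<close>, and
  keeps the bound from vanishing or becoming negative otherwise.\<close>

definition time_bound :: "int mat \<Rightarrow> real vec set set \<Rightarrow> real \<Rightarrow> real" where
  "time_bound M T \<epsilon> =
     (let \<Delta> = real_of_int \<bar>Determinant.det M\<bar>
      in max 1 (ln \<Delta>) * max 1 (ln (\<Delta> / \<epsilon>)) * real (card T))"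

end

(*
  A Smith decomposition M = U D V identifies the residue classes modulo M Z^k, hence the points of S,
  with the digit vectors w (0 <= w_l < |D_ll|) via w |-> U w, and so with the numbers n < N = |det M|
  written in mixed radix.  In these coordinates every character e(-xi . x) is a product of powers
  z_l^{w_l}, so that the cumulative sums F(n) = H(x_0) + ... + H(x_{n-1}) are obtained from geometric
  sums by Horner's rule.

  The sampler draws u = j / 2^b uniformly, with 2^b >= 2N / eps, and looks for n with
  F(n) <= u < F(n+1) by binary search.  F need not be monotone, but the search only relies on
  F(0) = 0 <= u < 1 = F(N).  The n found satisfies H(x_n) > 0 and is reached with probability at
  most H(x_n) + 2^-b, which bounds the positive part of Q - P by that of H - P plus N / 2^b <= eps / 2.

  The representative of U w in S comes from the solution y of M y = U w - m, which is computed row by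
  row with Huang's projection method.  Unlike Gaussian elimination this needs no pivoting.
*)
theory Submission
  imports Defs
begin

section \<open>Programs and their running time\<close>

text \<open>Randomness is confined to one loop, which reads bits and whose number of rounds depends
  only on N and eps. Everything before and after it is deterministic, so it can be treated as a
  relation between memories with a step bound; probability enters only through
  \<open>uniform_bits\<close>. One-sided bounds on Q suffice because P, Q and H all have total mass
  1: the total variation distance is then the sum of the positive parts of the difference. This is
  what makes negative values of H harmless. The error budget is eps/3 + eps/2, where eps/2 bounds N
  / 2^b, one rounding loss per point. One value of F costs O(k^2) steps per frequency and about log
  N values are needed, while the log(N / eps) bits are drawn only once. The two logarithms therefore
  come from separate stages, and the product in the time bound dominates their sum because each is
  rounded up to at least 1. The machine has neither complex numbers nor an absolute value.
  Characters are handled through sines and cosines, and case distinctions inside expressions through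
  floors and the convention x / 0 = 0.\<close>

text \<open>Quantifying over the remaining stack \<open>ps\<close> makes the relation compose. The
  step count n is exact, since one more step would already execute \<open>ps\<close>; the separate
  bound t absorbs branches of different length.\<close>

definition reach :: "nat \<Rightarrow> prog \<Rightarrow> memory \<Rightarrow> memory \<Rightarrow> bool" where
  "reach t p s s' \<longleftrightarrow> (\<exists>n\<le>t. \<forall>ps. run n (p # ps, s) = return_pmf (ps, s'))"

lemma run_add: "run (m + n) cf = bind_pmf (run m cf) (run n)"
  by (induction m arbitrary: cf) (simp_all add: bind_return_pmf bind_assoc_pmf cong: bind_pmf_cong)

lemma run_halted [simp]: "run n ([], s) = return_pmf ([], s)"
  by (induction n) (simp_all add: bind_return_pmf)

lemma reach_mono: "reach t p s s' \<Longrightarrow> t \<le> t' \<Longrightarrow> reach t' p s s'"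
  unfolding reach_def by (meson le_trans)

lemma reach_Assign: "reach 1 (Assign x i a) s (store s x \<lfloor>aval i s\<rfloor> (aval a s))"
  unfolding reach_def by (intro exI[of _ 1]) (simp add: bind_return_pmf)

lemma reach_Seq:
  assumes "reach t p s s'" "reach t' q s' s''"
  shows "reach (t + t' + 1) (Seq p q) s s''"
proof -
  obtain n n' where "n \<le> t" "\<And>ps. run n (p # ps, s) = return_pmf (ps, s')"
    "n' \<le> t'" "\<And>ps. run n' (q # ps, s') = return_pmf (ps, s'')"
    using assms unfolding reach_def by blast
  then show ?thesis unfolding reach_def
    by (intro exI[of _ "Suc (n + n')"]) (simp add: bind_return_pmf run_add)
qed

lemma reach_If: "reach t (if bval c s then p else q) s s' \<Longrightarrow> reach (t + 1) (If c p q) s s'"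
  unfolding reach_def
proof (elim exE conjE)
  fix n assume "n \<le> t" "\<forall>ps. run n ((if bval c s then p else q) # ps, s) = return_pmf (ps, s')"
  then show "\<exists>n\<le>t + 1. \<forall>ps. run n (If c p q # ps, s) = return_pmf (ps, s')"
    by (intro exI[of _ "Suc n"]) (simp add: bind_return_pmf)
qed

lemma reach_While_False: "\<not> bval c s \<Longrightarrow> reach 1 (While c p) s s"
  unfolding reach_def by (intro exI[of _ 1]) (simp add: bind_return_pmf)

lemma reach_While_True:
  assumes "bval c s" "reach t p s s'" "reach t' (While c p) s' s''"
  shows "reach (t + t' + 1) (While c p) s s''"
proof -
  obtain n n' where "n \<le> t" "\<And>ps. run n (p # ps, s) = return_pmf (ps, s')"
    "n' \<le> t'" "\<And>ps. run n' (While c p # ps, s') = return_pmf (ps, s'')"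
    using assms unfolding reach_def by blast
  then show ?thesis unfolding reach_def using assms(1)
    by (intro exI[of _ "Suc (n + n')"]) (simp add: bind_return_pmf run_add)
qed

section \<open>Counting loops and the arrays they may change\<close>

abbreviation Var :: "string \<Rightarrow> expr" where
  "Var x \<equiv> Cell x (Num 0)"

definition set_var :: "string \<Rightarrow> expr \<Rightarrow> prog" where
  "set_var x a = Assign x (Num 0) a"

definition for_loop :: "string \<Rightarrow> expr \<Rightarrow> prog \<Rightarrow> prog" where
  "for_loop x b p = Seq (set_var x (Num 0))
     (While (Less (Var x) b) (Seq p (set_var x (Add (Var x) (Num 1)))))"

definition sum_loop :: "string \<Rightarrow> string \<Rightarrow> expr \<Rightarrow> expr \<Rightarrow> prog" where
  "sum_loop acc x b e = Seq (set_var acc (Num 0)) (for_loop x b (set_var acc (Add (Var acc) e)))"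

text \<open>One shape serves both matrix-vector products and, with the inner bound
  \<open>Num 0\<close>, entrywise assignments.\<close>

definition table_loop ::
    "string \<Rightarrow> string \<Rightarrow> expr \<Rightarrow> string \<Rightarrow> string \<Rightarrow> expr \<Rightarrow> expr \<Rightarrow> expr \<Rightarrow> prog" where
  "table_loop v x b acc y b' e' e = for_loop x b (Seq (sum_loop acc y b' e') (Assign v (Var x) e))"

definition frame :: "string set \<Rightarrow> memory \<Rightarrow> memory \<Rightarrow> bool" where
  "frame W s s' \<longleftrightarrow> (\<forall>x. x \<notin> W \<longrightarrow> s' x = s x)"

lemma frameD: "frame W s s' \<Longrightarrow> x \<notin> W \<Longrightarrow> s' x = s x"
  by (simp add: frame_def)

lemma frame_refl [simp]: "frame W s s"
  by (simp add: frame_def)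

lemma frame_store [simp]: "x \<in> W \<Longrightarrow> frame W s (store s' x i r) \<longleftrightarrow> frame W s s'"
  unfolding frame_def store_def by auto

lemma frame_trans: "frame W s s' \<Longrightarrow> frame W' s' s'' \<Longrightarrow> W \<union> W' \<subseteq> X \<Longrightarrow> frame X s s''"
  unfolding frame_def by (metis UnCI subsetD)

lemma frame_mono: "frame W s s' \<Longrightarrow> W \<subseteq> X \<Longrightarrow> frame X s s'"
  unfolding frame_def by blast

lemma store_same [simp]: "store s x i r x i = r"
  and store_other [simp]: "x \<noteq> y \<Longrightarrow> store s x i r y = s y" "y \<noteq> x \<Longrightarrow> store s x i r y = s y"
  by (simp_all add: store_def)

lemma reach_set_var: "reach 1 (set_var x a) s (store s x 0 (aval a s))"
  unfolding set_var_def using reach_Assign[of x "Num 0" a s] by simp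

lemma reach_set_varI: "aval a s = v \<Longrightarrow> reach 1 (set_var x a) s (store s x 0 v)"
  using reach_set_var by metis

text \<open>The invariant describes the memory at the test, with the counter already set. Besides
  the body a round costs the test, the sequence node and the increment; the last 3 steps are the
  initialization, its sequence node and the failing test.\<close>

lemma reach_for_loop:
  assumes init: "I 0 (store s x 0 0)"
    and step: "\<And>i s. i < n \<Longrightarrow> I i s \<Longrightarrow>
      \<exists>s'. reach t p s s' \<and> s' x 0 = real i \<and> I (Suc i) (store s' x 0 (real (Suc i)))"
    and idx: "\<And>i s. I i s \<Longrightarrow> s x 0 = real i"
    and bound: "\<And>i s. i \<le> n \<Longrightarrow> I i s \<Longrightarrow> aval b s = real n"
  shows "\<exists>s'. reach (n * (t + 3) + 3) (for_loop x b p) s s' \<and> I n s'"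
proof -
  let ?W = "While (Less (Var x) b) (Seq p (set_var x (Add (Var x) (Num 1))))"
  have loop: "i \<le> n \<Longrightarrow> I i s \<Longrightarrow> \<exists>s'. reach ((n - i) * (t + 3) + 1) ?W s s' \<and> I n s'" for i s
  proof (induction "n - i" arbitrary: i s)
    case 0
    then have "i = n" by simp
    with 0 have "reach 1 ?W s s \<and> I n s"
      using idx[of n s] bound[of n s] by (intro conjI reach_While_False) auto
    with \<open>i = n\<close> show ?case by auto
  next
    case (Suc m)
    then have "i < n" by simp
    then obtain s' where s': "reach t p s s'" "s' x 0 = real i" "I (Suc i) (store s' x 0 (real (Suc i)))"
      using step Suc.prems by blast
    have "reach 1 (set_var x (Add (Var x) (Num 1))) s' (store s' x 0 (real (Suc i)))"
      using reach_set_var[of x "Add (Var x) (Num 1)" s'] s'(2) by (simp add: add.commute)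
    with s'(1) have body: "reach (t + 1 + 1) (Seq p (set_var x (Add (Var x) (Num 1)))) s (store s' x 0 (real (Suc i)))"
      by (rule reach_Seq)
    obtain s'' where s'': "reach ((n - Suc i) * (t + 3) + 1) ?W (store s' x 0 (real (Suc i))) s''" "I n s''"
      using Suc.hyps(1)[OF _ _ s'(3)] Suc.hyps(2) \<open>i < n\<close> by fastforce
    have "bval (Less (Var x) b) s" using idx[OF Suc.prems(2)] bound[OF Suc.prems] \<open>i < n\<close> by simp
    from reach_While_True[OF this body s''(1)] have "reach ((n - i) * (t + 3) + 1) ?W s s''"
    proof (rule reach_mono)
      have "n - i = Suc (n - Suc i)" using \<open>i < n\<close> by simp
      then show "t + 1 + 1 + ((n - Suc i) * (t + 3) + 1) + 1 \<le> (n - i) * (t + 3) + 1" by simp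
    qed
    with s''(2) show ?case by blast
  qed
  obtain s' where s': "reach (n * (t + 3) + 1) ?W (store s x 0 0) s'" "I n s'"
    using loop[of 0, OF _ init] by auto
  have "reach 1 (set_var x (Num 0)) s (store s x 0 0)" using reach_set_var[of x "Num 0" s] by simp
  from reach_Seq[OF this s'(1)] have "reach (n * (t + 3) + 3) (for_loop x b p) s s'"
    unfolding for_loop_def by (rule reach_mono) simp
  with s'(2) show ?thesis by blast
qed

text \<open>Only two cells change, so the final memory can be given exactly. The variable v in the
  hypotheses stands for the running accumulator, whose value must not influence the bound or the
  summand.\<close>

lemma reach_sum_loop:
  assumes xy: "acc \<noteq> x"
    and bound: "\<And>i v. i \<le> n \<Longrightarrow> aval b (store (store s acc 0 v) x 0 (real i)) = real n"
    and val: "\<And>i v. i < n \<Longrightarrow> aval e (store (store s acc 0 v) x 0 (real i)) = f i"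
  shows "reach (n * 4 + 5) (sum_loop acc x b e) s (store (store s acc 0 (\<Sum>i<n. f i)) x 0 (real n))"
proof -
  let ?I = "\<lambda>i s'. s' = store (store s acc 0 (\<Sum>j<i. f j)) x 0 (real i)"
  have "\<exists>s'. reach (n * (1 + 3) + 3) (for_loop x b (set_var acc (Add (Var acc) e))) (store s acc 0 0) s' \<and> ?I n s'"
  proof (rule reach_for_loop)
    fix i s' assume i: "i < n" and I: "?I i s'"
    have "aval (Add (Var acc) e) s' = (\<Sum>j<Suc i. f j)"
      using val[OF i] xy I by simp
    with reach_set_var[of acc "Add (Var acc) e" s']
    have "reach 1 (set_var acc (Add (Var acc) e)) s' (store s' acc 0 (\<Sum>j<Suc i. f j))"
      by (simp only:)
    moreover have "store s' acc 0 (\<Sum>j<Suc i. f j) x 0 = real i"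
      using xy I by simp
    moreover have "?I (Suc i) (store (store s' acc 0 (\<Sum>j<Suc i. f j)) x 0 (real (Suc i)))"
      unfolding I using xy by (simp add: store_def fun_upd_twist)
    ultimately show "\<exists>s''. reach 1 (set_var acc (Add (Var acc) e)) s' s'' \<and> s'' x 0 = real i \<and>
        ?I (Suc i) (store s'' x 0 (real (Suc i)))" by blast
  qed (use bound in auto)
  then have "reach (n * (1 + 3) + 3) (for_loop x b (set_var acc (Add (Var acc) e))) (store s acc 0 0)
      (store (store s acc 0 (\<Sum>i<n. f i)) x 0 (real n))" by blast
  moreover have "reach 1 (set_var acc (Num 0)) s (store s acc 0 0)"
    using reach_set_var[of acc "Num 0" s] by simp
  ultimately show ?thesis unfolding sum_loop_def by (rule reach_mono[OF reach_Seq[rotated]]) simp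
qed

text \<open>The premise \<open>s' v (int i) = s v (int i)\<close> in the last hypothesis is what
  permits updates in place: when entry i is computed, the table has been overwritten only at smaller
  indices.\<close>

lemma reach_table_loop:
  assumes dist: "distinct [v, x, acc, y]"
    and bound: "\<And>s'. frame {v, x, acc, y} s s' \<Longrightarrow> aval b s' = real n"
    and bound': "\<And>s'. frame {v, x, acc, y} s s' \<Longrightarrow> aval b' s' = real n'"
    and val': "\<And>i j s'. i < n \<Longrightarrow> j < n' \<Longrightarrow> frame {v, x, acc, y} s s' \<Longrightarrow> s' x 0 = real i \<Longrightarrow>
       s' y 0 = real j \<Longrightarrow> aval e' s' = f i j"
    and val: "\<And>i s'. i < n \<Longrightarrow> frame {v, x, acc, y} s s' \<Longrightarrow> s' x 0 = real i \<Longrightarrow>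
       s' acc 0 = (\<Sum>j<n'. f i j) \<Longrightarrow> s' v (int i) = s v (int i) \<Longrightarrow> aval e s' = h i"
  shows "\<exists>s'. reach (n * (n' * 4 + 10) + 3) (table_loop v x b acc y b' e' e) s s' \<and>
     frame {v, x, acc, y} s s' \<and> (\<forall>i<n. s' v (int i) = h i)"
proof -
  let ?W = "{v, x, acc, y}"
  let ?I = "\<lambda>i s'. frame ?W s s' \<and> s' x 0 = real i \<and> (\<forall>j<i. s' v (int j) = h j) \<and>
     (\<forall>j\<ge>i. s' v (int j) = s v (int j))"
  have "\<exists>s'. reach (n * ((n' * 4 + 7) + 3) + 3) (table_loop v x b acc y b' e' e) s s' \<and> ?I n s'"
    unfolding table_loop_def
  proof (rule reach_for_loop)
    show "?I 0 (store s x 0 0)" using dist by simp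
  next
    fix i s' assume i: "i < n" and I: "?I i s'"
    define s1 where "s1 = store (store s' acc 0 (\<Sum>j<n'. f i j)) y 0 (real n')"
    have 1: "reach (n' * 4 + 5) (sum_loop acc y b' e') s' s1"
      unfolding s1_def using I i dist by (intro reach_sum_loop) (auto intro!: bound' val')
    have f1: "frame ?W s s1" "s1 x 0 = real i" "s1 acc 0 = (\<Sum>j<n'. f i j)"
      "\<And>j. s1 v j = s' v j"
      using I dist by (simp_all add: s1_def)
    have "aval e s1 = h i" using f1 I i by (intro val) auto
    then have 2: "reach 1 (Assign v (Var x) e) s1 (store s1 v (int i) (h i))"
      using reach_Assign[of v "Var x" e s1] f1 by simp
    define s2 where "s2 = store s1 v (int i) (h i)"
    have "?I (Suc i) (store s2 x 0 (real (Suc i)))"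
      using I f1 dist by (intro conjI) (simp add: s2_def, auto simp: s2_def store_def less_Suc_eq)
    moreover have "s2 x 0 = real i" using f1 dist by (simp add: s2_def)
    moreover have "reach (n' * 4 + 7) (Seq (sum_loop acc y b' e') (Assign v (Var x) e)) s' s2"
      unfolding s2_def by (rule reach_mono[OF reach_Seq[OF 1 2]]) simp
    ultimately show "\<exists>s''. reach (n' * 4 + 7) (Seq (sum_loop acc y b' e') (Assign v (Var x) e)) s' s'' \<and>
       s'' x 0 = real i \<and> ?I (Suc i) (store s'' x 0 (real (Suc i)))" by blast
  qed (use bound in auto)
  then obtain s' where "reach (n * ((n' * 4 + 7) + 3) + 3) (table_loop v x b acc y b' e' e) s s'" "?I n s'"
    by blast
  then show ?thesis by (intro exI[of _ s']) (simp add: reach_mono)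
qed

text \<open>A halted configuration stays put, so shorter runs can be padded to the common time
  t.\<close>

lemma run_reach:
  assumes "reach t p s s'"
  shows "run t ([p], s) = return_pmf ([], s')"
proof -
  obtain n where n: "n \<le> t" "run n ([p], s) = return_pmf ([], s')"
    using assms unfolding reach_def by blast
  then have "run (n + (t - n)) ([p], s) = return_pmf ([], s')"
    unfolding run_add by (simp add: bind_return_pmf)
  with n show ?thesis by simp
qed


section \<open>Character sums in mixed radix and successive projections\<close>

definition place :: "(nat \<Rightarrow> nat) \<Rightarrow> nat \<Rightarrow> nat" where
  "place d i = (\<Prod>j<i. d j)"

definition digit :: "(nat \<Rightarrow> nat) \<Rightarrow> nat \<Rightarrow> nat \<Rightarrow> nat" where
  "digit d n i = n div place d i mod d i"

lemma place_0 [simp]: "place d 0 = 1"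
  and place_Suc: "place d (Suc i) = place d i * d i"
  by (simp_all add: place_def)

lemma place_dvd: "i \<le> l \<Longrightarrow> place d i dvd place d l"
  unfolding place_def by (intro prod_dvd_prod_subset) auto

lemma place_pos: "(\<And>i. i < l \<Longrightarrow> 0 < d i) \<Longrightarrow> 0 < place d l"
  unfolding place_def by (rule prod_pos) auto

lemma mod_place_Suc: "n mod place d (Suc i) = digit d n i * place d i + n mod place d i"
  unfolding place_Suc mod_mult2_eq digit_def by (simp add: mult.commute)

lemma digit_less: "0 < d i \<Longrightarrow> digit d n i < d i"
  by (simp add: digit_def)

lemma digit_mod_place:
  assumes "i < l"
  shows "digit d (n mod place d l) i = digit d n i"
proof -
  \<comment> \<open>Digit i depends only on the residue modulo the next place value. For place value
    0 both sides are 0 by the conventions on division.\<close>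
  have eq: "digit d m i = (m mod place d (Suc i)) div place d i" for m
  proof (cases "place d i = 0")
    case False
    then show ?thesis by (simp add: mod_place_Suc) 
  qed (simp add: digit_def)
  have "n mod place d l mod place d (Suc i) = n mod place d (Suc i)"
    using assms by (intro mod_mod_cancel place_dvd) simp
  then show ?thesis by (simp only: eq)
qed

lemma digits_determine:
  assumes "n < place d k" "n' < place d k" "\<And>i. i < k \<Longrightarrow> digit d n i = digit d n' i"
  shows "n = n'"
proof -
  have "l \<le> k \<Longrightarrow> n mod place d l = n' mod place d l" for l
    by (induction l) (simp_all add: mod_place_Suc assms(3))
  from this[of k] show ?thesis using assms(1,2) by simp
qed

text \<open>Counting: the digit map is injective into a product of intervals that has exactly
  \<open>place d k\<close> elements.\<close>

lemma digits_surj: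
  assumes pos: "\<And>i. i < k \<Longrightarrow> 0 < d i" and w: "\<And>i. i < k \<Longrightarrow> w i < d i"
  shows "\<exists>n<place d k. \<forall>i<k. digit d n i = w i"
proof -
  let ?B = "Pi\<^sub>E {..<k} (\<lambda>i. {..<d i})"
  let ?g = "\<lambda>n. restrict (digit d n) {..<k}"
  have "inj_on ?g {..<place d k}"
  proof (rule inj_onI)
    fix n n' assume n: "n \<in> {..<place d k}" "n' \<in> {..<place d k}" and eq: "?g n = ?g n'"
    show "n = n'"
    proof (rule digits_determine)
      fix i assume "i < k"
      with fun_cong[OF eq, of i] show "digit d n i = digit d n' i" by simp
    qed (use n in auto)
  qed
  moreover have sub: "?g ` {..<place d k} \<subseteq> ?B"
    using pos by (auto simp: digit_less split: if_splits)
  moreover have "card ?B = place d k"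
    by (simp add: card_PiE place_def)
  moreover have "finite ?B" by (intro finite_PiE) auto
  ultimately have "?g ` {..<place d k} = ?B"
    by (metis card_subset_eq card_image card_lessThan)
  moreover have "restrict w {..<k} \<in> ?B" using w by auto
  ultimately have "restrict w {..<k} \<in> ?g ` {..<place d k}" by (simp only:)
  then obtain n where n: "n < place d k" and eq: "restrict w {..<k} = ?g n"
    unfolding image_iff by (meson lessThan_iff)
  have "digit d n i = w i" if "i < k" for i using fun_cong[OF eq, of i] that by simp
  with n show ?thesis by blast
qed

text \<open>In the applications D is a place value, so that the block number b is the leading
  digit.\<close>

lemma sum_blocks:
  fixes g :: "nat \<Rightarrow> 'a::comm_monoid_add"
  shows "(\<Sum>n<a * D + r. g n) = (\<Sum>b<a. \<Sum>i<D. g (b * D + i)) + (\<Sum>i<r. g (a * D + i))"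
proof -
  have tail: "(\<Sum>n<m + r. g n) = (\<Sum>n<m. g n) + (\<Sum>i<r. g (m + i))" for m r
    by (induction r) (simp_all add: add.assoc)
  have "(\<Sum>n<a * D. g n) = (\<Sum>b<a. \<Sum>i<D. g (b * D + i))"
  proof (induction a)
    case (Suc a)
    have "(\<Sum>n<Suc a * D. g n) = (\<Sum>n<a * D + D. g n)" by (simp add: add.commute)
    then show ?case by (simp only: tail Suc sum.lessThan_Suc)
  qed simp
  then show ?thesis by (simp add: tail)
qed

section \<open>Character sums over initial segments\<close>

definition char_value :: "(nat \<Rightarrow> complex) \<Rightarrow> (nat \<Rightarrow> nat) \<Rightarrow> nat \<Rightarrow> nat \<Rightarrow> complex" where
  "char_value z d l n = (\<Prod>i<l. z i ^ digit d n i)"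

definition char_sum :: "(nat \<Rightarrow> complex) \<Rightarrow> (nat \<Rightarrow> nat) \<Rightarrow> nat \<Rightarrow> nat \<Rightarrow> complex" where
  "char_sum z d l n = (\<Sum>i<n. char_value z d l i)"

lemma char_value_block:
  assumes "b < d l" "r < place d l"
  shows "char_value z d (Suc l) (b * place d l + r) = z l ^ b * char_value z d l r"
proof -
  have "digit d (b * place d l + r) i = digit d r i" if "i < l" for i
    using digit_mod_place[OF that, of d "b * place d l + r"] assms(2) by simp
  moreover have "digit d (b * place d l + r) l = b"
    using assms by (simp add: digit_def)
  ultimately show ?thesis by (simp add: char_value_def)
qed

text \<open>The numbers below b * place + r form b full blocks, with leading digits a < b, and an
  initial piece of the block with leading digit b. On each block the factor of the leading digit is
  constant, which leaves a geometric sum. This is the Horner step, running from the lowest digit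
  upwards.\<close>

lemma char_sum_Suc:
  assumes b: "b < d l" and r: "r < place d l"
  shows "char_sum z d (Suc l) (b * place d l + r) =
    z l ^ b * char_sum z d l r + (\<Sum>a<b. z l ^ a) * char_sum z d l (place d l)"
proof -
  have "char_sum z d (Suc l) (b * place d l + r) =
    (\<Sum>a<b. \<Sum>i<place d l. z l ^ a * char_value z d l i) + (\<Sum>i<r. z l ^ b * char_value z d l i)"
    unfolding char_sum_def sum_blocks using b r by (simp add: char_value_block)
  then show ?thesis by (simp add: char_sum_def sum_product flip: sum_distrib_left)
qed

text \<open>The block decomposition with d l full blocks and no partial one. It is separate from
  \<open>char_sum_Suc\<close> because d l itself is not a digit.\<close>

lemma char_sum_full_Suc:
  assumes "\<And>i. i < Suc l \<Longrightarrow> 0 < d i"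
  shows "char_sum z d (Suc l) (place d (Suc l)) = (\<Sum>a<d l. z l ^ a) * char_sum z d l (place d l)"
proof -
  have "(\<Sum>n<d l * place d l + 0. char_value z d (Suc l) n) =
    (\<Sum>a<d l. \<Sum>i<place d l. z l ^ a * char_value z d l i)"
    unfolding sum_blocks by (simp add: char_value_block)
  then show ?thesis
    by (simp add: char_sum_def place_Suc sum_product mult.commute)
qed

lemma geometric_sum_root_of_unity:
  fixes z :: complex
  assumes "z ^ n = 1"
  shows "(\<Sum>a<n. z ^ a) = (if z = 1 then of_nat n else 0)"
  using assms by (auto simp: geometric_sum)

text \<open>The full sum is a product of geometric sums, one per digit, and the factor belonging to
  a nontrivial root of unity vanishes.\<close>

lemma char_sum_full_eq_0:
  assumes "\<And>i. i < k \<Longrightarrow> 0 < d i" "\<And>i. i < k \<Longrightarrow> z i ^ d i = 1" "i < k" "z i \<noteq> 1"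
  shows "char_sum z d k (place d k) = 0"
  using assms(1,2,3)
proof (induction k)
  case (Suc k)
  show ?case
  proof (cases "i = k")
    case True
    then show ?thesis using assms(4) Suc.prems by (simp add: char_sum_full_Suc geometric_sum_root_of_unity)
  next
    case False
    then show ?thesis using Suc by (simp add: char_sum_full_Suc)
  qed
qed simp

lemma char_sum_trivial:
  assumes "\<And>i. i < k \<Longrightarrow> z i = 1"
  shows "char_sum z d k n = of_nat n"
  using assms by (simp add: char_sum_def char_value_def)

section \<open>Successive orthogonal projections\<close>

text \<open>That is, \<open>P\<close> is the orthogonal projection of \<open>\<real>\<^sup>k\<close> onto the complement of the first \<open>i\<close> rows
  of \<open>R\<close>.\<close>

definition projector :: "nat \<Rightarrow> (nat \<Rightarrow> nat \<Rightarrow> real) \<Rightarrow> nat \<Rightarrow> (nat \<Rightarrow> nat \<Rightarrow> real) \<Rightarrow> bool" where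
  "projector k R i P \<longleftrightarrow>
     (\<forall>a<k. \<forall>b<k. P a b = P b a) \<and>
     (\<forall>j<i. \<forall>a<k. (\<Sum>b<k. P a b * R j b) = 0) \<and>
     (\<forall>v. (\<forall>j<i. (\<Sum>b<k. R j b * v b) = 0) \<longrightarrow> (\<forall>a<k. (\<Sum>b<k. P a b * v b) = v a))"

lemma projector_0: "projector k R 0 (\<lambda>a b. if a = b then 1 else 0)"
proof -
  have "(\<Sum>b<k. (if a = b then 1 else 0) * v b) = v a" if "a < k" for a and v :: "nat \<Rightarrow> real"
  proof -
    have "(\<Sum>b<k. (if a = b then 1 else 0) * v b) = (\<Sum>b<k. if b = a then v b else 0)"
      by (rule sum.cong) auto
    then show ?thesis using that by simp
  qed
  then show ?thesis by (simp add: projector_def)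
qed

text \<open>Self-adjointness of P, by which P is moved across inner products in the computations
  below.\<close>

lemma projector_swap:
  assumes "projector k R i P"
  shows "(\<Sum>a<k. u a * (\<Sum>b<k. P a b * v b)) = (\<Sum>a<k. (\<Sum>b<k. P a b * u b) * v a)"
proof -
  have "(\<Sum>a<k. u a * (\<Sum>b<k. P a b * v b)) = (\<Sum>a<k. \<Sum>b<k. P a b * u a * v b)"
    by (simp add: sum_distrib_left mult_ac)
  also have "\<dots> = (\<Sum>b<k. \<Sum>a<k. P a b * u a * v b)" by (rule sum.swap)
  also have "\<dots> = (\<Sum>b<k. \<Sum>a<k. P b a * u a * v b)"
    using assms by (intro sum.cong refl) (auto simp: projector_def)
  finally show ?thesis by (simp add: sum_distrib_right)
qed

text \<open>Here q = P R_i is the component of row i orthogonal to the earlier rows, and \<alpha> =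
  R_i . q is its squared length.\<close>

context
  fixes k :: nat and R :: "nat \<Rightarrow> nat \<Rightarrow> real" and i :: nat and P :: "nat \<Rightarrow> nat \<Rightarrow> real"
    and q :: "nat \<Rightarrow> real" and \<alpha> :: real
  assumes P: "projector k R i P"
    and q: "\<And>a. a < k \<Longrightarrow> q a = (\<Sum>b<k. P a b * R i b)"
    and \<alpha>: "\<alpha> = (\<Sum>b<k. R i b * q b)"
begin

text \<open>Moving P over to R_j gives 0. Hence a step along q does not disturb the equations
  already solved.\<close>

lemma projector_row_orth:
  assumes "j < i"
  shows "(\<Sum>b<k. R j b * q b) = 0"
proof -
  have "(\<Sum>b<k. R j b * q b) = (\<Sum>b<k. R j b * (\<Sum>c<k. P b c * R i c))"
    using q by simp
  also have "\<dots> = (\<Sum>a<k. (\<Sum>b<k. P a b * R j b) * R i a)"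
    by (rule projector_swap[OF P])
  also have "\<dots> = 0" using P assms by (simp add: projector_def)
  finally show ?thesis .
qed

text \<open>As \<alpha> = |q|^2, a zero pivot would force q = 0. But v is orthogonal to the earlier
  rows, hence fixed by P, and so 1 = R_i . v = q . v = 0. In the application v is a column of the
  inverse of M; this is why no pivot has to be searched for.\<close>

lemma projector_pivot_nonzero:
  assumes v: "\<And>j. j \<le> i \<Longrightarrow> (\<Sum>b<k. R j b * v b) = (if j = i then 1 else 0)"
  shows "\<alpha> \<noteq> 0"
proof
  assume "\<alpha> = 0"
  have Pq: "(\<Sum>b<k. P a b * q b) = q a" if "a < k" for a
    using P projector_row_orth that unfolding projector_def by blast
  have "\<alpha> = (\<Sum>a<k. R i a * (\<Sum>b<k. P a b * q b))" using Pq by (simp add: \<alpha>)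
  also have "\<dots> = (\<Sum>a<k. (\<Sum>b<k. P a b * R i b) * q a)" by (rule projector_swap[OF P])
  also have "\<dots> = (\<Sum>a<k. q a * q a)" using q by simp
  finally have "\<forall>a\<in>{..<k}. q a * q a = 0"
    using \<open>\<alpha> = 0\<close> by (subst (asm) eq_commute) (simp add: sum_nonneg_eq_0_iff)
  then have q0: "q a = 0" if "a < k" for a using that by auto
  have Pv: "(\<Sum>b<k. P a b * v b) = v a" if "a < k" for a
  proof -
    have "\<forall>j<i. (\<Sum>b<k. R j b * v b) = 0" using v by simp
    then show ?thesis using P that unfolding projector_def by blast
  qed
  have "1 = (\<Sum>a<k. R i a * (\<Sum>b<k. P a b * v b))" using v[of i] Pv by simp
  also have "\<dots> = (\<Sum>a<k. (\<Sum>b<k. P a b * R i b) * v a)" by (rule projector_swap[OF P])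
  also have "\<dots> = (\<Sum>a<k. q a * v a)" using q by simp
  also have "\<dots> = 0" using q0 by simp
  finally show False by simp
qed

text \<open>The matrix subtracted is q q^T / |q|^2, the projection onto the line spanned by
  q.\<close>

lemma projector_step:
  assumes "\<alpha> \<noteq> 0"
  shows "projector k R (Suc i) (\<lambda>a b. P a b - q a * q b / \<alpha>)"
proof -
  have exp: "(\<Sum>b<k. (P a b - q a * q b / \<alpha>) * v b) =
      (\<Sum>b<k. P a b * v b) - q a * (\<Sum>b<k. v b * q b) / \<alpha>" for a v
  proof -
    have "(P a b - q a * q b / \<alpha>) * v b = P a b * v b - q a / \<alpha> * (v b * q b)" for b
      by (simp add: left_diff_distrib)
    then show ?thesis
      by (simp only: sum_subtractf sum_distrib_left[symmetric]) (simp add: field_simps)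
  qed
  have orth: "(\<Sum>b<k. (P a b - q a * q b / \<alpha>) * R j b) = 0" if "j < Suc i" "a < k" for j a
  proof (cases "j = i")
    case True
    then show ?thesis unfolding exp using q[OF that(2)] assms by (simp add: \<alpha>)
  next
    case False
    then have "j < i" using that by simp
    with P that(2) have "(\<Sum>b<k. P a b * R j b) = 0" unfolding projector_def by blast
    with \<open>j < i\<close> show ?thesis unfolding exp by (simp add: projector_row_orth)
  qed
  have fixed: "(\<Sum>b<k. (P a b - q a * q b / \<alpha>) * v b) = v a"
    if v: "\<forall>j<Suc i. (\<Sum>b<k. R j b * v b) = 0" and a: "a < k" for v a
  proof -
    have Pv: "(\<Sum>b<k. P a b * v b) = v a" if "a < k" for a
    proof -
      have "\<forall>j<i. (\<Sum>b<k. R j b * v b) = 0" using v by simp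
      then show ?thesis using P that unfolding projector_def by blast
    qed
    have "(\<Sum>b<k. v b * q b) = (\<Sum>b<k. v b * (\<Sum>c<k. P b c * R i c))" using q by simp
    also have "\<dots> = (\<Sum>a<k. (\<Sum>b<k. P a b * v b) * R i a)" by (rule projector_swap[OF P])
    also have "\<dots> = (\<Sum>a<k. R i a * v a)" using Pv by (simp add: mult.commute)
    also have "\<dots> = 0" using v by simp
    finally show ?thesis unfolding exp using Pv[OF a] by simp
  qed
  have "P a b = P b a" if "a < k" "b < k" for a b using P that by (simp add: projector_def)
  with orth fixed show ?thesis unfolding projector_def by (simp add: mult.commute)
qed

text \<open>A move along q affects only equation i, so its residual, divided by R_i . q = \<alpha>,
  is the right step length.\<close>

lemma projector_solution_step:
  assumes "\<alpha> \<noteq> 0" and y: "\<And>j. j < i \<Longrightarrow> (\<Sum>b<k. R j b * y b) = c j"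
    and y': "\<And>b. b < k \<Longrightarrow> y' b = y b + q b * (c i - (\<Sum>b<k. R i b * y b)) / \<alpha>"
    and j: "j < Suc i"
  shows "(\<Sum>b<k. R j b * y' b) = c j"
proof -
  have "(\<Sum>b<k. R j b * y' b) = (\<Sum>b<k. R j b * y b) +
      (\<Sum>b<k. R j b * q b) * ((c i - (\<Sum>b<k. R i b * y b)) / \<alpha>)"
  proof -
    have "R j b * y' b = R j b * y b + R j b * q b * ((c i - (\<Sum>b<k. R i b * y b)) / \<alpha>)"
      if "b < k" for b using y'[OF that] by (simp add: distrib_left)
    then have "(\<Sum>b<k. R j b * y' b) =
        (\<Sum>b<k. R j b * y b + R j b * q b * ((c i - (\<Sum>b<k. R i b * y b)) / \<alpha>))"
      by (intro sum.cong) auto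
    then show ?thesis by (simp only: sum.distrib sum_distrib_right)
  qed
  then show ?thesis
    using j y projector_row_orth[of j] assms(1) by (cases "j = i") (simp_all add: \<alpha>[symmetric])
qed

end


section \<open>Sampling by inversion\<close>

text \<open>The new bit is appended at the low end, as the program does when it replaces u by 2 u +
  c.\<close>

fun uniform_bits :: "nat \<Rightarrow> nat pmf" where
  "uniform_bits 0 = return_pmf 0"
| "uniform_bits (Suc b) =
     bind_pmf (uniform_bits b) (\<lambda>j. map_pmf (\<lambda>c. 2 * j + of_bool c) (bernoulli_pmf (1/2)))"

lemma pmf_uniform_bits: "pmf (uniform_bits b) j = (if j < 2 ^ b then 1 / 2 ^ b else 0)"
proof (induction b arbitrary: j)
  case (Suc b)
  have inner: "pmf (map_pmf (\<lambda>c. 2 * i + of_bool c) (bernoulli_pmf (1/2))) j =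
      (1/2) * indicator {j div 2} i" for i :: nat
  proof -
    \<comment> \<open>The value j arises only from its half, with the bit given by its
      parity.\<close>
    have vimage: "(\<lambda>c. 2 * i + of_bool c) -` {j} = (if i = j div 2 then {odd j} else {})"
      by (auto simp: vimage_def of_bool_def split: if_splits; presburger)
    show ?thesis unfolding pmf_map vimage by (auto simp: measure_pmf_single)
  qed
  have "pmf (uniform_bits (Suc b)) j = 1/2 * pmf (uniform_bits b) (j div 2)"
    by (simp add: pmf_bind inner measure_pmf_single)
  also have "\<dots> = (if j < 2 ^ Suc b then 1 / 2 ^ Suc b else 0)"
    unfolding Suc by auto
  finally show ?case .
qed simp

lemma set_uniform_bits: "set_pmf (uniform_bits b) = {..<2 ^ b}"
  by (auto simp: set_pmf_eq pmf_uniform_bits)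

section \<open>Rounding loss and total variation distance\<close>

text \<open>The surplus 1, divided by 2^b, becomes the rounding loss charged to each point.\<close>

lemma card_nats_between:
  assumes "x < y"
  shows "real (card {j :: nat. x \<le> real j \<and> real j < y}) \<le> y - x + 1"
proof -
  have "{j :: nat. x \<le> real j \<and> real j < y} \<subseteq> nat ` {\<lceil>x\<rceil>..<\<lceil>y\<rceil>}"
  proof
    fix j :: nat assume "j \<in> {j. x \<le> real j \<and> real j < y}"
    then have "int j \<in> {\<lceil>x\<rceil>..<\<lceil>y\<rceil>}" by (simp add: ceiling_le_iff less_ceiling_iff)
    then show "j \<in> nat ` {\<lceil>x\<rceil>..<\<lceil>y\<rceil>}" by force
  qed
  then have "card {j :: nat. x \<le> real j \<and> real j < y} \<le> card (nat ` {\<lceil>x\<rceil>..<\<lceil>y\<rceil>})"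
    by (rule card_mono[rotated]) simp
  also have "\<dots> \<le> card {\<lceil>x\<rceil>..<\<lceil>y\<rceil>}" by (rule card_image_le) simp
  also have "\<dots> = nat (\<lceil>y\<rceil> - \<lceil>x\<rceil>)" by simp
  finally have "int (card {j :: nat. x \<le> real j \<and> real j < y}) \<le> max 0 (\<lceil>y\<rceil> - \<lceil>x\<rceil>)" by linarith
  moreover have "real_of_int (max 0 (\<lceil>y\<rceil> - \<lceil>x\<rceil>)) \<le> y - x + 1"
    using assms by linarith
  ultimately show ?thesis by linarith
qed

text \<open>The difference has total 0, so its positive and negative parts have equal sums. Both
  functions may be signed, as H is.\<close>

lemma sum_abs_diff_eq_positive_part:
  fixes f g :: "'a \<Rightarrow> real"
  assumes "sum f S = sum g S"
  shows "(\<Sum>x\<in>S. \<bar>f x - g x\<bar>) = 2 * (\<Sum>x\<in>S. max 0 (g x - f x))"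
proof -
  have "(\<Sum>x\<in>S. \<bar>f x - g x\<bar>) = (\<Sum>x\<in>S. 2 * max 0 (g x - f x) + (f x - g x))"
    by (rule sum.cong) (simp_all add: max_def)
  then show ?thesis using assms by (simp add: sum.distrib sum_subtractf sum_distrib_left)
qed

text \<open>The bits \<open>j\<close> that lead to the point \<open>x = \<phi> n\<close> have \<open>j / 2^b\<close> in an interval of length
  \<open>H x\<close> (empty if \<open>H x \<le> 0\<close>), so that \<open>x\<close> gets mass at most \<open>max 0 (H x) + 2^-b\<close>.\<close>

lemma quantile_sampling_error:
  fixes H :: "'a \<Rightarrow> real" and \<phi> :: "nat \<Rightarrow> 'a" and P :: "'a pmf"
  assumes bij: "bij_betw \<phi> {..<N} S"
    and H1: "sum H S = 1"
    and P: "set_pmf P \<subseteq> S"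
    and \<nu>: "\<And>j. j < 2 ^ b \<Longrightarrow> \<nu> j < N \<and>
      (\<Sum>i<\<nu> j. H (\<phi> i)) \<le> real j / 2 ^ b \<and> real j / 2 ^ b < (\<Sum>i<Suc (\<nu> j). H (\<phi> i))"
  defines "Q \<equiv> map_pmf (\<lambda>j. \<phi> (\<nu> j)) (uniform_bits b)"
  shows "set_pmf Q \<subseteq> S" "dTV S (pmf P) (pmf Q) \<le> dTV S H (pmf P) + real N / 2 ^ b"
proof -
  have S: "S = \<phi> ` {..<N}" and inj: "inj_on \<phi> {..<N}" using bij by (auto simp: bij_betw_def)
  then have fin: "finite S" and cardS: "card S = N" by (simp_all add: card_image)
  show Q: "set_pmf Q \<subseteq> S" unfolding Q_def S using \<nu> by (auto simp: set_uniform_bits)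
  have bound: "pmf Q x \<le> max 0 (H x) + 1 / 2 ^ b" if x: "x \<in> S" for x
  proof -
    obtain n where n: "n < N" and xn: "x = \<phi> n" using x S by auto
    define c where "c = (\<Sum>i<n. H (\<phi> i))"
    let ?J = "{j. j < 2 ^ b \<and> \<nu> j = n}"
    have pQ: "pmf Q x = real (card ?J) / 2 ^ b"
    proof -
      \<comment> \<open>Nothing is known about \<nu> from 2^b on, so the two events agree only up to
        values of probability 0.\<close>
      have "pmf Q x = measure (measure_pmf (uniform_bits b)) ?J"
        unfolding Q_def pmf_map
      proof (rule measure_prob_cong_0)
        fix j assume "j \<in> (\<lambda>j. \<phi> (\<nu> j)) -` {x} - ?J"
        then show "pmf (uniform_bits b) j = 0"
          using \<nu>[of j] n xn inj by (auto simp: pmf_uniform_bits inj_on_def)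
      next
        fix j assume "j \<in> ?J - (\<lambda>j. \<phi> (\<nu> j)) -` {x}"
        then show "pmf (uniform_bits b) j = 0" using xn by auto
      qed
      also have "\<dots> = (\<Sum>j\<in>?J. pmf (uniform_bits b) j)"
        by (rule measure_measure_pmf_finite) simp
      also have "\<dots> = (\<Sum>j\<in>?J. 1 / 2 ^ b)" by (rule sum.cong) (simp_all add: pmf_uniform_bits)
      finally show ?thesis by simp
    qed
    have J: "c * 2 ^ b \<le> real j \<and> real j < (c + H x) * 2 ^ b" if "j \<in> ?J" for j
      using \<nu>[of j] that xn by (simp add: c_def field_simps)
    show ?thesis
    proof (cases "H x > 0")
      case True
      have "real (card ?J) \<le> real (card {j :: nat. c * 2 ^ b \<le> real j \<and> real j < (c + H x) * 2 ^ b})"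
      proof (intro of_nat_mono card_mono)
        have "{j :: nat. c * 2 ^ b \<le> real j \<and> real j < (c + H x) * 2 ^ b} \<subseteq> {..nat \<lceil>(c + H x) * 2 ^ b\<rceil>}"
          by (auto simp: le_nat_iff) linarith
        then show "finite {j :: nat. c * 2 ^ b \<le> real j \<and> real j < (c + H x) * 2 ^ b}"
          by (rule finite_subset) simp
      qed (use J in blast)
      also have "\<dots> \<le> (c + H x) * 2 ^ b - c * 2 ^ b + 1"
        using True by (intro card_nats_between) (simp add: distrib_right)
      finally show ?thesis using True unfolding pQ by (simp add: field_simps)
    next
      case False
      have "?J = {}"
      proof (rule ccontr)
        assume "?J \<noteq> {}"
        then obtain j where "j \<in> ?J" by blast
        with J have "c * 2 ^ b < (c + H x) * 2 ^ b" by (meson le_less_trans)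
        with False show False by simp
      qed
      then show ?thesis unfolding pQ by (simp only:) simp
    qed
  qed
  have sP: "sum (pmf P) S = 1" and sQ: "sum (pmf Q) S = 1"
    using P Q fin by (simp_all add: sum_pmf_eq_1)
  have "dTV S (pmf P) (pmf Q) = (\<Sum>x\<in>S. max 0 (pmf Q x - pmf P x))"
    unfolding dTV_def using sP sQ by (simp add: sum_abs_diff_eq_positive_part)
  also have "\<dots> \<le> (\<Sum>x\<in>S. max 0 (H x - pmf P x) + 1 / 2 ^ b)"
  proof (rule sum_mono)
    fix x assume "x \<in> S"
    \<comment> \<open>Where H x is negative, replacing it by 0 costs nothing because
      \<open>pmf P x\<close> is nonnegative.\<close>
    from bound[OF this] pmf_nonneg[of P x]
    have "pmf Q x - pmf P x \<le> max 0 (H x - pmf P x) + 1 / 2 ^ b" by linarith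
    moreover have "0 \<le> max 0 (H x - pmf P x) + 1 / 2 ^ b" by simp
    ultimately show "max 0 (pmf Q x - pmf P x) \<le> max 0 (H x - pmf P x) + 1 / 2 ^ b" by linarith
  qed
  also have "\<dots> = (\<Sum>x\<in>S. max 0 (H x - pmf P x)) + real N / 2 ^ b"
    by (simp add: sum.distrib cardS)
  also have "(\<Sum>x\<in>S. max 0 (H x - pmf P x)) = dTV S H (pmf P)"
    using sum_abs_diff_eq_positive_part[of "pmf P" S H] sP H1
    by (simp add: dTV_def abs_minus_commute)
  finally show "dTV S (pmf P) (pmf Q) \<le> dTV S H (pmf P) + real N / 2 ^ b" .
qed


section \<open>Lattice points and frequencies\<close>

text \<open>The adjugate multiplied by the determinant is an integral inverse, since the determinant
  squares to 1.\<close>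

lemma int_mat_inverse:
  fixes A :: "int mat"
  assumes A: "A \<in> carrier_mat k k" and det: "\<bar>Determinant.det A\<bar> = 1"
  obtains B where "B \<in> carrier_mat k k" "A * B = 1\<^sub>m k" "B * A = 1\<^sub>m k"
proof
  let ?B = "Determinant.det A \<cdot>\<^sub>m adj_mat A"
  have adj: "adj_mat A \<in> carrier_mat k k"
    "A * adj_mat A = Determinant.det A \<cdot>\<^sub>m 1\<^sub>m k" "adj_mat A * A = Determinant.det A \<cdot>\<^sub>m 1\<^sub>m k"
    using adj_mat[OF A] by auto
  have sq: "Determinant.det A * Determinant.det A = 1" using det by (metis abs_mult_self_eq mult_1)
  show "?B \<in> carrier_mat k k" using adj by simp
  show "A * ?B = 1\<^sub>m k"
    using A adj sq by (intro eq_matI) (auto simp: mult_smult_distrib)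
  show "?B * A = 1\<^sub>m k"
    using A adj sq by (intro eq_matI) (auto simp: mult_smult_assoc_mat)
qed

lemma inverse_mult_mat_vec:
  fixes A :: "'a :: comm_ring_1 mat"
  assumes "A \<in> carrier_mat k k" "B \<in> carrier_mat k k" "B * A = 1\<^sub>m k" "u \<in> carrier_vec k"
  shows "B *\<^sub>v (A *\<^sub>v u) = u"
proof -
  have "B *\<^sub>v (A *\<^sub>v u) = (B * A) *\<^sub>v u"
    by (rule assoc_mult_mat_vec[symmetric]) (rule assms)+
  then show ?thesis using assms(3,4) by (simp only: one_mult_mat_vec)
qed

lemma rvec_mult_mat_vec:
  assumes "A \<in> carrier_mat n k" "v \<in> carrier_vec k"
  shows "rvec (A *\<^sub>v v) = rmat A *\<^sub>v rvec v"
  using assms by (intro eq_vecI) (auto simp: scalar_prod_def)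

lemma real_mat_inverse:
  assumes M: "M \<in> carrier_mat k k" and det: "Determinant.det M \<noteq> 0"
  obtains B :: "real mat" where "B \<in> carrier_mat k k" "rmat M * B = 1\<^sub>m k" "B * rmat M = 1\<^sub>m k"
proof -
  have "Determinant.det (rmat M) \<noteq> 0" using det by (simp add: of_int_hom.hom_det)
  moreover have rM: "rmat M \<in> carrier_mat k k" using M by simp
  ultimately have "rmat M \<in> Units (ring_mat TYPE(real) k ())"
    by (intro det_non_zero_imp_unit)
  then show ?thesis using that unfolding Units_def by (auto simp: ring_mat_def)
qed

text \<open>\<xi> . (M t) = (M^T \<xi>) . t. Consequently the character of \<xi> is constant on
  classes modulo M Z^k.\<close>

lemma dual_lattice_scalar_prod:
  assumes M: "M \<in> carrier_mat k k" and \<xi>: "\<xi> \<in> dual_lattice k M" and t: "t \<in> carrier_vec k"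
  shows "scalar_prod \<xi> (rvec (M *\<^sub>v t)) \<in> \<int>"
proof -
  from \<xi> obtain z where \<xi>k: "\<xi> \<in> carrier_vec k" and z: "z \<in> carrier_vec k"
    and eq: "transpose_mat (rmat M) *\<^sub>v \<xi> = rvec z"
    by (auto simp: dual_lattice_def)
  have "scalar_prod \<xi> (rvec (M *\<^sub>v t)) = scalar_prod (transpose_mat (rmat M) *\<^sub>v \<xi>) (rvec t)"
    using M t \<xi>k by (simp add: rvec_mult_mat_vec transpose_vec_mult_scalar)
  also have "\<dots> = of_int (scalar_prod z t)"
    using z t by (simp add: eq scalar_prod_def)
  finally show ?thesis by simp
qed

lemma coset_refl: "\<xi> \<in> carrier_vec k \<Longrightarrow> \<xi> \<in> coset k \<xi>"
  by (auto simp: coset_def mod_Z_def Zvecs_def intro!: image_eqI[of _ _ "0\<^sub>v k"])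

text \<open>The input lists arbitrary representatives of the cosets. They stay in the dual lattice
  because M^T maps integer vectors to integer vectors.\<close>

lemma coset_in_freqs:
  assumes M: "M \<in> carrier_mat k k" and \<xi>: "\<xi> \<in> carrier_vec k" and c: "coset k \<xi> \<in> freqs k M"
  shows "\<xi> \<in> dual_lattice k M"
proof -
  from c obtain \<eta> where \<eta>: "\<eta> \<in> dual_lattice k M" and "coset k \<xi> = coset k \<eta>"
    by (auto simp: freqs_def)
  then have "\<xi> \<in> coset k \<eta>" using coset_refl[OF \<xi>] by simp
  then obtain z where z: "z \<in> carrier_vec k" and diff: "\<eta> - \<xi> = rvec z"
    by (auto simp: coset_def mod_Z_def Zvecs_def)
  from \<eta> obtain u where u: "\<eta> \<in> carrier_vec k" "u \<in> carrier_vec k"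
    "transpose_mat (rmat M) *\<^sub>v \<eta> = rvec u"
    by (auto simp: dual_lattice_def)
  have "\<xi> = \<eta> - rvec z" unfolding diff[symmetric] using \<xi> u by (intro eq_vecI) auto
  then have "transpose_mat (rmat M) *\<^sub>v \<xi> = rvec u - transpose_mat (rmat M) *\<^sub>v rvec z"
    using M u z by (simp add: mult_minus_distrib_mat_vec)
  also have "transpose_mat (rmat M) *\<^sub>v rvec z = rvec (transpose_mat M *\<^sub>v z)"
    using M z by (intro eq_vecI) (auto simp: scalar_prod_def)
  also have "rvec u - \<dots> = rvec (u - transpose_mat M *\<^sub>v z)"
    using M u z by (intro eq_vecI) auto
  finally show ?thesis using \<xi> M u z unfolding dual_lattice_def
    by (intro CollectI conjI bexI[of _ "u - transpose_mat M *\<^sub>v z"]) auto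
qed

text \<open>The cell coordinates of x and x' differ by the integer vector t, whose entries lie
  strictly between -1 and 1 because the cell is half-open.\<close>

lemma fund_points_unique:
  assumes M: "M \<in> carrier_mat k k" and det: "Determinant.det M \<noteq> 0" and m: "m \<in> carrier_vec k"
    and x: "x \<in> fund_points k M m" "x' \<in> fund_points k M m"
    and t: "t \<in> carrier_vec k" "x = x' + M *\<^sub>v t"
  shows "x = x'"
proof -
  obtain B where B: "B \<in> carrier_mat k k" "B * rmat M = 1\<^sub>m k"
    using real_mat_inverse[OF M det] by metis
  obtain y y' where y: "y \<in> carrier_vec k" "\<And>i. i < k \<Longrightarrow> - 1/2 < y $ i \<and> y $ i \<le> 1/2"
      "rvec x = m + rmat M *\<^sub>v y"
    and y': "y' \<in> carrier_vec k" "\<And>i. i < k \<Longrightarrow> - 1/2 < y' $ i \<and> y' $ i \<le> 1/2"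
      "rvec x' = m + rmat M *\<^sub>v y'"
    and xk: "x' \<in> carrier_vec k"
    using x by (auto simp: fund_points_def)
  have "rvec x = rvec x' + rmat M *\<^sub>v rvec t"
    unfolding rvec_mult_mat_vec[OF M t(1), symmetric] t(2) using M t(1) xk by (intro eq_vecI) auto
  then have eq: "m + rmat M *\<^sub>v y = (m + rmat M *\<^sub>v y') + rmat M *\<^sub>v rvec t"
    unfolding y(3) y'(3) .
  have "rmat M *\<^sub>v y = rmat M *\<^sub>v (y' + rvec t)"
  proof (rule eq_vecI)
    fix i assume i: "i < dim_vec (rmat M *\<^sub>v (y' + rvec t))"
    then have "(m + rmat M *\<^sub>v y) $ i = ((m + rmat M *\<^sub>v y') + rmat M *\<^sub>v rvec t) $ i"
      using eq by simp
    moreover have "rmat M *\<^sub>v (y' + rvec t) = rmat M *\<^sub>v y' + rmat M *\<^sub>v rvec t"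
      using M y' t by (intro mult_add_distrib_mat_vec[of _ k k]) auto
    ultimately show "(rmat M *\<^sub>v y) $ i = (rmat M *\<^sub>v (y' + rvec t)) $ i"
      using i M m y(1) y'(1) t(1) by simp
  qed (use M in auto)
  then have "B *\<^sub>v (rmat M *\<^sub>v y) = B *\<^sub>v (rmat M *\<^sub>v (y' + rvec t))" by simp
  then have yy: "y = y' + rvec t"
    using inverse_mult_mat_vec[of "rmat M" k B] B M y(1) y'(1) t(1) by simp
  have "t $ i = 0" if i: "i < k" for i
  proof -
    have "y $ i = y' $ i + real_of_int (t $ i)" using yy y'(1) t(1) i by simp
    then have "\<bar>real_of_int (t $ i)\<bar> < 1" using y(2)[OF i] y'(2)[OF i] by linarith
    then show ?thesis by linarith
  qed
  then have "t = 0\<^sub>v k" using t(1) by (intro eq_vecI) auto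
  moreover have "M *\<^sub>v 0\<^sub>v k = 0\<^sub>v k" using M by (intro eq_vecI) (auto simp: scalar_prod_def)
  ultimately show ?thesis using t(2) xk by simp
qed

text \<open>Adding the floor of 1/2 - y_i moves y_i into (-1/2, 1/2]; a floor of y_i + 1/2 would put
  the wrong endpoint into the interval.\<close>

lemma fund_points_round:
  assumes M: "M \<in> carrier_mat k k" and m: "m \<in> carrier_vec k" and v: "v \<in> carrier_vec k"
    and y: "y \<in> carrier_vec k" "rmat M *\<^sub>v y = rvec v - m"
  shows "v + M *\<^sub>v vec k (\<lambda>i. \<lfloor>1/2 - y $ i\<rfloor>) \<in> fund_points k M m"
proof -
  let ?z = "vec k (\<lambda>i. \<lfloor>1/2 - y $ i\<rfloor>)"
  have z: "rvec ?z \<in> carrier_vec k" by simp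
  have "rvec (v + M *\<^sub>v ?z) = rvec v + rmat M *\<^sub>v rvec ?z"
    unfolding rvec_mult_mat_vec[OF M vec_carrier, symmetric] using M v by (intro eq_vecI) auto
  also have "\<dots> = m + (rmat M *\<^sub>v y + rmat M *\<^sub>v rvec ?z)"
    unfolding y(2) using M m v by (intro eq_vecI) auto
  also have "rmat M *\<^sub>v y + rmat M *\<^sub>v rvec ?z = rmat M *\<^sub>v (y + rvec ?z)"
    using M y(1) z by (intro mult_add_distrib_mat_vec[of _ k k, symmetric]) auto
  finally have "rvec (v + M *\<^sub>v ?z) = m + rmat M *\<^sub>v (y + rvec ?z)" .
  moreover have "- 1/2 < (y + rvec ?z) $ i \<and> (y + rvec ?z) $ i \<le> 1/2" if "i < k" for i
  proof -
    have "(y + rvec ?z) $ i = y $ i + of_int \<lfloor>1/2 - y $ i\<rfloor>" using that y(1) by simp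
    then show ?thesis by linarith
  qed
  ultimately show ?thesis unfolding fund_points_def
    using M v y(1) z by (intro CollectI conjI bexI[of _ "y + rvec ?z"]) auto
qed

lemma cis_sum: "cis (\<Sum>l<k. f l) = (\<Prod>l<k. cis (f l))" for k :: nat
  by (induction k) (simp_all flip: cis_mult)

section \<open>Numbering the points of S by digit vectors\<close>

locale sampler_data =
  fixes k :: nat and M :: "int mat" and m :: "real vec" and U D V :: "int mat"
  assumes M: "M \<in> carrier_mat k k" and det: "Determinant.det M \<noteq> 0" and m: "m \<in> carrier_vec k"
    and smith: "smith_decomp k M U D V"
begin

lemma U: "U \<in> carrier_mat k k" and D: "D \<in> carrier_mat k k" and V: "V \<in> carrier_mat k k"
  and detU: "\<bar>Determinant.det U\<bar> = 1" and detV: "\<bar>Determinant.det V\<bar> = 1"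
  and M_eq: "M = U * D * V" and D0: "i < k \<Longrightarrow> j < k \<Longrightarrow> i \<noteq> j \<Longrightarrow> D $$ (i, j) = 0"
  using smith by (auto simp: smith_decomp_def diagonal_mat_def)

definition d :: "nat \<Rightarrow> nat" where
  "d i = nat \<bar>D $$ (i, i)\<bar>"

definition N :: nat where
  "N = place d k"

lemma det_D: "Determinant.det D = (\<Prod>i<k. D $$ (i, i))"
proof -
  have "upper_triangular D" using D D0 by (auto simp: upper_triangular_def)
  then have "Determinant.det D = prod_list (diag_mat D)"
    using det_upper_triangular D by blast
  also have "\<dots> = (\<Prod>i<k. D $$ (i, i))"
    using D by (simp add: prod_list_diag_prod lessThan_atLeast0)
  finally show ?thesis .
qed

lemma abs_det: "\<bar>Determinant.det M\<bar> = int N"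
proof -
  have "Determinant.det M = Determinant.det U * Determinant.det D * Determinant.det V"
    unfolding M_eq using U D V by (simp add: det_mult[of _ k])
  then have "\<bar>Determinant.det M\<bar> = \<bar>Determinant.det D\<bar>"
    using detU detV by (simp add: abs_mult)
  also have "\<dots> = int N"
    by (simp add: det_D abs_prod N_def place_def d_def)
  finally show ?thesis .
qed

lemma N_pos: "0 < N"
  using abs_det det by (metis of_nat_0_less_iff zero_less_abs_iff)

lemma d_pos: "i < k \<Longrightarrow> 0 < d i"
  using N_pos by (auto simp: N_def place_def intro!: Nat.gr0I)

lemma D_nonzero: "i < k \<Longrightarrow> D $$ (i, i) \<noteq> 0"
  using d_pos[of i] by (auto simp: d_def)

definition code :: "nat \<Rightarrow> int vec" where
  "code n = vec k (\<lambda>i. int (digit d n i))"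

lemma code_carrier [simp]: "code n \<in> carrier_vec k"
  by (simp add: code_def)

text \<open>A relation with a uniqueness lemma, so that whatever point the program computes in the
  right class and cell is recognized as \<open>point n\<close> by \<open>point_eqI\<close>.\<close>

definition represents_code :: "nat \<Rightarrow> int vec \<Rightarrow> bool" where
  "represents_code n x \<longleftrightarrow> x \<in> fund_points k M m \<and>
     (\<exists>t \<in> carrier_vec k. x = U *\<^sub>v code n + M *\<^sub>v t)"

lemma represents_code_unique:
  assumes "represents_code n x" "represents_code n x'"
  shows "x = x'"
proof -
  from assms obtain t t' where t: "t \<in> carrier_vec k" "t' \<in> carrier_vec k"
    "x = U *\<^sub>v code n + M *\<^sub>v t" "x' = U *\<^sub>v code n + M *\<^sub>v t'"
    by (auto simp: represents_code_def)
  then have eq: "x = x' + M *\<^sub>v (t - t')"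
    using M U by (simp add: mult_minus_distrib_mat_vec[of _ k k]) (intro eq_vecI; simp)
  have "x \<in> fund_points k M m" "x' \<in> fund_points k M m"
    using assms by (simp_all add: represents_code_def)
  moreover have "t - t' \<in> carrier_vec k" using t(1,2) by simp
  ultimately show ?thesis using eq by (rule fund_points_unique[OF M det m])
qed

lemma represents_code_exists: "\<exists>x. represents_code n x"
proof -
  obtain B where B: "B \<in> carrier_mat k k" "rmat M * B = 1\<^sub>m k"
    using real_mat_inverse[OF M det] by metis
  define y where "y = B *\<^sub>v (rvec (U *\<^sub>v code n) - m)"
  have v: "rvec (U *\<^sub>v code n) - m \<in> carrier_vec k" using U m by simp
  have "rmat M *\<^sub>v y = rvec (U *\<^sub>v code n) - m"
    unfolding y_def using M B v by (intro inverse_mult_mat_vec) auto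
  then have "U *\<^sub>v code n + M *\<^sub>v vec k (\<lambda>i. \<lfloor>1/2 - y $ i\<rfloor>) \<in> fund_points k M m"
    using B U m by (intro fund_points_round[OF M m]) (auto simp: y_def)
  then show ?thesis unfolding represents_code_def
    by (intro exI conjI bexI[of _ "vec k (\<lambda>i. \<lfloor>1/2 - y $ i\<rfloor>)"] refl) auto
qed

definition point :: "nat \<Rightarrow> int vec" where
  "point n = (THE x. represents_code n x)"

lemma represents_code_point: "represents_code n (point n)"
  unfolding point_def using represents_code_exists represents_code_unique by (metis theI)

lemma point_eqI: "represents_code n x \<Longrightarrow> point n = x"
  using represents_code_point represents_code_unique by blast

lemma D_mult_vec:
  assumes "v \<in> carrier_vec k" "i < k"
  shows "(D *\<^sub>v v) $ i = D $$ (i, i) * v $ i"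
proof -
  have "(D *\<^sub>v v) $ i = (\<Sum>j<k. D $$ (i, j) * v $ j)"
    using D assms by (simp add: scalar_prod_def lessThan_atLeast0)
  also have "\<dots> = (\<Sum>j<k. if j = i then D $$ (i, i) * v $ i else 0)"
    using assms by (intro sum.cong) (auto simp: D0)
  also have "\<dots> = D $$ (i, i) * v $ i" using assms by simp
  finally show ?thesis .
qed

lemma M_mult_vec: "t \<in> carrier_vec k \<Longrightarrow> M *\<^sub>v t = U *\<^sub>v (D *\<^sub>v (V *\<^sub>v t))"
  unfolding M_eq using U D V by (simp add: assoc_mult_mat_vec[of _ k k _ k])

lemma mult_U_cancel:
  assumes "u \<in> carrier_vec k" "v \<in> carrier_vec k" "U *\<^sub>v u = U *\<^sub>v v"
  shows "u = v"
proof -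
  obtain B where B: "B \<in> carrier_mat k k" "B * U = 1\<^sub>m k"
    using int_mat_inverse[OF U detU] by metis
  have "B *\<^sub>v (U *\<^sub>v u) = B *\<^sub>v (U *\<^sub>v v)" using assms by simp
  then show ?thesis using inverse_mult_mat_vec[OF U B] assms(1,2) by metis
qed

text \<open>Cancelling U in M = U D V turns congruence modulo M Z^k into congruence of each entry
  modulo d i.\<close>

lemma dvd_code_diff:
  assumes "t \<in> carrier_vec k" "t' \<in> carrier_vec k" "v \<in> carrier_vec k" "v' \<in> carrier_vec k"
    and "U *\<^sub>v v + M *\<^sub>v t = U *\<^sub>v v' + M *\<^sub>v t'" "i < k"
  shows "int (d i) dvd v $ i - v' $ i"
proof -
  have Vt: "V *\<^sub>v t \<in> carrier_vec k" "V *\<^sub>v t' \<in> carrier_vec k" using V assms by auto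
  have sums: "v + D *\<^sub>v (V *\<^sub>v t) \<in> carrier_vec k" "v' + D *\<^sub>v (V *\<^sub>v t') \<in> carrier_vec k"
    using assms(1-4) D V by auto
  have "U *\<^sub>v (v + D *\<^sub>v (V *\<^sub>v t)) = U *\<^sub>v (v' + D *\<^sub>v (V *\<^sub>v t'))"
    using assms U D V by (simp add: M_mult_vec mult_add_distrib_mat_vec[of _ k k])
  from mult_U_cancel[OF sums this] have "(v + D *\<^sub>v (V *\<^sub>v t)) $ i = (v' + D *\<^sub>v (V *\<^sub>v t')) $ i" by simp
  then have "v $ i - v' $ i = D $$ (i, i) * ((V *\<^sub>v t') $ i - (V *\<^sub>v t) $ i)"
    using assms D_mult_vec[OF Vt(1) \<open>i < k\<close>] D_mult_vec[OF Vt(2) \<open>i < k\<close>] D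
    by (simp add: algebra_simps)
  then show ?thesis by (simp add: d_def)
qed

text \<open>Injectivity: digits in [0, d i) that are congruent modulo d i agree. Surjectivity: the
  entries of U^-1 x are reduced modulo d i, and V^-1 applied to the quotients yields the integer
  vector t of \<open>represents_code\<close>.\<close>

lemma bij_point: "bij_betw point {..<N} (fund_points k M m)"
  unfolding bij_betw_def
proof (intro conjI inj_onI equalityI subsetI)
  fix n n' assume n: "n \<in> {..<N}" "n' \<in> {..<N}" and eq: "point n = point n'"
  obtain t t' where t: "t \<in> carrier_vec k" "t' \<in> carrier_vec k"
    "U *\<^sub>v code n + M *\<^sub>v t = U *\<^sub>v code n' + M *\<^sub>v t'"
    using represents_code_point[of n] represents_code_point[of n'] eq
    by (auto simp: represents_code_def)
  show "n = n'"
  proof (rule digits_determine)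
    fix i assume i: "i < k"
    have "int (d i) dvd int (digit d n i) - int (digit d n' i)"
      using dvd_code_diff[OF t(1,2) code_carrier code_carrier t(3) i] i by (simp add: code_def)
    moreover have "\<bar>int (digit d n i) - int (digit d n' i)\<bar> < int (d i)"
      using digit_less[of d i n] digit_less[of d i n'] d_pos[OF i] by linarith
    ultimately have "int (digit d n i) - int (digit d n' i) = 0"
      using dvd_imp_le_int[of "int (digit d n i) - int (digit d n' i)" "int (d i)"] by linarith
    then show "digit d n i = digit d n' i" by simp
  qed (use n in \<open>auto simp: N_def\<close>)
next
  fix x assume "x \<in> point ` {..<N}"
  then show "x \<in> fund_points k M m"
    using represents_code_point by (auto simp: represents_code_def)
next
  fix x assume x: "x \<in> fund_points k M m"
  then have xk: "x \<in> carrier_vec k" by (simp add: fund_points_def)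
  obtain BU where BU: "BU \<in> carrier_mat k k" "U * BU = 1\<^sub>m k"
    using int_mat_inverse[OF U detU] by metis
  obtain BV where BV: "BV \<in> carrier_mat k k" "V * BV = 1\<^sub>m k"
    using int_mat_inverse[OF V detV] by metis
  define v where "v = BU *\<^sub>v x"
  have v: "v \<in> carrier_vec k" using BU xk by (simp add: v_def)
  have Uv: "U *\<^sub>v v = x"
    unfolding v_def by (rule inverse_mult_mat_vec[OF BU(1) U BU(2) xk])
  obtain n where n: "n < N" "\<And>i. i < k \<Longrightarrow> digit d n i = nat (v $ i mod int (d i))"
    using digits_surj[of k d "\<lambda>i. nat (v $ i mod int (d i))"] d_pos
    by (auto simp: N_def nat_less_iff)
  \<comment> \<open>The quotient is by the signed entry of D, not by d i, so that D q = v - code n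
    holds for negative entries as well.\<close>
  define q where "q = vec k (\<lambda>i. (v $ i - code n $ i) div D $$ (i, i))"
  have q: "q \<in> carrier_vec k" by (simp add: q_def)
  have Dq: "D *\<^sub>v q = v - code n"
  proof (rule eq_vecI)
    fix i assume "i < dim_vec (v - code n)"
    then have i: "i < k" by (simp add: code_def)
    have "int (d i) dvd v $ i - code n $ i"
      using n(2)[OF i] d_pos[OF i] i by (simp add: code_def)
    then have "D $$ (i, i) dvd v $ i - code n $ i" by (simp add: d_def)
    then show "(D *\<^sub>v q) $ i = (v - code n) $ i"
      using i v by (subst D_mult_vec[OF q i]) (simp add: q_def code_def)
  qed (use D in \<open>simp add: code_def\<close>)
  have "M *\<^sub>v (BV *\<^sub>v q) = U *\<^sub>v (v - code n)"
    using M_mult_vec[of "BV *\<^sub>v q"] inverse_mult_mat_vec[OF BV(1) V BV(2) q] BV q by (simp add: Dq)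
  also have "\<dots> = x - U *\<^sub>v code n"
    using U v Uv by (simp add: mult_minus_distrib_mat_vec[of _ k k])
  finally have "x = U *\<^sub>v code n + M *\<^sub>v (BV *\<^sub>v q)"
    using xk U by (intro eq_vecI) auto
  then have "represents_code n x"
    unfolding represents_code_def using x BV q by (intro conjI bexI[of _ "BV *\<^sub>v q"]) auto
  then show "x \<in> point ` {..<N}" using n(1) point_eqI[of n x] by (intro image_eqI[of _ _ n]) simp_all
qed

section \<open>Characters in digit coordinates\<close>

text \<open>Component l of U^T \<xi>. As e(x) = exp(-2 pi i x), the character e(-\<xi> . x) has a
  positive exponent, whence the sign in \<open>root\<close>.\<close>

definition angle :: "real vec \<Rightarrow> nat \<Rightarrow> real" where
  "angle \<xi> l = (\<Sum>a<k. \<xi> $ a * real_of_int (U $$ (a, l)))"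

definition root :: "real vec \<Rightarrow> nat \<Rightarrow> complex" where
  "root \<xi> l = cis (2 * pi * angle \<xi> l)"

lemma scalar_prod_U:
  assumes "\<xi> \<in> carrier_vec k" "v \<in> carrier_vec k"
  shows "scalar_prod \<xi> (rvec (U *\<^sub>v v)) = (\<Sum>l<k. angle \<xi> l * real_of_int (v $ l))"
proof -
  have "scalar_prod \<xi> (rvec (U *\<^sub>v v)) =
      (\<Sum>a<k. \<Sum>l<k. \<xi> $ a * (real_of_int (U $$ (a, l)) * real_of_int (v $ l)))"
    using U assms by (simp add: scalar_prod_def lessThan_atLeast0 sum_distrib_left)
  also have "\<dots> = (\<Sum>l<k. \<Sum>a<k. \<xi> $ a * (real_of_int (U $$ (a, l)) * real_of_int (v $ l)))"
    by (rule sum.swap)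
  finally show ?thesis by (simp add: angle_def sum_distrib_right mult.assoc)
qed

lemma cis_Ints: "x \<in> \<int> \<Longrightarrow> cis (2 * pi * x) = 1"
  by (rule cis_multiple_2pi)

text \<open>U D e_l = M V^-1 e_l lies in M Z^k, so its product with \<xi>, which is D_ll times the
  angle, is an integer. The sign of D_ll does not affect integrality.\<close>

lemma root_power_d:
  assumes \<xi>: "\<xi> \<in> dual_lattice k M" and l: "l < k"
  shows "root \<xi> l ^ d l = 1"
proof -
  have \<xi>k: "\<xi> \<in> carrier_vec k" using \<xi> by (simp add: dual_lattice_def)
  obtain BV where BV: "BV \<in> carrier_mat k k" "V * BV = 1\<^sub>m k"
    using int_mat_inverse[OF V detV] by metis
  have e: "unit_vec k l \<in> carrier_vec k" by simp
  have "V *\<^sub>v (BV *\<^sub>v unit_vec k l) = unit_vec k l"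
    by (rule inverse_mult_mat_vec[OF BV(1) V BV(2) e])
  then have "M *\<^sub>v (BV *\<^sub>v unit_vec k l) = U *\<^sub>v (D *\<^sub>v unit_vec k l)"
    using M_mult_vec[of "BV *\<^sub>v unit_vec k l"] BV by simp
  then have "scalar_prod \<xi> (rvec (U *\<^sub>v (D *\<^sub>v unit_vec k l))) \<in> \<int>"
    using dual_lattice_scalar_prod[OF M \<xi>, of "BV *\<^sub>v unit_vec k l"] BV by simp
  also have "scalar_prod \<xi> (rvec (U *\<^sub>v (D *\<^sub>v unit_vec k l))) =
      (\<Sum>i<k. angle \<xi> i * real_of_int ((D *\<^sub>v unit_vec k l) $ i))"
    using D \<xi>k by (intro scalar_prod_U) auto
  also have "\<dots> = (\<Sum>i<k. if i = l then angle \<xi> l * real_of_int (D $$ (l, l)) else 0)"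
    using e l by (intro sum.cong) (auto simp: D_mult_vec)
  also have "\<dots> = angle \<xi> l * real_of_int (D $$ (l, l))" using l by simp
  finally have "angle \<xi> l * real_of_int (D $$ (l, l)) \<in> \<int>" .
  then have "real (d l) * angle \<xi> l \<in> \<int>"
    unfolding d_def by (cases "D $$ (l, l) \<ge> 0") (auto simp: mult.commute)
  then have "cis (2 * pi * (real (d l) * angle \<xi> l)) = 1" by (rule cis_Ints)
  then show ?thesis unfolding root_def Complex.DeMoivre by (simp only: mult.left_commute)
qed

text \<open>\<open>point n\<close> differs from U times the digit vector by an element of M Z^k,
  where the character equals 1.\<close>

lemma e_coset_point:
  assumes \<xi>: "\<xi> \<in> dual_lattice k M"
  shows "e_coset (coset k \<xi>) (point n) = char_value (root \<xi>) d k n"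
proof -
  have \<xi>k: "\<xi> \<in> carrier_vec k" using \<xi> by (simp add: dual_lattice_def)
  obtain t where t: "t \<in> carrier_vec k" "point n = U *\<^sub>v code n + M *\<^sub>v t"
    and S: "point n \<in> fund_points k M m"
    using represents_code_point[of n] by (auto simp: represents_code_def)
  then have pk: "point n \<in> carrier_vec k" by (simp add: fund_points_def)
  have eq: "rvec (point n) = rvec (U *\<^sub>v code n) + rvec (M *\<^sub>v t)"
    using t U M by (intro eq_vecI) auto
  then have sp: "scalar_prod \<xi> (rvec (point n)) =
      (\<Sum>l<k. angle \<xi> l * real (digit d n l)) + scalar_prod \<xi> (rvec (M *\<^sub>v t))"
  proof -
    have "scalar_prod \<xi> (rvec (U *\<^sub>v code n) + rvec (M *\<^sub>v t)) =
        scalar_prod \<xi> (rvec (U *\<^sub>v code n)) + scalar_prod \<xi> (rvec (M *\<^sub>v t))"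
      using \<xi>k U M t(1) by (intro scalar_prod_add_distrib[of _ k]) auto
    then show ?thesis
      using eq scalar_prod_U[OF \<xi>k code_carrier, of n] by (simp add: code_def)
  qed
  have "e_coset (coset k \<xi>) (point n) = cis (2 * pi * scalar_prod \<xi> (rvec (point n)))"
    unfolding e_coset_eq[OF \<xi>k pk] by (simp add: e_char_def cis_conv_exp mult_ac)
  also have "\<dots> = cis (\<Sum>l<k. 2 * pi * angle \<xi> l * real (digit d n l))"
    unfolding sp distrib_left cis_mult[symmetric] cis_Ints[OF dual_lattice_scalar_prod[OF M \<xi> t(1)]]
    by (simp add: sum_distrib_left mult_ac)
  also have "\<dots> = (\<Prod>l<k. cis (2 * pi * angle \<xi> l * real (digit d n l)))"
    by (rule cis_sum)
  also have "\<dots> = char_value (root \<xi>) d k n"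
    unfolding char_value_def root_def Complex.DeMoivre by (simp add: mult_ac)
  finally show ?thesis .
qed

text \<open>If all angles are integers, then U^T \<xi> is integral, and \<xi> with it because U is
  unimodular.\<close>

lemma root_eq_1_imp_trivial:
  assumes \<xi>: "\<xi> \<in> carrier_vec k" and one: "\<And>l. l < k \<Longrightarrow> root \<xi> l = 1"
  shows "coset k \<xi> = coset k (0\<^sub>v k)"
proof -
  have int: "angle \<xi> l \<in> \<int>" if l: "l < k" for l
  proof -
    have "cos (2 * pi * angle \<xi> l) = 1"
      using one[OF l] by (metis root_def cis.simps(1) one_complex.sel(1))
    then obtain j :: int where "2 * pi * angle \<xi> l = real_of_int j * 2 * pi"
      by (auto simp: cos_one_2pi_int)
    then have "angle \<xi> l = real_of_int j" by simp
    then show ?thesis by simp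
  qed
  obtain B where B: "B \<in> carrier_mat k k" "U * B = 1\<^sub>m k"
    using int_mat_inverse[OF U detU] by metis
  have "\<xi> $ a \<in> \<int>" if a: "a < k" for a
  proof -
    let ?e = "unit_vec k a :: int vec"
    have Ue: "U *\<^sub>v (B *\<^sub>v ?e) = ?e" using B by (intro inverse_mult_mat_vec[OF _ U]) auto
    have "\<xi> $ a = scalar_prod \<xi> (rvec (U *\<^sub>v (B *\<^sub>v ?e)))"
    proof -
      have "rvec ?e = unit_vec k a" by (intro eq_vecI) (auto simp: unit_vec_def)
      then show ?thesis unfolding Ue using \<xi> a by simp
    qed
    also have "\<dots> = (\<Sum>l<k. angle \<xi> l * real_of_int ((B *\<^sub>v ?e) $ l))"
      using B \<xi> by (intro scalar_prod_U) auto
    also have "\<dots> \<in> \<int>" using int by (intro Ints_sum Ints_mult) auto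
    finally show ?thesis .
  qed
  then have fl: "\<xi> $ a = real_of_int \<lfloor>\<xi> $ a\<rfloor>" if "a < k" for a using that by simp
  define z where "z = vec k (\<lambda>a. \<lfloor>\<xi> $ a\<rfloor>)"
  have \<xi>z: "\<xi> = rvec z" using fl \<xi> by (intro eq_vecI) (auto simp: z_def)
  have z: "z \<in> carrier_vec k" by (simp add: z_def)
  have "coset k \<xi> \<subseteq> coset k (0\<^sub>v k)"
  proof
    fix \<eta> assume "\<eta> \<in> coset k \<xi>"
    then obtain u where "\<eta> \<in> carrier_vec k" "u \<in> carrier_vec k" "\<xi> - \<eta> = rvec u"
      by (auto simp: coset_def mod_Z_def Zvecs_def)
    then have "0\<^sub>v k - \<eta> = rvec (u - z)" "u - z \<in> carrier_vec k" "\<eta> \<in> carrier_vec k"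
      using z unfolding \<xi>z by (auto intro!: eq_vecI dest!: vec_eq_iff[THEN iffD1])
    then show "\<eta> \<in> coset k (0\<^sub>v k)" by (auto simp: coset_def mod_Z_def Zvecs_def)
  qed
  moreover have "coset k (0\<^sub>v k) \<subseteq> coset k \<xi>"
  proof
    fix \<eta> assume "\<eta> \<in> coset k (0\<^sub>v k)"
    then obtain u where "\<eta> \<in> carrier_vec k" "u \<in> carrier_vec k" "0\<^sub>v k - \<eta> = rvec u"
      by (auto simp: coset_def mod_Z_def Zvecs_def)
    then have "\<xi> - \<eta> = rvec (u + z)" "u + z \<in> carrier_vec k" "\<eta> \<in> carrier_vec k"
      using z unfolding \<xi>z by (auto intro!: eq_vecI dest!: vec_eq_iff[THEN iffD1])
    then show "\<eta> \<in> coset k \<xi>" using \<xi> by (auto simp: coset_def mod_Z_def Zvecs_def)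
  qed
  ultimately show ?thesis by blast
qed

end

section \<open>Cumulative sums of H\<close>

locale sampler_instance = sampler_data +
  fixes T :: "real vec set set" and Hhat :: "real vec set \<Rightarrow> complex" and H :: "int vec \<Rightarrow> real"
    and \<xi>s :: "real vec list"
  assumes T: "T \<subseteq> freqs k M" and zero_in_T: "coset k (0\<^sub>v k) \<in> T"
    and Hhat_0: "Hhat (coset k (0\<^sub>v k)) = 1"
    and H: "x \<in> fund_points k M m \<Longrightarrow> complex_of_real (H x) = inverse_DFT M T Hhat x"
    and \<xi>s: "represents k \<xi>s T"
begin

text \<open>The real part is taken frequency by frequency, as in the program. Since H is real, these
  real parts still add up to the sum of H.\<close>

definition cdf :: "nat \<Rightarrow> real" where
  "cdf n = (\<Sum>t<length \<xi>s.
     Re (Hhat (coset k (\<xi>s ! t)) * char_sum (root (\<xi>s ! t)) d k n) / real N)"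

lemma bij_index: "bij_betw (\<lambda>t. coset k (\<xi>s ! t)) {..<length \<xi>s} T"
proof -
  have "distinct (map (coset k) \<xi>s)" "set (map (coset k) \<xi>s) = T"
    using \<xi>s by (auto simp: represents_def)
  then have "bij_betw ((!) (map (coset k) \<xi>s)) {..<length (map (coset k) \<xi>s)} T"
    by (intro bij_betw_nth) auto
  then show ?thesis by (subst bij_betw_cong[of _ _ "(!) (map (coset k) \<xi>s)"]) auto
qed

lemma card_T: "card T = length \<xi>s"
  using bij_betw_same_card[OF bij_index] by simp

lemma \<xi>s_carrier: "t < length \<xi>s \<Longrightarrow> \<xi>s ! t \<in> carrier_vec k"
  using \<xi>s unfolding represents_def by (meson nth_mem subsetD)

lemma \<xi>s_dual: "t < length \<xi>s \<Longrightarrow> \<xi>s ! t \<in> dual_lattice k M"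
  using coset_in_freqs[OF M \<xi>s_carrier] bij_betwE[OF bij_index] T by blast

lemma H_point:
  "H (point n) = (\<Sum>t<length \<xi>s.
     Re (Hhat (coset k (\<xi>s ! t)) * char_value (root (\<xi>s ! t)) d k n) / real N)"
proof -
  have S: "point n \<in> fund_points k M m"
    using represents_code_point by (simp add: represents_code_def)
  have "complex_of_real (H (point n)) = 1 / of_nat N * (\<Sum>c\<in>T. e_coset c (point n) * Hhat c)"
    unfolding H[OF S] inverse_DFT_def abs_det by simp
  also have "(\<Sum>c\<in>T. e_coset c (point n) * Hhat c) =
      (\<Sum>t<length \<xi>s. e_coset (coset k (\<xi>s ! t)) (point n) * Hhat (coset k (\<xi>s ! t)))"
    by (rule sum.reindex_bij_betw[OF bij_index, symmetric])
  also have "\<dots> = (\<Sum>t<length \<xi>s. Hhat (coset k (\<xi>s ! t)) * char_value (root (\<xi>s ! t)) d k n)"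
    by (intro sum.cong refl) (simp add: e_coset_point \<xi>s_dual mult.commute)
  finally have eq: "complex_of_real (H (point n)) =
      (\<Sum>t<length \<xi>s. Hhat (coset k (\<xi>s ! t)) * char_value (root (\<xi>s ! t)) d k n) / of_nat N"
    by simp
  have "H (point n) = Re (complex_of_real (H (point n)))" by simp
  also have "\<dots> = (\<Sum>t<length \<xi>s. Re (Hhat (coset k (\<xi>s ! t)) * char_value (root (\<xi>s ! t)) d k n)) / real N"
    unfolding eq by (simp only: Re_divide_of_nat Re_sum)
  finally show ?thesis by (simp only: sum_divide_distrib)
qed

lemma cdf_eq_sum: "cdf n = (\<Sum>i<n. H (point i))"
proof -
  have "(\<Sum>i<n. H (point i)) = (\<Sum>t<length \<xi>s. \<Sum>i<n.
      Re (Hhat (coset k (\<xi>s ! t)) * char_value (root (\<xi>s ! t)) d k i) / real N)"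
    unfolding H_point by (rule sum.swap)
  then show ?thesis
    unfolding cdf_def char_sum_def sum_distrib_left Re_sum sum_divide_distrib by simp
qed

text \<open>By orthogonality of characters only the trivial frequency contributes to the total mass.\<close>

lemma cdf_N: "cdf N = 1"
proof -
  obtain t0 where t0: "t0 < length \<xi>s" "coset k (\<xi>s ! t0) = coset k (0\<^sub>v k)"
    using zero_in_T bij_betw_imp_surj_on[OF bij_index] by (metis imageE lessThan_iff)
  have "Re (Hhat (coset k (\<xi>s ! t)) * char_sum (root (\<xi>s ! t)) d k N) / real N =
      (if t = t0 then 1 else 0)" if t: "t < length \<xi>s" for t
  proof (cases "\<forall>l<k. root (\<xi>s ! t) l = 1")
    case True
    then have c: "coset k (\<xi>s ! t) = coset k (0\<^sub>v k)"
      using root_eq_1_imp_trivial[OF \<xi>s_carrier[OF t]] by blast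
    then have "t = t0"
      using bij_betw_imp_inj_on[OF bij_index] t t0 by (metis inj_on_eq_iff lessThan_iff)
    moreover have "char_sum (root (\<xi>s ! t)) d k N = of_nat N"
      using True by (intro char_sum_trivial) auto
    ultimately show ?thesis using c Hhat_0 N_pos by simp
  next
    case False
    then obtain l where l: "l < k" "root (\<xi>s ! t) l \<noteq> 1" by blast
    have "char_sum (root (\<xi>s ! t)) d k N = 0"
      unfolding N_def using l d_pos root_power_d[OF \<xi>s_dual[OF t]] by (intro char_sum_full_eq_0) auto
    \<comment> \<open>A representative of the trivial coset is an integer vector, and then all its
      roots equal 1.\<close>
    moreover have "t \<noteq> t0"
    proof
      assume "t = t0"
      then have "\<xi>s ! t \<in> coset k (0\<^sub>v k)" using t0 coset_refl[OF \<xi>s_carrier[OF t]] by simp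
      then obtain z where z: "z \<in> carrier_vec k" "0\<^sub>v k - \<xi>s ! t = rvec z"
        by (auto simp: coset_def mod_Z_def Zvecs_def)
      have "(\<xi>s ! t) $ a \<in> \<int>" if a: "a < k" for a
      proof -
        have "(0\<^sub>v k - \<xi>s ! t) $ a = rvec z $ a" using z(2) by simp
        then have "(\<xi>s ! t) $ a = of_int (- z $ a)" using a z(1) \<xi>s_carrier[OF t] by simp
        then show ?thesis by (metis Ints_of_int)
      qed
      then have "angle (\<xi>s ! t) l \<in> \<int>"
        unfolding angle_def by (intro Ints_sum Ints_mult) auto
      then show False using l(2) cis_Ints by (simp add: root_def)
    qed
    ultimately show ?thesis by simp
  qed
  then have "cdf N = (\<Sum>t<length \<xi>s. if t = t0 then 1 else 0)"
    unfolding cdf_def by (intro sum.cong) auto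
  then show ?thesis using t0 by simp
qed

lemma sum_H: "sum H (fund_points k M m) = 1"
  using cdf_N sum.reindex_bij_betw[OF bij_point, of H] by (simp add: cdf_eq_sum)

end


section \<open>Binary search on the cumulative sums\<close>

notation Seq (infixr \<open>;;\<close> 60)

text \<open>Here \<open>\<delta> = \<bar>1 - cis th\<bar>\<^sup>2\<close>.  As \<open>0 / 0 = 0\<close>, the expression \<open>1 - \<delta> / \<delta>\<close> is 1 for a trivial root
  and 0 otherwise, and \<open>gre + \<i> gim\<close> is the geometric sum in both cases.  The full sum \<open>W\<close> is real
  because the root is a \<open>d\<close>-th root of unity.\<close>

definition digit_step :: prog where
  "digit_step =
     (let th = Var ''th''; r = Var ''r''; d = Cell ''d'' (Var ''l''); w = Var ''w'';
          re = Var ''Sre''; im = Var ''Sim''; W = Var ''W'';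
          c = Cos th; s = Sin th; \<delta> = Sub (Num 2) (Mul (Num 2) c);
          cw = Cos (Mul w th); sw = Sin (Mul w th);
          trivial = Sub (Num 1) (Div \<delta> \<delta>);
          gre = Add (Div (Add (Mul (Sub (Num 1) cw) (Sub (Num 1) c)) (Mul sw s)) \<delta>) (Mul w trivial);
          gim = Div (Sub (Mul (Sub (Num 1) cw) s) (Mul sw (Sub (Num 1) c))) \<delta>
      in sum_loop ''th'' ''a'' (Var ''k'')
           (Mul (Cell ''xi'' (Add (Mul (Var ''t'') (Var ''k'')) (Var ''a'')))
                (Cell ''U'' (Add (Mul (Var ''a'') (Var ''k'')) (Var ''l'')))) ;;
         set_var ''th'' (Mul (Mul (Num 2) Pi) th) ;;
         set_var ''w'' (Sub r (Mul d (Floor (Div r d)))) ;;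
         set_var ''r'' (Floor (Div r d)) ;;
         set_var ''x'' (Add (Sub (Mul cw re) (Mul sw im)) (Mul gre W)) ;;
         set_var ''Sim'' (Add (Add (Mul cw im) (Mul sw re)) (Mul gim W)) ;;
         set_var ''Sre'' (Var ''x'') ;;
         set_var ''W'' (Mul (Mul d trivial) W))"

text \<open>Digits are split off \<open>r\<close> from the low end. \<open>Sre\<close> and
  \<open>Sim\<close> hold the sum up to the residue read so far, and \<open>W\<close> the full sum
  over all values of the digits read.\<close>

definition char_sum_prog :: prog where
  "char_sum_prog =
     (set_var ''r'' (Var ''mid'') ;; set_var ''Sre'' (Num 0) ;; set_var ''Sim'' (Num 0) ;;
      set_var ''W'' (Num 1) ;; for_loop ''l'' (Var ''k'') digit_step)"

definition cdf_prog :: prog where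
  "cdf_prog =
     (set_var ''F'' (Num 0) ;;
      for_loop ''t'' (Var ''card_T'')
        (char_sum_prog ;;
         set_var ''F'' (Add (Var ''F'')
           (Div (Sub (Mul (Cell ''Hhat_re'' (Var ''t'')) (Var ''Sre''))
                     (Mul (Cell ''Hhat_im'' (Var ''t'')) (Var ''Sim''))) (Var ''N'')))))"

definition search_prog :: prog where
  "search_prog =
     (set_var ''lo'' (Num 0) ;; set_var ''hi'' (Var ''N'') ;;
      While (Less (Num 1) (Sub (Var ''hi'') (Var ''lo'')))
        (set_var ''mid'' (Floor (Div (Add (Var ''lo'') (Var ''hi'')) (Num 2))) ;;
         cdf_prog ;;
         If (Less (Var ''u'') (Var ''F'')) (set_var ''hi'' (Var ''mid'')) (set_var ''lo'' (Var ''mid''))))"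

text \<open>For z = cis t this is (1 - z^n) / (1 - z), expanded by the conjugate of 1 - z, so that
  the denominator is |1 - z|^2 = 2 - 2 cos t. For z = 1 both fractions are 0 and the extra term
  supplies n.\<close>

lemma geometric_sum_cis:
  fixes t :: real and n :: nat
  defines "\<delta> \<equiv> 2 - 2 * cos t"
  shows "(\<Sum>a<n. cis t ^ a) =
    Complex (((1 - cos (n * t)) * (1 - cos t) + sin (n * t) * sin t) / \<delta> + n * (1 - \<delta> / \<delta>))
      (((1 - cos (n * t)) * sin t - sin (n * t) * (1 - cos t)) / \<delta>)"
proof (cases "cos t = 1")
  case True
  then have "sin t = 0" using sin_cos_squared_add[of t] by simp
  with True have "cis t = 1" by (simp add: complex_eq_iff)
  with True \<open>sin t = 0\<close> show ?thesis by (simp add: \<delta>_def complex_eq_iff)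
next
  case False
  then have z: "cis t \<noteq> 1" by (auto simp: complex_eq_iff)
  have \<delta>: "\<delta> \<noteq> 0" using False by (simp add: \<delta>_def)
  let ?C = "cos (n * t)" and ?S = "sin (n * t)" and ?c = "cos t" and ?s = "sin t"
  let ?x = "(1 - ?C) * (1 - ?c) + ?S * ?s" and ?y = "(1 - ?C) * ?s - ?S * (1 - ?c)"
  have sq: "?s * ?s = 1 - ?c * ?c" using sin_squared_eq[of t] by (simp add: power2_eq_square)
  have alg: "((1 - C) * (1 - c) + S * s) * (c - 1) - ((1 - C) * s - S * (1 - c)) * s =
      (C - 1) * ((1 - c) * (1 - c) + s * s)"
    "((1 - C) * (1 - c) + S * s) * s + ((1 - C) * s - S * (1 - c)) * (c - 1) =
      S * ((1 - c) * (1 - c) + s * s)" for C S c s :: real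
    by (simp_all add: algebra_simps)
  have "?x * (?c - 1) - ?y * ?s = (?C - 1) * ((1 - ?c) * (1 - ?c) + ?s * ?s)"
    by (rule alg)
  also have "\<dots> = (?C - 1) * \<delta>" unfolding sq \<delta>_def by (simp add: algebra_simps)
  finally have re: "?x / \<delta> * (?c - 1) - ?y / \<delta> * ?s = ?C - 1"
    using \<delta> by (simp add: diff_divide_distrib[symmetric])
  have "?x * ?s + ?y * (?c - 1) = ?S * ((1 - ?c) * (1 - ?c) + ?s * ?s)"
    by (rule alg)
  also have "\<dots> = ?S * \<delta>" unfolding sq \<delta>_def by (simp add: algebra_simps)
  finally have im: "?x / \<delta> * ?s + ?y / \<delta> * (?c - 1) = ?S"
    using \<delta> by (simp add: add_divide_distrib[symmetric])
  have "Complex (?x / \<delta>) (?y / \<delta>) * (cis t - 1) = cis t ^ n - 1"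
    unfolding Complex.DeMoivre using re im by (simp add: complex_eq_iff)
  then have "Complex (?x / \<delta>) (?y / \<delta>) = (cis t ^ n - 1) / (cis t - 1)"
    using z by (simp add: field_simps)
  then show ?thesis using \<delta> z by (simp add: geometric_sum)
qed

lemma floor_index [simp]:
  "\<lfloor>real a * real b + real c\<rfloor> = int a * int b + int c"
  by (metis floor_of_nat of_nat_add of_nat_mult)

lemma floor_div_nat [simp]: "\<lfloor>real a / real b\<rfloor> = int (a div b)"
  by (rule floor_divide_of_nat_eq)

lemma real_mod_nat: "real a - real b * real (a div b) = real (a mod b)"
  by (metis add_diff_cancel_left' mult_div_mod_eq of_nat_add of_nat_mult)

text \<open>These are the arrays on which \<open>prepared\<close> depends. No stage after the
  initialization writes to them, so \<open>prepared\<close> survives by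
  \<open>prepared_frame\<close>.\<close>

definition "data_vars = {''k'', ''card_T'', ''M'', ''U'', ''m'', ''xi'', ''Hhat_re'', ''Hhat_im'', ''d'', ''N''}"

section \<open>Correctness and cost of the search\<close>

context sampler_instance
begin

definition prepared :: "memory \<Rightarrow> bool" where
  "prepared s \<longleftrightarrow> s ''k'' 0 = real k \<and> s ''card_T'' 0 = real (length \<xi>s) \<and> s ''N'' 0 = real N \<and>
     (\<forall>i<k. s ''d'' (int i) = real (d i)) \<and> (\<forall>i<k. s ''m'' (int i) = m $ i) \<and>
     (\<forall>i<k. \<forall>j<k. s ''M'' (int i * int k + int j) = real_of_int (M $$ (i, j))) \<and>
     (\<forall>i<k. \<forall>j<k. s ''U'' (int i * int k + int j) = real_of_int (U $$ (i, j))) \<and>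
     (\<forall>t<length \<xi>s. \<forall>i<k. s ''xi'' (int t * int k + int i) = \<xi>s ! t $ i) \<and>
     (\<forall>t<length \<xi>s. s ''Hhat_re'' (int t) = Re (Hhat (coset k (\<xi>s ! t)))) \<and>
     (\<forall>t<length \<xi>s. s ''Hhat_im'' (int t) = Im (Hhat (coset k (\<xi>s ! t))))"

lemma prepared_frame:
  assumes "frame W s s'" "W \<inter> data_vars = {}" "prepared s"
  shows "prepared s'"
proof -
  have "s' x = s x" if "x \<in> data_vars" for x using assms(1,2) that by (auto simp: frame_def)
  then have "s' ''k'' = s ''k''" "s' ''card_T'' = s ''card_T''" "s' ''N'' = s ''N''" "s' ''d'' = s ''d''"
    "s' ''m'' = s ''m''" "s' ''M'' = s ''M''" "s' ''U'' = s ''U''" "s' ''xi'' = s ''xi''"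
    "s' ''Hhat_re'' = s ''Hhat_re''" "s' ''Hhat_im'' = s ''Hhat_im''"
    by (simp_all add: data_vars_def)
  with assms(3) show ?thesis by (simp add: prepared_def)
qed

definition "digit_vars = {''th'', ''a'', ''w'', ''r'', ''x'', ''Sre'', ''Sim'', ''W''}"

lemma reach_digit_step:
  assumes prep: "prepared s" and t: "t < length \<xi>s" and l: "l < k"
    and st: "s ''t'' 0 = real t" "s ''l'' 0 = real l" "s ''r'' 0 = real \<rho>"
  defines "z \<equiv> root (\<xi>s ! t) l" and "w \<equiv> \<rho> mod d l"
  shows "\<exists>s'. reach (4 * k + 19) digit_step s s' \<and> frame digit_vars s s' \<and>
     s' ''r'' 0 = real (\<rho> div d l) \<and>
     Complex (s' ''Sre'' 0) (s' ''Sim'' 0) =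
       z ^ w * Complex (s ''Sre'' 0) (s ''Sim'' 0) + (\<Sum>a<w. z ^ a) * of_real (s ''W'' 0) \<and>
     complex_of_real (s' ''W'' 0) = (\<Sum>a<d l. z ^ a) * of_real (s ''W'' 0)"
proof -
  define \<theta> where "\<theta> = 2 * pi * angle (\<xi>s ! t) l"
  define \<delta> where "\<delta> = 2 - 2 * cos \<theta>"
  define g where "g = (\<Sum>a<w. z ^ a)"
  have z: "z = cis \<theta>" by (simp add: z_def root_def \<theta>_def)
  have g: "Re g = ((1 - cos (w * \<theta>)) * (1 - cos \<theta>) + sin (w * \<theta>) * sin \<theta>) / \<delta> + w * (1 - \<delta> / \<delta>)"
    "Im g = ((1 - cos (w * \<theta>)) * sin \<theta> - sin (w * \<theta>) * (1 - cos \<theta>)) / \<delta>"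
    unfolding g_def z geometric_sum_cis \<delta>_def by simp_all
  define X where "X = cos (w * \<theta>) * s ''Sre'' 0 - sin (w * \<theta>) * s ''Sim'' 0 + Re g * s ''W'' 0"
  define Y where "Y = cos (w * \<theta>) * s ''Sim'' 0 + sin (w * \<theta>) * s ''Sre'' 0 + Im g * s ''W'' 0"
  define W' where "W' = real (d l) * (1 - \<delta> / \<delta>) * s ''W'' 0"
  define s1 where "s1 = store (store s ''th'' 0 (angle (\<xi>s ! t) l)) ''a'' 0 (real k)"
  define s2 where "s2 = store s1 ''th'' 0 \<theta>"
  define s3 where "s3 = store s2 ''w'' 0 (real w)"
  define s4 where "s4 = store s3 ''r'' 0 (real (\<rho> div d l))"
  \<comment> \<open>The new real part is held in \<open>x\<close> for a moment, since the new
    imaginary part still needs the old one.\<close>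
  define s5 where "s5 = store s4 ''x'' 0 X"
  define s6 where "s6 = store s5 ''Sim'' 0 Y"
  define s7 where "s7 = store s6 ''Sre'' 0 X"
  define s8 where "s8 = store s7 ''W'' 0 W'"
  note defs = s1_def s2_def s3_def s4_def s5_def s6_def s7_def s8_def
  have r1: "reach (k * 4 + 5) (sum_loop ''th'' ''a'' (Var ''k'')
       (Mul (Cell ''xi'' (Add (Mul (Var ''t'') (Var ''k'')) (Var ''a'')))
            (Cell ''U'' (Add (Mul (Var ''a'') (Var ''k'')) (Var ''l''))))) s s1"
    unfolding s1_def angle_def using prep t l st
    by (intro reach_sum_loop) (simp_all add: prepared_def)
  have r2: "reach 1 (set_var ''th'' e) s1 s2" if "aval e s1 = \<theta>" for e
    unfolding s2_def using that by (rule reach_set_varI)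
  have r3: "reach 1 (set_var ''w'' e) s2 s3" if "aval e s2 = real w" for e
    unfolding s3_def using that by (rule reach_set_varI)
  have r4: "reach 1 (set_var ''r'' e) s3 s4" if "aval e s3 = real (\<rho> div d l)" for e
    unfolding s4_def using that by (rule reach_set_varI)
  have r5: "reach 1 (set_var ''x'' e) s4 s5" if "aval e s4 = X" for e
    unfolding s5_def using that by (rule reach_set_varI)
  have r6: "reach 1 (set_var ''Sim'' e) s5 s6" if "aval e s5 = Y" for e
    unfolding s6_def using that by (rule reach_set_varI)
  have r7: "reach 1 (set_var ''Sre'' e) s6 s7" if "aval e s6 = X" for e
    unfolding s7_def using that by (rule reach_set_varI)
  have r8: "reach 1 (set_var ''W'' e) s7 s8" if "aval e s7 = W'" for e
    unfolding s8_def using that by (rule reach_set_varI)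
  have "reach (4 * k + 19) digit_step s s8"
    unfolding digit_step_def Let_def
    by (rule reach_mono[OF reach_Seq[OF r1 reach_Seq[OF r2 reach_Seq[OF r3 reach_Seq[OF r4
          reach_Seq[OF r5 reach_Seq[OF r6 reach_Seq[OF r7 r8]]]]]]]])
      (use prep l st in \<open>simp_all add: s1_def s2_def s3_def s4_def s5_def s6_def s7_def prepared_def
        \<theta>_def[symmetric] w_def real_mod_nat g X_def Y_def W'_def \<delta>_def\<close>)
  moreover have "frame digit_vars s s8" by (simp add: defs digit_vars_def)
  moreover have "s8 ''r'' 0 = real (\<rho> div d l)" by (simp add: defs)
  moreover have "Complex (s8 ''Sre'' 0) (s8 ''Sim'' 0) =
       z ^ w * Complex (s ''Sre'' 0) (s ''Sim'' 0) + (\<Sum>a<w. z ^ a) * of_real (s ''W'' 0)"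
    unfolding g_def[symmetric] unfolding z Complex.DeMoivre
    by (simp add: defs X_def Y_def complex_eq_iff)
  moreover have "complex_of_real (s8 ''W'' 0) = (\<Sum>a<d l. z ^ a) * of_real (s ''W'' 0)"
  proof -
    have "(\<Sum>a<d l. z ^ a) = (if z = 1 then of_nat (d l) else 0)"
      unfolding z_def using root_power_d[OF \<xi>s_dual[OF t] l] by (rule geometric_sum_root_of_unity)
    moreover have "z = 1 \<longleftrightarrow> \<delta> = 0"
    proof
      assume "\<delta> = 0"
      then have "cos \<theta> = 1" by (simp add: \<delta>_def)
      moreover from this have "sin \<theta> = 0" using sin_cos_squared_add[of \<theta>] by simp
      ultimately show "z = 1" by (simp add: z complex_eq_iff)
    qed (simp add: \<delta>_def z complex_eq_iff)
    ultimately show ?thesis by (simp add: defs W'_def)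
  qed
  ultimately show ?thesis by blast
qed


lemma reach_char_sum:
  assumes prep: "prepared s" and t: "t < length \<xi>s" "s ''t'' 0 = real t"
    and n: "s ''mid'' 0 = real n" "n < N"
  shows "\<exists>s'. reach (k * (4 * k + 22) + 11) char_sum_prog s s' \<and>
    frame (insert ''l'' digit_vars) s s' \<and>
    Complex (s' ''Sre'' 0) (s' ''Sim'' 0) = char_sum (root (\<xi>s ! t)) d k n"
proof -
  let ?W = "insert ''l'' digit_vars" and ?z = "root (\<xi>s ! t)"
  define s1 where "s1 = store s ''r'' 0 (real n)"
  define s2 where "s2 = store s1 ''Sre'' 0 0"
  define s3 where "s3 = store s2 ''Sim'' 0 0"
  define s4 where "s4 = store s3 ''W'' 0 1"
  note defs = s1_def s2_def s3_def s4_def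
  let ?I = "\<lambda>l s'. frame ?W s s' \<and> s' ''l'' 0 = real l \<and> s' ''r'' 0 = real (n div place d l) \<and>
     Complex (s' ''Sre'' 0) (s' ''Sim'' 0) = char_sum ?z d l (n mod place d l) \<and>
     complex_of_real (s' ''W'' 0) = char_sum ?z d l (place d l)"
  have "\<exists>s'. reach (k * ((4 * k + 19) + 3) + 3) (for_loop ''l'' (Var ''k'') digit_step) s4 s' \<and> ?I k s'"
  proof (rule reach_for_loop[where I = ?I])
    \<comment> \<open>With no digit read the residue is 0, so the partial sum is empty; the full
      range has one term, an empty product, whence \<open>W\<close> starts at 1.\<close>
    show "?I 0 (store s4 ''l'' 0 0)"
      by (simp add: defs digit_vars_def char_sum_def char_value_def complex_eq_iff)
  next
    fix l s' assume l: "l < k" and I: "?I l s'"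
    have fr: "frame ?W s s'" using I by blast
    have "prepared s'" by (rule prepared_frame[OF fr _ prep]) (simp add: digit_vars_def data_vars_def)
    moreover have "s' ''t'' 0 = real t" using frameD[OF fr, of "''t''"] t by (simp add: digit_vars_def)
    ultimately obtain s'' where s'': "reach (4 * k + 19) digit_step s' s''" "frame digit_vars s' s''"
      "s'' ''r'' 0 = real (n div place d l div d l)"
      "Complex (s'' ''Sre'' 0) (s'' ''Sim'' 0) =
         ?z l ^ (n div place d l mod d l) * Complex (s' ''Sre'' 0) (s' ''Sim'' 0) +
         (\<Sum>a<n div place d l mod d l. ?z l ^ a) * of_real (s' ''W'' 0)"
      "complex_of_real (s'' ''W'' 0) = (\<Sum>a<d l. ?z l ^ a) * of_real (s' ''W'' 0)"
      using reach_digit_step[of s' t l "n div place d l"] t(1) l I by blast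
    have l_kept: "s'' ''l'' 0 = real l"
      using frameD[OF s''(2), of "''l''"] I by (simp add: digit_vars_def)
    have "Complex (s'' ''Sre'' 0) (s'' ''Sim'' 0) = char_sum ?z d (Suc l) (n mod place d (Suc l))"
      unfolding s''(4) mod_place_Suc digit_def[symmetric] using I l d_pos
      by (subst char_sum_Suc) (simp_all add: digit_less place_pos)
    moreover have "complex_of_real (s'' ''W'' 0) = char_sum ?z d (Suc l) (place d (Suc l))"
      unfolding s''(5) using I l d_pos by (subst char_sum_full_Suc) simp_all
    moreover have "frame ?W s s''" by (rule frame_trans[OF fr s''(2)]) auto
    ultimately show "\<exists>s''. reach (4 * k + 19) digit_step s' s'' \<and> s'' ''l'' 0 = real l \<and>
        ?I (Suc l) (store s'' ''l'' 0 (real (Suc l)))"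
      using s''(1,3) l_kept
      by (intro exI[of _ s'']) (simp add: place_Suc div_mult2_eq del: of_nat_Suc)
  next
    fix l s' assume "?I l s'"
    then show "s' ''l'' 0 = real l" "aval (Var ''k'') s' = real k"
      using prep frameD[of ?W s s' "''k''"] by (simp_all add: prepared_def digit_vars_def)
  qed
  then obtain s' where s': "reach (k * ((4 * k + 19) + 3) + 3) (for_loop ''l'' (Var ''k'') digit_step) s4 s'" "?I k s'"
    by blast
  have r: "reach 1 (set_var ''r'' (Var ''mid'')) s s1" "reach 1 (set_var ''Sre'' (Num 0)) s1 s2"
    "reach 1 (set_var ''Sim'' (Num 0)) s2 s3" "reach 1 (set_var ''W'' (Num 1)) s3 s4"
    unfolding defs using n by (auto intro!: reach_set_varI simp del: One_nat_def)
  have "reach (k * (4 * k + 22) + 11) char_sum_prog s s'"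
    unfolding char_sum_prog_def
    by (rule reach_mono[OF reach_Seq[OF r(1) reach_Seq[OF r(2) reach_Seq[OF r(3) reach_Seq[OF r(4) s'(1)]]]]]) simp
  moreover have "n mod place d k = n" using n by (simp add: N_def)
  ultimately show ?thesis using s'(2) by (intro exI[of _ s']) simp
qed

definition "cdf_vars = {''l'', ''t'', ''F''} \<union> digit_vars"

definition "cdf_time = length \<xi>s * (k * (4 * k + 22) + 16) + 5"

lemma reach_cdf:
  assumes prep: "prepared s" and n: "s ''mid'' 0 = real n" "n < N"
  shows "\<exists>s'. reach cdf_time cdf_prog s s' \<and> frame cdf_vars s s' \<and> s' ''F'' 0 = cdf n"
proof -
  let ?f = "\<lambda>t. Re (Hhat (coset k (\<xi>s ! t)) * char_sum (root (\<xi>s ! t)) d k n) / real N"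
  let ?I = "\<lambda>t s'. frame cdf_vars s s' \<and> s' ''t'' 0 = real t \<and> s' ''F'' 0 = (\<Sum>i<t. ?f i)"
  let ?e = "Add (Var ''F'') (Div (Sub (Mul (Cell ''Hhat_re'' (Var ''t'')) (Var ''Sre''))
                     (Mul (Cell ''Hhat_im'' (Var ''t'')) (Var ''Sim''))) (Var ''N''))"
  define s1 where "s1 = store s ''F'' 0 0"
  have "\<exists>s'. reach (length \<xi>s * ((k * (4 * k + 22) + 13) + 3) + 3)
      (for_loop ''t'' (Var ''card_T'') (char_sum_prog ;; set_var ''F'' ?e)) s1 s' \<and> ?I (length \<xi>s) s'"
  proof (rule reach_for_loop[where I = ?I])
    show "?I 0 (store s1 ''t'' 0 0)" by (simp add: s1_def cdf_vars_def)
  next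
    fix t s' assume t: "t < length \<xi>s" and I: "?I t s'"
    have fr: "frame cdf_vars s s'" using I by blast
    have prep': "prepared s'"
      by (rule prepared_frame[OF fr _ prep]) (simp add: cdf_vars_def digit_vars_def data_vars_def)
    have "s' ''mid'' 0 = real n"
      using frameD[OF fr, of "''mid''"] n by (simp add: cdf_vars_def digit_vars_def)
    then obtain s2 where s2: "reach (k * (4 * k + 22) + 11) char_sum_prog s' s2"
      "frame (insert ''l'' digit_vars) s' s2"
      "Complex (s2 ''Sre'' 0) (s2 ''Sim'' 0) = char_sum (root (\<xi>s ! t)) d k n"
      using reach_char_sum[OF prep' t _ _ n(2)] I by blast
    have "prepared s2"
      by (rule prepared_frame[OF s2(2) _ prep']) (simp add: digit_vars_def data_vars_def)
    moreover have kept: "s2 ''t'' = s' ''t''" "s2 ''F'' = s' ''F''"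
      using s2(2) by (auto intro!: frameD simp: digit_vars_def)
    moreover have "s2 ''Sre'' 0 = Re (char_sum (root (\<xi>s ! t)) d k n)"
      "s2 ''Sim'' 0 = Im (char_sum (root (\<xi>s ! t)) d k n)"
      unfolding s2(3)[symmetric] by simp_all
    ultimately have e: "aval ?e s2 = (\<Sum>i<Suc t. ?f i)"
      using I t by (simp add: prepared_def)
    define s3 where "s3 = store s2 ''F'' 0 (\<Sum>i<Suc t. ?f i)"
    have "reach 1 (set_var ''F'' ?e) s2 s3" unfolding s3_def by (rule reach_set_varI[OF e])
    from reach_Seq[OF s2(1) this] have "reach (k * (4 * k + 22) + 13) (char_sum_prog ;; set_var ''F'' ?e) s' s3"
      by (rule reach_mono) simp
    moreover have "frame cdf_vars s s2"
      by (rule frame_trans[OF fr s2(2)]) (auto simp: cdf_vars_def)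
    then have "?I (Suc t) (store s3 ''t'' 0 (real (Suc t)))"
      by (simp add: s3_def cdf_vars_def)
    moreover have "s3 ''t'' 0 = real t" using kept I by (simp add: s3_def)
    ultimately show "\<exists>s''. reach (k * (4 * k + 22) + 13) (char_sum_prog ;; set_var ''F'' ?e) s' s'' \<and>
        s'' ''t'' 0 = real t \<and> ?I (Suc t) (store s'' ''t'' 0 (real (Suc t)))" by blast
  next
    fix t s' assume "?I t s'"
    then show "s' ''t'' 0 = real t" "aval (Var ''card_T'') s' = real (length \<xi>s)"
      using prep frameD[of cdf_vars s s' "''card_T''"]
      by (simp_all add: prepared_def cdf_vars_def digit_vars_def)
  qed
  then obtain s' where s': "reach (length \<xi>s * ((k * (4 * k + 22) + 13) + 3) + 3)
      (for_loop ''t'' (Var ''card_T'') (char_sum_prog ;; set_var ''F'' ?e)) s1 s'" "?I (length \<xi>s) s'"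
    by blast
  have "reach 1 (set_var ''F'' (Num 0)) s s1" unfolding s1_def by (rule reach_set_varI) simp
  from reach_Seq[OF this s'(1)] have "reach cdf_time cdf_prog s s'"
    unfolding cdf_prog_def cdf_time_def by (rule reach_mono) simp
  then show ?thesis using s'(2) unfolding cdf_def by blast
qed

definition "search_vars = {''lo'', ''hi'', ''mid''} \<union> cdf_vars"

definition "search_time b = b * (cdf_time + 8) + 5"

text \<open>Every round halves hi - lo, rounding up, so an initial length of at most 2^b allows at
  most b rounds. Since lo < mid < hi \<le> N, the program never evaluates F at N, where all digits
  would wrap around to 0.\<close>

lemma reach_search:
  assumes prep: "prepared s" and u: "0 \<le> s ''u'' 0" "s ''u'' 0 < 1" and b: "N \<le> 2 ^ b"
  shows "\<exists>s' n. reach (search_time b) search_prog s s' \<and> frame search_vars s s' \<and>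
    s' ''lo'' 0 = real n \<and> n < N \<and> cdf n \<le> s ''u'' 0 \<and> s ''u'' 0 < cdf (Suc n)"
proof -
  let ?body = "set_var ''mid'' (Floor (Div (Add (Var ''lo'') (Var ''hi'')) (Num 2))) ;;
         cdf_prog ;;
         If (Less (Var ''u'') (Var ''F'')) (set_var ''hi'' (Var ''mid'')) (set_var ''lo'' (Var ''mid''))"
  let ?W = "While (Less (Num 1) (Sub (Var ''hi'') (Var ''lo''))) ?body"
  define v where "v = s ''u'' 0"
  have loop: "\<exists>s'' n. reach (b * (cdf_time + 8) + 1) ?W s' s'' \<and> frame search_vars s' s'' \<and>
      s'' ''lo'' 0 = real n \<and> n < N \<and> cdf n \<le> v \<and> v < cdf (Suc n)"
    if "prepared s'" "s' ''u'' 0 = v" "s' ''lo'' 0 = real lo" "s' ''hi'' 0 = real hi" "hi - lo \<le> 2 ^ b"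
      "lo < hi" "hi \<le> N" "cdf lo \<le> v" "v < cdf hi" for s' lo hi b
    using that
  proof (induction b arbitrary: s' lo hi)
    case 0
    then have "hi = Suc lo" by simp
    have "reach 1 ?W s' s'"
      by (rule reach_While_False) (simp add: 0 \<open>hi = Suc lo\<close>)
    with 0 \<open>hi = Suc lo\<close> show ?case by (intro exI[of _ s'] exI[of _ lo]) simp
  next
    case (Suc b)
    show ?case
    proof (cases "hi = Suc lo")
      case True
      have "reach 1 ?W s' s'" by (rule reach_While_False) (simp add: Suc.prems True)
      then have "reach (Suc b * (cdf_time + 8) + 1) ?W s' s'" by (rule reach_mono) simp
      with Suc.prems True show ?thesis by (intro exI[of _ s'] exI[of _ lo]) simp
    next
      case False
      define mid where "mid = (lo + hi) div 2"
      have mid: "lo < mid" "mid < hi" "mid - lo \<le> 2 ^ b" "hi - mid \<le> 2 ^ b"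
        using False Suc.prems(5,6) by (auto simp: mid_def)
      define s1 where "s1 = store s' ''mid'' 0 (real mid)"
      have "\<lfloor>(real lo + real hi) / 2\<rfloor> = int mid"
        using floor_div_nat[of "lo + hi" 2] by (simp add: mid_def)
      then have r1: "reach 1 (set_var ''mid'' (Floor (Div (Add (Var ''lo'') (Var ''hi'')) (Num 2)))) s' s1"
        unfolding s1_def using Suc.prems by (intro reach_set_varI) simp
      have f1: "frame search_vars s' s1" by (simp add: s1_def search_vars_def)
      have disj: "search_vars \<inter> data_vars = {}"
        by (simp add: search_vars_def cdf_vars_def digit_vars_def data_vars_def)
      have p1: "prepared s1" by (rule prepared_frame[OF f1 disj Suc.prems(1)])
      obtain s2 where r2: "reach cdf_time cdf_prog s1 s2" and f2: "frame cdf_vars s1 s2"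
        and F: "s2 ''F'' 0 = cdf mid"
        using reach_cdf[OF p1, of mid] mid Suc.prems(7) by (auto simp: s1_def)
      have f12: "frame search_vars s' s2"
        by (rule frame_trans[OF f1 f2]) (auto simp: search_vars_def)
      have kept: "s2 ''u'' 0 = v" "s2 ''lo'' 0 = real lo" "s2 ''hi'' 0 = real hi" "s2 ''mid'' 0 = real mid"
        using frameD[OF f2] Suc.prems(2-4) by (simp_all add: s1_def cdf_vars_def digit_vars_def)
      define s3 where "s3 = (if v < cdf mid then store s2 ''hi'' 0 (real mid) else store s2 ''lo'' 0 (real mid))"
      have "reach (1 + 1) (If (Less (Var ''u'') (Var ''F'')) (set_var ''hi'' (Var ''mid'')) (set_var ''lo'' (Var ''mid''))) s2 s3"
        unfolding s3_def by (rule reach_If) (auto simp: kept F intro!: reach_set_varI simp del: One_nat_def)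
      from reach_Seq[OF r1 reach_Seq[OF r2 this]]
      have body: "reach (cdf_time + 6) ?body s' s3" by (rule reach_mono) simp
      have f3: "frame search_vars s' s3" using f12 by (simp add: s3_def search_vars_def)
      have p3: "prepared s3" by (rule prepared_frame[OF f3 disj Suc.prems(1)])
      have "\<exists>s'' n. reach (b * (cdf_time + 8) + 1) ?W s3 s'' \<and> frame search_vars s3 s'' \<and>
          s'' ''lo'' 0 = real n \<and> n < N \<and> cdf n \<le> v \<and> v < cdf (Suc n)"
      proof (cases "v < cdf mid")
        case True
        then show ?thesis
          using p3 mid Suc.prems(7,8) kept by (intro Suc.IH[of s3 lo mid]) (simp_all add: s3_def)
      next
        case False
        then show ?thesis
          using p3 mid Suc.prems(7,9) kept by (intro Suc.IH[of s3 mid hi]) (simp_all add: s3_def)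
      qed
      then obtain s'' n where s'': "reach (b * (cdf_time + 8) + 1) ?W s3 s''" "frame search_vars s3 s''"
        "s'' ''lo'' 0 = real n" "n < N" "cdf n \<le> v" "v < cdf (Suc n)" by blast
      have "bval (Less (Num 1) (Sub (Var ''hi'') (Var ''lo''))) s'"
        using mid Suc.prems(3,4) by simp
      from reach_While_True[OF this body s''(1)]
      have "reach (Suc b * (cdf_time + 8) + 1) ?W s' s''" by (rule reach_mono) simp
      moreover have "frame search_vars s' s''" by (rule frame_trans[OF f3 s''(2)]) simp
      ultimately show ?thesis using s'' by blast
    qed
  qed
  define s1 where "s1 = store s ''lo'' 0 0"
  define s2 where "s2 = store s1 ''hi'' 0 (real N)"
  have f2: "frame search_vars s s2" by (simp add: s1_def s2_def search_vars_def)
  have p2: "prepared s2" by (rule prepared_frame[OF f2 _ prep])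
     (simp add: search_vars_def cdf_vars_def digit_vars_def data_vars_def)
  have "cdf 0 = 0" by (simp add: cdf_eq_sum)
  then obtain s' n where s': "reach (b * (cdf_time + 8) + 1) ?W s2 s'" "frame search_vars s2 s'"
      "s' ''lo'' 0 = real n" "n < N" "cdf n \<le> v" "v < cdf (Suc n)"
    using loop[OF p2, of 0 N b] u N_pos cdf_N b by (auto simp: s1_def s2_def v_def)
  have r: "reach 1 (set_var ''lo'' (Num 0)) s s1" "reach 1 (set_var ''hi'' (Var ''N'')) s1 s2"
    unfolding s1_def s2_def using prep by (auto intro!: reach_set_varI simp: prepared_def simp del: One_nat_def)
  have "reach (search_time b) search_prog s s'"
    unfolding search_prog_def search_time_def
    by (rule reach_mono[OF reach_Seq[OF r(1) reach_Seq[OF r(2) s'(1)]]]) simp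
  moreover have "frame search_vars s s'" by (rule frame_trans[OF f2 s'(2)]) simp
  ultimately show ?thesis using s' unfolding v_def by blast
qed

end


section \<open>From an index to a lattice point\<close>

definition digits_prog :: prog where
  "digits_prog =
     (set_var ''r'' (Var ''lo'') ;;
      for_loop ''l'' (Var ''k'')
        (Assign ''dig'' (Var ''l'') (Sub (Var ''r'')
           (Mul (Cell ''d'' (Var ''l'')) (Floor (Div (Var ''r'') (Cell ''d'' (Var ''l'')))))) ;;
         set_var ''r'' (Floor (Div (Var ''r'') (Cell ''d'' (Var ''l''))))))"

abbreviation entry :: "string \<Rightarrow> string \<Rightarrow> string \<Rightarrow> expr" where
  "entry A i j \<equiv> Cell A (Add (Mul (Var i) (Var ''k'')) (Var j))"

abbreviation row_of :: "string \<Rightarrow> expr" where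
  "row_of i \<equiv> Floor (Div (Var i) (Var ''k''))"

abbreviation col_of :: "string \<Rightarrow> expr" where
  "col_of i \<equiv> Sub (Var i) (Mul (Var ''k'') (row_of i))"

text \<open>The product \<open>be\<close> of row n with y is saved before y is overwritten, because
  the update of each entry refers to the old y.\<close>

definition elimination_step :: prog where
  "elimination_step =
     (table_loop ''q'' ''i'' (Var ''k'') ''acc'' ''j'' (Var ''k'')
        (Mul (entry ''P'' ''i'' ''j'') (entry ''M'' ''n'' ''j'')) (Var ''acc'') ;;
      sum_loop ''al'' ''j'' (Var ''k'') (Mul (entry ''M'' ''n'' ''j'') (Cell ''q'' (Var ''j''))) ;;
      sum_loop ''be'' ''j'' (Var ''k'') (Mul (entry ''M'' ''n'' ''j'') (Cell ''y'' (Var ''j''))) ;;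
      table_loop ''y'' ''i'' (Var ''k'') ''acc'' ''j'' (Num 0) (Num 0)
        (Add (Cell ''y'' (Var ''i'')) (Div (Mul (Cell ''q'' (Var ''i''))
           (Sub (Sub (Cell ''b'' (Var ''n'')) (Cell ''m'' (Var ''n''))) (Var ''be''))) (Var ''al''))) ;;
      table_loop ''P'' ''i'' (Mul (Var ''k'') (Var ''k'')) ''acc'' ''j'' (Num 0) (Num 0)
        (Sub (Cell ''P'' (Var ''i''))
           (Div (Mul (Cell ''q'' (row_of ''i'')) (Cell ''q'' (col_of ''i''))) (Var ''al''))))"

text \<open>The matrix \<open>P\<close> is stored as one array of length \<open>k * k\<close>; again \<open>1 - x / x\<close> tests \<open>x = 0\<close>.\<close>

definition solve_prog :: prog where
  "solve_prog =
     (table_loop ''P'' ''i'' (Mul (Var ''k'') (Var ''k'')) ''acc'' ''j'' (Num 0) (Num 0)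
        (Sub (Num 1) (Div (Sub (row_of ''i'') (col_of ''i'')) (Sub (row_of ''i'') (col_of ''i'')))) ;;
      for_loop ''n'' (Var ''k'') elimination_step)"

definition point_prog :: prog where
  "point_prog =
     (digits_prog ;;
      table_loop ''b'' ''i'' (Var ''k'') ''acc'' ''j'' (Var ''k'')
        (Mul (entry ''U'' ''i'' ''j'') (Cell ''dig'' (Var ''j''))) (Var ''acc'') ;;
      solve_prog ;;
      table_loop ''z'' ''i'' (Var ''k'') ''acc'' ''j'' (Num 0) (Num 0)
        (Floor (Sub (Div (Num 1) (Num 2)) (Cell ''y'' (Var ''i'')))) ;;
      table_loop ''out'' ''i'' (Var ''k'') ''acc'' ''j'' (Var ''k'')
        (Mul (entry ''M'' ''i'' ''j'') (Cell ''z'' (Var ''j'')))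
        (Add (Cell ''b'' (Var ''i'')) (Var ''acc'')))"

text \<open>Row-major storage reproduces a matrix only at indices below k; beyond that the cells are
  shared with other entries.\<close>

lemma projector_cong:
  assumes "\<And>a b. a < k \<Longrightarrow> b < k \<Longrightarrow> P a b = P' a b"
  shows "projector k R i P \<longleftrightarrow> projector k R i P'"
proof -
  have "(\<Sum>b<k. P a b * v b) = (\<Sum>b<k. P' a b * v b)" if "a < k" for a v
    using assms that by simp
  then show ?thesis using assms by (simp add: projector_def)
qed

lemma row_major:
  assumes "a < k" "b < (k :: nat)"
  shows "a * k + b < k * k" "(a * k + b) div k = a" "(a * k + b) mod k = b"
proof -
  have "a * k + b < Suc a * k" using assms by simp
  also have "Suc a * k \<le> k * k" using assms by (intro mult_le_mono1) simp
  finally show "a * k + b < k * k" .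
qed (use assms in simp_all)

section \<open>Correctness of the point computation\<close>

context sampler_instance
begin

lemma reach_digits:
  assumes prep: "prepared s" and n: "s ''lo'' 0 = real n"
  shows "\<exists>s'. reach (k * 6 + 5) digits_prog s s' \<and> frame {''r'', ''l'', ''dig''} s s' \<and>
    (\<forall>i<k. s' ''dig'' (int i) = real (digit d n i))"
proof -
  let ?e = "Sub (Var ''r'') (Mul (Cell ''d'' (Var ''l'')) (Floor (Div (Var ''r'') (Cell ''d'' (Var ''l'')))))"
  let ?f = "Floor (Div (Var ''r'') (Cell ''d'' (Var ''l'')))"
  let ?W = "{''r'', ''l'', ''dig''}"
  define s1 where "s1 = store s ''r'' 0 (real n)"
  let ?I = "\<lambda>l s'. frame ?W s s' \<and> s' ''l'' 0 = real l \<and> s' ''r'' 0 = real (n div place d l) \<and>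
     (\<forall>i<l. s' ''dig'' (int i) = real (digit d n i))"
  have "\<exists>s'. reach (k * (3 + 3) + 3) (for_loop ''l'' (Var ''k'')
      (Assign ''dig'' (Var ''l'') ?e ;; set_var ''r'' ?f)) s1 s' \<and> ?I k s'"
  proof (rule reach_for_loop[where I = ?I])
    show "?I 0 (store s1 ''l'' 0 0)" by (simp add: s1_def)
  next
    fix l s' assume l: "l < k" and I: "?I l s'"
    have prep': "prepared s'"
      by (rule prepared_frame[OF _ _ prep]) (use I in \<open>auto simp: data_vars_def\<close>)
    define s2 where "s2 = store s' ''dig'' (int l) (real (digit d n l))"
    define s3 where "s3 = store s2 ''r'' 0 (real (n div place d (Suc l)))"
    have "aval ?e s' = real (digit d n l)"
      using prep' l I by (simp add: prepared_def real_mod_nat digit_def)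
    then have 1: "reach 1 (Assign ''dig'' (Var ''l'') ?e) s' s2"
      using reach_Assign[of "''dig''" "Var ''l''" ?e s'] I by (simp add: s2_def)
    have "aval ?f s2 = real (n div place d (Suc l))"
      using prep' l I by (simp add: prepared_def s2_def place_Suc div_mult2_eq)
    then have 2: "reach 1 (set_var ''r'' ?f) s2 s3" unfolding s3_def by (rule reach_set_varI)
    have "reach 3 (Assign ''dig'' (Var ''l'') ?e ;; set_var ''r'' ?f) s' s3"
      by (rule reach_mono[OF reach_Seq[OF 1 2]]) simp
    moreover have "?I (Suc l) (store s3 ''l'' 0 (real (Suc l)))"
      using I by (simp add: s2_def s3_def) (simp add: store_def less_Suc_eq)
    moreover have "s3 ''l'' 0 = real l" using I by (simp add: s2_def s3_def)
    ultimately show "\<exists>s''. reach 3 (Assign ''dig'' (Var ''l'') ?e ;; set_var ''r'' ?f) s' s'' \<and>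
        s'' ''l'' 0 = real l \<and> ?I (Suc l) (store s'' ''l'' 0 (real (Suc l)))" by blast
  next
    fix l s' assume "?I l s'"
    then show "s' ''l'' 0 = real l" "aval (Var ''k'') s' = real k"
      using prep frameD[of ?W s s' "''k''"] by (simp_all add: prepared_def)
  qed
  then obtain s' where s': "reach (k * (3 + 3) + 3) (for_loop ''l'' (Var ''k'')
      (Assign ''dig'' (Var ''l'') ?e ;; set_var ''r'' ?f)) s1 s'" "?I k s'" by blast
  have "reach 1 (set_var ''r'' (Var ''lo'')) s s1" unfolding s1_def using n by (intro reach_set_varI) simp
  from reach_Seq[OF this s'(1)] have "reach (k * 6 + 5) digits_prog s s'"
    unfolding digits_prog_def by (rule reach_mono) simp
  then show ?thesis using s'(2) by blast
qed

definition "solve_vars = {''q'', ''i'', ''acc'', ''j'', ''al'', ''be'', ''y'', ''P'', ''n''}"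

abbreviation "Mrow \<equiv> \<lambda>j b. real_of_int (M $$ (j, b))"

abbreviation "mem_mat A s \<equiv> \<lambda>a b. (s :: memory) A (int (a * k + b))"
abbreviation "mem_vec A s \<equiv> \<lambda>a. (s :: memory) A (int a)"

definition "step_time = k * (k * 4 + 10) + (k * 4 + 5) + (k * 4 + 5) + (k * 10) + (k * k * 10) + 13"

lemma reach_elimination_step:
  assumes prep: "prepared s" and n: "s ''n'' 0 = real n" "n < k"
    and P: "projector k Mrow n (mem_mat ''P'' s)"
    and y: "\<And>j. j < n \<Longrightarrow> (\<Sum>b<k. Mrow j b * mem_vec ''y'' s b) = c j"
    and c: "c n = mem_vec ''b'' s n - mem_vec ''m'' s n"
  shows "\<exists>s'. reach step_time elimination_step s s' \<and> frame (solve_vars - {''n''}) s s' \<and>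
     projector k Mrow (Suc n) (mem_mat ''P'' s') \<and>
     (\<forall>j<Suc n. (\<Sum>b<k. Mrow j b * mem_vec ''y'' s' b) = c j)"
proof -
  let ?P = "mem_mat ''P'' s" and ?y = "mem_vec ''y'' s"
  define q where "q a = (\<Sum>b<k. ?P a b * Mrow n b)" for a
  define \<alpha> where "\<alpha> = (\<Sum>b<k. Mrow n b * q b)"
  define \<beta> where "\<beta> = (\<Sum>b<k. Mrow n b * ?y b)"
  have k: "s ''k'' 0 = real k" using prep by (simp add: prepared_def)
  have Mn: "s ''M'' (int n * int k + int b) = Mrow n b" if "b < k" for b
    using prep n that by (simp add: prepared_def)
  have "\<exists>s1. reach (k * (k * 4 + 10) + 3) (table_loop ''q'' ''i'' (Var ''k'') ''acc'' ''j'' (Var ''k'')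
        (Mul (entry ''P'' ''i'' ''j'') (entry ''M'' ''n'' ''j'')) (Var ''acc'')) s s1 \<and>
      frame {''q'', ''i'', ''acc'', ''j''} s s1 \<and> (\<forall>i<k. s1 ''q'' (int i) = q i)"
    by (rule reach_table_loop[where f = "\<lambda>i j. ?P i j * Mrow n j"])
      (simp_all add: frameD k n Mn q_def)
  then obtain s1 where r1: "reach (k * (k * 4 + 10) + 3) (table_loop ''q'' ''i'' (Var ''k'') ''acc'' ''j'' (Var ''k'')
        (Mul (entry ''P'' ''i'' ''j'') (entry ''M'' ''n'' ''j'')) (Var ''acc'')) s s1"
    and f1: "frame {''q'', ''i'', ''acc'', ''j''} s s1" and q1: "\<And>i. i < k \<Longrightarrow> s1 ''q'' (int i) = q i"
    by blast
  define s2 where "s2 = store (store s1 ''al'' 0 \<alpha>) ''j'' 0 (real k)"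
  have r2: "reach (k * 4 + 5) (sum_loop ''al'' ''j'' (Var ''k'')
      (Mul (entry ''M'' ''n'' ''j'') (Cell ''q'' (Var ''j'')))) s1 s2"
    unfolding s2_def \<alpha>_def
    by (rule reach_sum_loop) (simp_all add: frameD[OF f1] k n Mn q1)
  define s3 where "s3 = store (store s2 ''be'' 0 \<beta>) ''j'' 0 (real k)"
  have r3: "reach (k * 4 + 5) (sum_loop ''be'' ''j'' (Var ''k'')
      (Mul (entry ''M'' ''n'' ''j'') (Cell ''y'' (Var ''j'')))) s2 s3"
    unfolding s3_def \<beta>_def
    by (rule reach_sum_loop) (simp_all add: s2_def frameD[OF f1] k n Mn)
  have s3: "s3 ''k'' 0 = real k" "s3 ''n'' 0 = real n" "s3 ''al'' 0 = \<alpha>" "s3 ''be'' 0 = \<beta>"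
    "s3 ''y'' = s ''y''" "s3 ''P'' = s ''P''" "s3 ''b'' = s ''b''" "s3 ''m'' = s ''m''"
    "\<And>i. i < k \<Longrightarrow> s3 ''q'' (int i) = q i"
    by (simp_all add: s3_def s2_def frameD[OF f1] k n q1)
  have f3: "frame (solve_vars - {''n''}) s s3"
    using frame_mono[OF f1, of "solve_vars - {''n''}"] by (simp add: s3_def s2_def solve_vars_def)
  let ?y' = "\<lambda>b. ?y b + q b * (c n - \<beta>) / \<alpha>"
  have "\<exists>s4. reach (k * (0 * 4 + 10) + 3) (table_loop ''y'' ''i'' (Var ''k'') ''acc'' ''j'' (Num 0) (Num 0)
        (Add (Cell ''y'' (Var ''i'')) (Div (Mul (Cell ''q'' (Var ''i''))
           (Sub (Sub (Cell ''b'' (Var ''n'')) (Cell ''m'' (Var ''n''))) (Var ''be''))) (Var ''al'')))) s3 s4 \<and>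
      frame {''y'', ''i'', ''acc'', ''j''} s3 s4 \<and> (\<forall>i<k. s4 ''y'' (int i) = ?y' i)"
    by (rule reach_table_loop[where f = "\<lambda>_ _. 0"]) (simp_all add: frameD s3 c)
  then obtain s4 where r4: "reach (k * (0 * 4 + 10) + 3) (table_loop ''y'' ''i'' (Var ''k'') ''acc'' ''j'' (Num 0) (Num 0)
        (Add (Cell ''y'' (Var ''i'')) (Div (Mul (Cell ''q'' (Var ''i''))
           (Sub (Sub (Cell ''b'' (Var ''n'')) (Cell ''m'' (Var ''n''))) (Var ''be''))) (Var ''al'')))) s3 s4"
    and f4: "frame {''y'', ''i'', ''acc'', ''j''} s3 s4" and y4: "\<And>i. i < k \<Longrightarrow> s4 ''y'' (int i) = ?y' i"
    by blast
  let ?P' = "\<lambda>i. s ''P'' (int i) - q (i div k) * q (i mod k) / \<alpha>"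
  have "\<exists>s5. reach (k * k * (0 * 4 + 10) + 3) (table_loop ''P'' ''i'' (Mul (Var ''k'') (Var ''k'')) ''acc'' ''j'' (Num 0) (Num 0)
        (Sub (Cell ''P'' (Var ''i''))
           (Div (Mul (Cell ''q'' (row_of ''i'')) (Cell ''q'' (col_of ''i''))) (Var ''al'')))) s4 s5 \<and>
      frame {''P'', ''i'', ''acc'', ''j''} s4 s5 \<and> (\<forall>i<k * k. s5 ''P'' (int i) = ?P' i)"
  proof (rule reach_table_loop[where f = "\<lambda>_ _. 0"])
    fix i s' assume i: "i < k * k" and st: "frame {''P'', ''i'', ''acc'', ''j''} s4 s'" "s' ''i'' 0 = real i"
      "s' ''P'' (int i) = s4 ''P'' (int i)"
    have "i div k < k" "i mod k < k"
      using i by (auto simp: less_mult_imp_div_less intro!: mod_less_divisor Nat.gr0I)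
    then show "aval (Sub (Cell ''P'' (Var ''i''))
           (Div (Mul (Cell ''q'' (row_of ''i'')) (Cell ''q'' (col_of ''i''))) (Var ''al''))) s' = ?P' i"
      using st by (simp add: frameD[OF st(1)] frameD[OF f4] s3 real_mod_nat)
  qed (simp_all add: frameD frameD[OF f4] s3)
  then obtain s5 where r5: "reach (k * k * (0 * 4 + 10) + 3) (table_loop ''P'' ''i'' (Mul (Var ''k'') (Var ''k'')) ''acc'' ''j'' (Num 0) (Num 0)
        (Sub (Cell ''P'' (Var ''i''))
           (Div (Mul (Cell ''q'' (row_of ''i'')) (Cell ''q'' (col_of ''i''))) (Var ''al'')))) s4 s5"
    and f5: "frame {''P'', ''i'', ''acc'', ''j''} s4 s5" and P5: "\<And>i. i < k * k \<Longrightarrow> s5 ''P'' (int i) = ?P' i"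
    by blast
  have "reach step_time elimination_step s s5"
    unfolding elimination_step_def step_time_def
    by (rule reach_mono[OF reach_Seq[OF r1 reach_Seq[OF r2 reach_Seq[OF r3 reach_Seq[OF r4 r5]]]]]) simp
  moreover have "frame (solve_vars - {''n''}) s s5"
    by (rule frame_trans[OF frame_trans[OF f3 f4 subset_refl] f5]) (simp add: solve_vars_def)
  moreover have "\<alpha> \<noteq> 0"
  proof -
    obtain B where B: "B \<in> carrier_mat k k" "rmat M * B = 1\<^sub>m k"
      using real_mat_inverse[OF M det] by metis
    \<comment> \<open>Column n of the inverse of M is the dual vector required by
      \<open>projector_pivot_nonzero\<close>.\<close>
    have "(\<Sum>b<k. Mrow j b * B $$ (b, n)) = (if j = n then 1 else 0)" if "j \<le> n" for j
    proof -
      have "(\<Sum>b<k. Mrow j b * B $$ (b, n)) = (rmat M * B) $$ (j, n)"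
        using that n(2) M B(1) by (simp add: scalar_prod_def lessThan_atLeast0)
      also have "\<dots> = (if j = n then 1 else 0)" unfolding B(2) using that n(2) by simp
      finally show ?thesis .
    qed
    then show ?thesis
      by (rule projector_pivot_nonzero[OF P q_def \<alpha>_def])
  qed
  moreover have "projector k Mrow (Suc n) (mem_mat ''P'' s5)"
  proof -
    have "projector k Mrow (Suc n) (\<lambda>a b. ?P a b - q a * q b / \<alpha>)"
      by (rule projector_step[OF P q_def \<alpha>_def \<open>\<alpha> \<noteq> 0\<close>])
    then show ?thesis
      by (subst projector_cong[where P' = "\<lambda>a b. ?P a b - q a * q b / \<alpha>"])
        (simp_all only: P5 row_major)
  qed
  moreover have "(\<Sum>b<k. Mrow j b * mem_vec ''y'' s5 b) = c j" if "j < Suc n" for j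
  proof (rule projector_solution_step[OF P q_def \<alpha>_def \<open>\<alpha> \<noteq> 0\<close> y _ that])
    show "mem_vec ''y'' s5 b = ?y b + q b * (c n - (\<Sum>b<k. Mrow n b * ?y b)) / \<alpha>" if "b < k" for b
      using y4[OF that] by (simp add: frameD[OF f5] \<beta>_def)
  qed
  ultimately show ?thesis by blast
qed

definition "solve_time = k * (step_time + 3) + k * k * 10 + 7"

text \<open>For n = 0 the invariant asks nothing of y, so the iteration may start from whatever the
  array contains; after k rows every equation holds.\<close>

lemma reach_solve:
  assumes prep: "prepared s"
  shows "\<exists>s'. reach solve_time solve_prog s s' \<and> frame solve_vars s s' \<and>
     (\<forall>j<k. (\<Sum>b<k. Mrow j b * mem_vec ''y'' s' b) = mem_vec ''b'' s j - m $ j)"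
proof -
  let ?c = "\<lambda>j. mem_vec ''b'' s j - m $ j"
  have k: "s ''k'' 0 = real k" using prep by (simp add: prepared_def)
  let ?\<delta> = "\<lambda>i. if i div k = i mod k then 1 else 0 :: real"
  have "\<exists>s1. reach (k * k * (0 * 4 + 10) + 3) (table_loop ''P'' ''i'' (Mul (Var ''k'') (Var ''k'')) ''acc'' ''j'' (Num 0) (Num 0)
        (Sub (Num 1) (Div (Sub (row_of ''i'') (col_of ''i'')) (Sub (row_of ''i'') (col_of ''i''))))) s s1 \<and>
      frame {''P'', ''i'', ''acc'', ''j''} s s1 \<and> (\<forall>i<k * k. s1 ''P'' (int i) = ?\<delta> i)"
    by (rule reach_table_loop[where f = "\<lambda>_ _. 0"]) (simp_all add: frameD k real_mod_nat)
  then obtain s1 where r1: "reach (k * k * (0 * 4 + 10) + 3) (table_loop ''P'' ''i'' (Mul (Var ''k'') (Var ''k'')) ''acc'' ''j'' (Num 0) (Num 0)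
        (Sub (Num 1) (Div (Sub (row_of ''i'') (col_of ''i'')) (Sub (row_of ''i'') (col_of ''i''))))) s s1"
    and f1: "frame {''P'', ''i'', ''acc'', ''j''} s s1" and P1: "\<And>i. i < k * k \<Longrightarrow> s1 ''P'' (int i) = ?\<delta> i"
    by blast
  let ?I = "\<lambda>n s'. frame solve_vars s s' \<and> s' ''n'' 0 = real n \<and> projector k Mrow n (mem_mat ''P'' s') \<and>
     (\<forall>j<n. (\<Sum>b<k. Mrow j b * mem_vec ''y'' s' b) = ?c j)"
  have "\<exists>s'. reach (k * (step_time + 3) + 3) (for_loop ''n'' (Var ''k'') elimination_step) s1 s' \<and> ?I k s'"
  proof (rule reach_for_loop[where I = ?I])
    have "projector k Mrow 0 (mem_mat ''P'' s1)"
      by (subst projector_cong[where P' = "\<lambda>a b. if a = b then 1 else 0"])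
        (simp_all only: P1 row_major projector_0)
    moreover have "frame solve_vars s s1" using frame_mono[OF f1] by (simp add: solve_vars_def)
    ultimately show "?I 0 (store s1 ''n'' 0 0)" by (simp add: solve_vars_def)
  next
    fix n s' assume n: "n < k" and I: "?I n s'"
    have fr: "frame solve_vars s s'" using I by blast
    have prep': "prepared s'"
      by (rule prepared_frame[OF fr _ prep]) (simp add: solve_vars_def data_vars_def)
    have b: "s' ''b'' = s ''b''" by (rule frameD[OF fr]) (simp add: solve_vars_def)
    have "?c n = mem_vec ''b'' s' n - mem_vec ''m'' s' n"
      using prep' n by (simp add: b prepared_def)
    then obtain s'' where s'': "reach step_time elimination_step s' s''" "frame (solve_vars - {''n''}) s' s''"
        "projector k Mrow (Suc n) (mem_mat ''P'' s'')"
        "\<forall>j<Suc n. (\<Sum>b<k. Mrow j b * mem_vec ''y'' s'' b) = ?c j"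
      using reach_elimination_step[OF prep' _ n, of ?c] I by blast
    have "s'' ''n'' 0 = real n" using frameD[OF s''(2), of "''n''"] I by simp
    moreover have "frame solve_vars s s''" by (rule frame_trans[OF fr s''(2)]) auto
    ultimately show "\<exists>s''. reach step_time elimination_step s' s'' \<and> s'' ''n'' 0 = real n \<and>
        ?I (Suc n) (store s'' ''n'' 0 (real (Suc n)))"
      using s'' by (intro exI[of _ s'']) (simp add: solve_vars_def)
  next
    fix n s' assume "?I n s'"
    then show "s' ''n'' 0 = real n" "aval (Var ''k'') s' = real k"
      using k frameD[of solve_vars s s' "''k''"] by (simp_all add: solve_vars_def)
  qed
  then obtain s' where s': "reach (k * (step_time + 3) + 3) (for_loop ''n'' (Var ''k'') elimination_step) s1 s'"
    "?I k s'" by blast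
  have "reach solve_time solve_prog s s'"
    unfolding solve_prog_def solve_time_def by (rule reach_mono[OF reach_Seq[OF r1 s'(1)]]) simp
  then show ?thesis using s'(2) by blast
qed

definition "point_time = (k * 6 + 5) + (k * (k * 4 + 10) + 3) + solve_time + (k * 10 + 3) +
  (k * (k * 4 + 10) + 3) + 4"

lemma reach_point:
  assumes prep: "prepared s" and n: "s ''lo'' 0 = real n"
  shows "\<exists>s'. reach point_time point_prog s s' \<and> vec k (\<lambda>i. s' ''out'' (int i)) = rvec (point n)"
proof -
  obtain s1 where r1: "reach (k * 6 + 5) digits_prog s s1" and f1: "frame {''r'', ''l'', ''dig''} s s1"
    and dig: "\<And>i. i < k \<Longrightarrow> s1 ''dig'' (int i) = real (digit d n i)"
    using reach_digits[OF prep n] by blast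
  have p1: "prepared s1" by (rule prepared_frame[OF f1 _ prep]) (simp add: data_vars_def)
  define x0 where "x0 = U *\<^sub>v code n"
  have x0: "x0 \<in> carrier_vec k" using U by (simp add: x0_def)
  have x0_sum: "real_of_int (x0 $ i) = (\<Sum>j<k. real_of_int (U $$ (i, j)) * real (digit d n j))" if "i < k" for i
    using that U by (simp add: x0_def code_def scalar_prod_def lessThan_atLeast0)
  have "\<exists>s2. reach (k * (k * 4 + 10) + 3) (table_loop ''b'' ''i'' (Var ''k'') ''acc'' ''j'' (Var ''k'')
        (Mul (entry ''U'' ''i'' ''j'') (Cell ''dig'' (Var ''j''))) (Var ''acc'')) s1 s2 \<and>
      frame {''b'', ''i'', ''acc'', ''j''} s1 s2 \<and> (\<forall>i<k. s2 ''b'' (int i) = real_of_int (x0 $ i))"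
    by (rule reach_table_loop[where f = "\<lambda>i j. real_of_int (U $$ (i, j)) * real (digit d n j)"])
      (use p1 in \<open>simp_all add: frameD prepared_def dig x0_sum\<close>)
  then obtain s2 where r2: "reach (k * (k * 4 + 10) + 3) (table_loop ''b'' ''i'' (Var ''k'') ''acc'' ''j'' (Var ''k'')
        (Mul (entry ''U'' ''i'' ''j'') (Cell ''dig'' (Var ''j''))) (Var ''acc'')) s1 s2"
    and f2: "frame {''b'', ''i'', ''acc'', ''j''} s1 s2" and b: "\<And>i. i < k \<Longrightarrow> s2 ''b'' (int i) = real_of_int (x0 $ i)"
    by blast
  have p2: "prepared s2" by (rule prepared_frame[OF f2 _ p1]) (simp add: data_vars_def)
  obtain s3 where r3: "reach solve_time solve_prog s2 s3" and f3: "frame solve_vars s2 s3"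
    and y: "\<And>j. j < k \<Longrightarrow> (\<Sum>b<k. Mrow j b * s3 ''y'' (int b)) = real_of_int (x0 $ j) - m $ j"
    using reach_solve[OF p2] b by auto
  have p3: "prepared s3" by (rule prepared_frame[OF f3 _ p2]) (simp add: data_vars_def solve_vars_def)
  have b3: "s3 ''b'' = s2 ''b''" by (rule frameD[OF f3]) (simp add: solve_vars_def)
  define y where "y = vec k (\<lambda>i. s3 ''y'' (int i))"
  have yk: "y \<in> carrier_vec k" by (simp add: y_def)
  have My: "rmat M *\<^sub>v y = rvec x0 - m"
    using M m x0 y by (intro eq_vecI) (auto simp: y_def scalar_prod_def lessThan_atLeast0)
  define z where "z = vec k (\<lambda>i. \<lfloor>1/2 - y $ i\<rfloor>)"
  have "x0 + M *\<^sub>v z \<in> fund_points k M m"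
    unfolding z_def by (rule fund_points_round[OF M m x0 yk My])
  \<comment> \<open>The vector lies in the cell and in the class of U times the digits, so
    uniqueness identifies it.\<close>
  then have pt: "point n = x0 + M *\<^sub>v z"
    by (intro point_eqI) (auto simp: represents_code_def x0_def z_def)
  have "\<exists>s4. reach (k * (0 * 4 + 10) + 3) (table_loop ''z'' ''i'' (Var ''k'') ''acc'' ''j'' (Num 0) (Num 0)
        (Floor (Sub (Div (Num 1) (Num 2)) (Cell ''y'' (Var ''i''))))) s3 s4 \<and>
      frame {''z'', ''i'', ''acc'', ''j''} s3 s4 \<and> (\<forall>i<k. s4 ''z'' (int i) = real_of_int (z $ i))"
    by (rule reach_table_loop[where f = "\<lambda>_ _. 0"])
      (use p3 in \<open>simp_all add: frameD prepared_def z_def y_def\<close>)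
  then obtain s4 where r4: "reach (k * (0 * 4 + 10) + 3) (table_loop ''z'' ''i'' (Var ''k'') ''acc'' ''j'' (Num 0) (Num 0)
        (Floor (Sub (Div (Num 1) (Num 2)) (Cell ''y'' (Var ''i''))))) s3 s4"
    and f4: "frame {''z'', ''i'', ''acc'', ''j''} s3 s4" and z4: "\<And>i. i < k \<Longrightarrow> s4 ''z'' (int i) = real_of_int (z $ i)"
    by blast
  have p4: "prepared s4" by (rule prepared_frame[OF f4 _ p3]) (simp add: data_vars_def)
  have b4: "s4 ''b'' (int i) = real_of_int (x0 $ i)" if "i < k" for i
    using b[OF that] by (simp add: frameD[OF f4] b3)
  have out_sum: "real_of_int ((x0 + M *\<^sub>v z) $ i) = real_of_int (x0 $ i) + (\<Sum>j<k. Mrow i j * real_of_int (z $ j))"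
    if "i < k" for i
    using that M x0 by (simp add: z_def scalar_prod_def lessThan_atLeast0)
  have "\<exists>s5. reach (k * (k * 4 + 10) + 3) (table_loop ''out'' ''i'' (Var ''k'') ''acc'' ''j'' (Var ''k'')
        (Mul (entry ''M'' ''i'' ''j'') (Cell ''z'' (Var ''j'')))
        (Add (Cell ''b'' (Var ''i'')) (Var ''acc''))) s4 s5 \<and>
      frame {''out'', ''i'', ''acc'', ''j''} s4 s5 \<and> (\<forall>i<k. s5 ''out'' (int i) = real_of_int ((x0 + M *\<^sub>v z) $ i))"
    by (rule reach_table_loop[where f = "\<lambda>i j. Mrow i j * real_of_int (z $ j)"])
      (use p4 in \<open>simp_all add: frameD prepared_def b4 z4 out_sum del: index_add_vec\<close>)
  then obtain s5 where r5: "reach (k * (k * 4 + 10) + 3) (table_loop ''out'' ''i'' (Var ''k'') ''acc'' ''j'' (Var ''k'')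
        (Mul (entry ''M'' ''i'' ''j'') (Cell ''z'' (Var ''j'')))
        (Add (Cell ''b'' (Var ''i'')) (Var ''acc''))) s4 s5"
    and out: "\<And>i. i < k \<Longrightarrow> s5 ''out'' (int i) = real_of_int ((x0 + M *\<^sub>v z) $ i)"
    by blast
  have "reach point_time point_prog s s5"
    unfolding point_prog_def point_time_def
    by (rule reach_mono[OF reach_Seq[OF r1 reach_Seq[OF r2 reach_Seq[OF r3 reach_Seq[OF r4 r5]]]]]) simp
  moreover have "vec k (\<lambda>i. s5 ''out'' (int i)) = rvec (point n)"
    unfolding pt using M x0 by (intro eq_vecI) (simp_all add: out del: index_add_vec(1))
  ultimately show ?thesis by blast
qed

end


section \<open>The sampler\<close>

text \<open>For an integer \<open>x \<noteq> 0\<close> the expression below uses \<open>\<lfloor>1 / (2 * x)\<rfloor> = (if x > 0 then 0 else - 1)\<close>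
  to compute \<open>\<bar>x\<bar>\<close>.\<close>

definition init_prog :: prog where
  "init_prog =
     (table_loop ''d'' ''i'' (Var ''k'') ''acc'' ''j'' (Num 0) (Num 0)
        (Mul (entry ''D'' ''i'' ''i'')
           (Add (Num 1) (Mul (Num 2) (Floor (Div (Num 1) (Mul (Num 2) (entry ''D'' ''i'' ''i''))))))) ;;
      set_var ''N'' (Num 1) ;;
      for_loop ''i'' (Var ''k'') (set_var ''N'' (Mul (Var ''N'') (Cell ''d'' (Var ''i'')))) ;;
      set_var ''R'' (Num 1) ;;
      set_var ''u'' (Num 0))"

text \<open>Resetting \<open>c\<close> makes the memory a function of the number of rounds and of
  the integer read so far, independent of the last bit otherwise. Testing R eps < 2 N finds the
  number of bits without a logarithm.\<close>

definition bits_loop :: prog where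
  "bits_loop =
     While (Less (Mul (Var ''R'') (Var ''eps'')) (Mul (Num 2) (Var ''N'')))
       (RandomBit ''c'' (Num 0) ;;
        set_var ''u'' (Add (Mul (Num 2) (Var ''u'')) (Var ''c'')) ;;
        set_var ''c'' (Num 0) ;;
        set_var ''R'' (Mul (Num 2) (Var ''R'')))"

definition inversion_prog :: prog where
  "inversion_prog = (set_var ''u'' (Div (Var ''u'') (Var ''R'')) ;; search_prog ;; point_prog)"

definition sampler_prog :: prog where
  "sampler_prog = (init_prog ;; bits_loop ;; inversion_prog)"

lemma floor_sign:
  fixes x :: int
  assumes "x \<noteq> 0"
  shows "real_of_int x * (1 + 2 * real_of_int \<lfloor>1 / (2 * real_of_int x)\<rfloor>) = real (nat \<bar>x\<bar>)"
proof (cases "x > 0")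
  case True
  then have "\<lfloor>1 / (2 * real_of_int x)\<rfloor> = 0" by (intro floor_unique) (simp_all add: field_simps)
  then show ?thesis using True by simp
next
  case False
  then have "x \<le> -1" using assms by simp
  then have "real_of_int x \<le> -1" by linarith
  then have "\<lfloor>1 / (2 * real_of_int x)\<rfloor> = -1" by (intro floor_unique) (simp_all add: field_simps)
  then show ?thesis using False by simp
qed

lemma arr_index: "i < n \<Longrightarrow> arr n f (int i) = f i"
  by (simp add: arr_def)

lemma row_major_less: "t < l \<Longrightarrow> b < (k :: nat) \<Longrightarrow> t * k + b < l * k"
  by (metis add.commute add_less_cancel_left less_le_trans mult_Suc mult_le_mono1 Suc_leI)

lemma arr_row_major:
  assumes "t < l" "b < (k :: nat)"
  shows "arr (l * k) (\<lambda>i. f (i div k) (i mod k)) (int t * int k + int b) = f t b"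
proof -
  have "(t * k + b) div k = t" "(t * k + b) mod k = b" using assms by simp_all
  then show ?thesis
    using arr_index[OF row_major_less[OF assms], of "\<lambda>i. f (i div k) (i mod k)"] by simp
qed

lemma mat_arr_index: "i < k \<Longrightarrow> j < k \<Longrightarrow> mat_arr k A (int i * int k + int j) = real_of_int (A $$ (i, j))"
  unfolding mat_arr_def by (rule arr_row_major[where f = "\<lambda>i j. real_of_int (A $$ (i, j))"])

section \<open>The random loop as a single uniform draw\<close>

definition bits_state :: "memory \<Rightarrow> nat \<Rightarrow> nat \<Rightarrow> memory" where
  "bits_state s i j = store (store s ''u'' 0 (real j)) ''R'' 0 (2 ^ i)"

text \<open>Eight steps are the test, three sequence nodes and four commands. The count is the same
  for both bits, so all random branches stay synchronized.\<close>

lemma run_bits_step: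
  assumes "s ''c'' 0 = 0" "2 ^ i * s ''eps'' 0 < 2 * s ''N'' 0"
  shows "run 8 (bits_loop # ps, bits_state s i j) =
    map_pmf (\<lambda>c. (bits_loop # ps, bits_state s (Suc i) (2 * j + of_bool c))) (bernoulli_pmf (1/2))"
proof -
  have "store (store (store (store (bits_state s i j) ''c'' 0 (of_bool c)) ''u'' 0 (2 * real j + of_bool c))
      ''c'' 0 0) ''R'' 0 (2 * 2 ^ i) = bits_state s (Suc i) (2 * j + of_bool c)" for c
    using assms(1) by (auto simp: bits_state_def store_def fun_eq_iff)
  then show ?thesis
    using assms(2)
    by (simp add: bits_loop_def set_var_def eval_nat_numeral bind_return_pmf bind_map_pmf
        map_pmf_def[symmetric] bits_state_def)
qed

lemma run_bits:
  assumes "s ''c'' 0 = 0" "s ''u'' 0 = 0" "s ''R'' 0 = 1"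
    and "\<And>i. i < b \<Longrightarrow> 2 ^ i * s ''eps'' 0 < 2 * s ''N'' 0"
  shows "run (8 * b) (bits_loop # ps, s) =
    map_pmf (\<lambda>j. (bits_loop # ps, bits_state s b j)) (uniform_bits b)"
  using assms(4)
proof (induction b)
  case 0
  have "bits_state s 0 0 = s" using assms(2,3) by (auto simp: bits_state_def store_def fun_eq_iff)
  then show ?case by simp
next
  case (Suc b)
  have "run (8 * Suc b) (bits_loop # ps, s) =
      bind_pmf (uniform_bits b) (\<lambda>j. run 8 (bits_loop # ps, bits_state s b j))"
    using Suc by (simp add: add.commute[of 8] run_add bind_map_pmf del: run.simps)
  then show ?case
    using Suc.prems[of b] assms(1) by (simp add: run_bits_step map_bind_pmf pmf.map_comp comp_def)
qed

text \<open>Minimality gives 2^(b-1) < x, and ln 2 \<ge> 1/2 turns this into b < 1 + 2 ln x. The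
  maximum with 0 covers x \<le> 1, where b = 0.\<close>

lemma power_of_2_above:
  fixes x :: real
  obtains b where "x \<le> 2 ^ b" "\<And>i. i < b \<Longrightarrow> 2 ^ i < x" "real b \<le> 1 + 2 * max 0 (ln x)"
proof
  define b where "b = (LEAST b. x \<le> 2 ^ b)"
  have "\<exists>b. x \<le> 2 ^ b" using real_arch_pow[of 2 x] by (auto intro: less_imp_le)
  then show "x \<le> 2 ^ b" unfolding b_def by (rule LeastI_ex)
  show less: "2 ^ i < x" if "i < b" for i
    using not_less_Least[of i "\<lambda>b. x \<le> 2 ^ b"] that by (simp add: b_def)
  show "real b \<le> 1 + 2 * max 0 (ln x)"
  proof (cases b)
    case (Suc b')
    have "2 ^ b' < x" using less Suc by simp
    then have "ln (2 ^ b') < ln x" by (subst ln_less_cancel_iff) (auto intro: less_trans[of _ "2 ^ b'"])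
    then have "real b' * ln 2 < ln x" by (simp add: ln_realpow)
    \<comment> \<open>This is ln(1/2) \<le> -1/2 with the sign reversed.\<close>
    moreover have "1 / 2 \<le> ln (2 :: real)"
      using ln_le_minus_one[of "1/2 :: real"] by (simp add: ln_div)
    then have "real b' * (1 / 2) \<le> real b' * ln 2" by (intro mult_left_mono) simp_all
    ultimately show ?thesis using Suc by simp
  qed simp
qed

section \<open>The assembled sampler: error and running time\<close>

context sampler_instance
begin

definition "init_time = (k * 10 + 3) + (k * 4 + 3) + 7"

lemma reach_init:
  fixes \<epsilon> :: real
  defines "s \<equiv> sampler_input k M m \<epsilon> \<xi>s Hhat U D V"
  shows "\<exists>s'. reach init_time init_prog s s' \<and> prepared s' \<and>
    s' ''c'' 0 = 0 \<and> s' ''u'' 0 = 0 \<and> s' ''R'' 0 = 1 \<and> s' ''eps'' 0 = \<epsilon>"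
proof -
  have inputs: "s ''k'' 0 = real k" "s ''card_T'' 0 = real (length \<xi>s)" "s ''eps'' 0 = \<epsilon>" "s ''c'' 0 = 0"
    "\<And>i. i < k \<Longrightarrow> s ''m'' (int i) = m $ i"
    "\<And>i j. i < k \<Longrightarrow> j < k \<Longrightarrow> s ''M'' (int i * int k + int j) = real_of_int (M $$ (i, j))"
    "\<And>i j. i < k \<Longrightarrow> j < k \<Longrightarrow> s ''U'' (int i * int k + int j) = real_of_int (U $$ (i, j))"
    "\<And>i j. i < k \<Longrightarrow> j < k \<Longrightarrow> s ''D'' (int i * int k + int j) = real_of_int (D $$ (i, j))"
    "\<And>t i. t < length \<xi>s \<Longrightarrow> i < k \<Longrightarrow> s ''xi'' (int t * int k + int i) = \<xi>s ! t $ i"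
    "\<And>t. t < length \<xi>s \<Longrightarrow> s ''Hhat_re'' (int t) = Re (Hhat (coset k (\<xi>s ! t)))"
    "\<And>t. t < length \<xi>s \<Longrightarrow> s ''Hhat_im'' (int t) = Im (Hhat (coset k (\<xi>s ! t)))"
    using arr_index[of 0 1]
    by (simp_all add: s_def sampler_input_def arr_index mat_arr_index
        arr_row_major[where f = "\<lambda>t i. \<xi>s ! t $ i"])
  let ?D = "entry ''D'' ''i'' ''i''"
  let ?e = "Mul ?D (Add (Num 1) (Mul (Num 2) (Floor (Div (Num 1) (Mul (Num 2) ?D)))))"
  have "\<exists>s1. reach (k * (0 * 4 + 10) + 3)
      (table_loop ''d'' ''i'' (Var ''k'') ''acc'' ''j'' (Num 0) (Num 0) ?e) s s1 \<and>
      frame {''d'', ''i'', ''acc'', ''j''} s s1 \<and> (\<forall>i<k. s1 ''d'' (int i) = real (d i))"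
    by (rule reach_table_loop[where f = "\<lambda>_ _. 0"])
      (simp_all add: frameD inputs floor_sign D_nonzero d_def)
  then obtain s1 where r1: "reach (k * (0 * 4 + 10) + 3)
      (table_loop ''d'' ''i'' (Var ''k'') ''acc'' ''j'' (Num 0) (Num 0) ?e) s s1"
    and f1: "frame {''d'', ''i'', ''acc'', ''j''} s s1" and d1: "\<And>i. i < k \<Longrightarrow> s1 ''d'' (int i) = real (d i)"
    by blast
  let ?W = "{''N'', ''i''}" and ?p = "set_var ''N'' (Mul (Var ''N'') (Cell ''d'' (Var ''i'')))"
  define s2 where "s2 = store s1 ''N'' 0 1"
  let ?I = "\<lambda>i s'. frame ?W s1 s' \<and> s' ''i'' 0 = real i \<and> s' ''N'' 0 = real (place d i)"
  have "\<exists>s'. reach (k * (1 + 3) + 3) (for_loop ''i'' (Var ''k'') ?p) s2 s' \<and> ?I k s'"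
  proof (rule reach_for_loop[where I = ?I])
    show "?I 0 (store s2 ''i'' 0 0)" by (simp add: s2_def)
  next
    fix i s' assume i: "i < k" and I: "?I i s'"
    define s3 where "s3 = store s' ''N'' 0 (real (place d (Suc i)))"
    have "s' ''d'' = s1 ''d''" by (rule frameD[of ?W]) (use I in simp_all)
    then have "reach 1 ?p s' s3"
      unfolding s3_def using I i by (intro reach_set_varI) (simp add: d1 place_Suc)
    moreover have "s3 ''i'' 0 = real i" "?I (Suc i) (store s3 ''i'' 0 (real (Suc i)))"
      using I by (simp_all add: s3_def)
    ultimately show "\<exists>s''. reach 1 ?p s' s'' \<and> s'' ''i'' 0 = real i \<and> ?I (Suc i) (store s'' ''i'' 0 (real (Suc i)))"
      by blast
  next
    fix i s' assume I: "?I i s'"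
    then have "s' ''k'' = s1 ''k''" by (intro frameD[of ?W]) simp_all
    then show "s' ''i'' 0 = real i" "aval (Var ''k'') s' = real k"
      using I by (simp_all add: frameD[OF f1] inputs)
  qed
  then obtain s3 where r3: "reach (k * (1 + 3) + 3) (for_loop ''i'' (Var ''k'') ?p) s2 s3" and I: "?I k s3" by blast
  then have f3: "frame ?W s1 s3" by blast
  define s4 where "s4 = store s3 ''R'' 0 1"
  define s5 where "s5 = store s4 ''u'' 0 0"
  have r: "reach 1 (set_var ''N'' (Num 1)) s1 s2" "reach 1 (set_var ''R'' (Num 1)) s3 s4"
    "reach 1 (set_var ''u'' (Num 0)) s4 s5"
    unfolding s2_def s4_def s5_def by (auto intro!: reach_set_varI simp del: One_nat_def)
  have "reach init_time init_prog s s5"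
    unfolding init_prog_def init_time_def
    by (rule reach_mono[OF reach_Seq[OF r1 reach_Seq[OF r(1) reach_Seq[OF r3 reach_Seq[OF r(2,3)]]]]]) simp
  moreover have "prepared s5"
    using I by (simp add: prepared_def s5_def s4_def N_def frameD[OF f3] frameD[OF f1] d1 inputs)
  moreover have "s5 ''c'' 0 = 0 \<and> s5 ''u'' 0 = 0 \<and> s5 ''R'' 0 = 1 \<and> s5 ''eps'' 0 = \<epsilon>"
    by (simp add: s5_def s4_def frameD[OF f3] frameD[OF f1] inputs)
  ultimately show ?thesis by blast
qed

definition "inversion_time b = search_time b + point_time + 3"

lemma reach_inversion:
  assumes prep: "prepared s" and j: "j < 2 ^ b" and b': "N \<le> 2 ^ b'"
  shows "\<exists>s' n. reach (inversion_time b') inversion_prog (bits_state s b j) s' \<and>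
    vec k (\<lambda>i. s' ''out'' (int i)) = rvec (point n) \<and>
    n < N \<and> cdf n \<le> real j / 2 ^ b \<and> real j / 2 ^ b < cdf (Suc n)"
proof -
  define s1 where "s1 = store (bits_state s b j) ''u'' 0 (real j / 2 ^ b)"
  have r1: "reach 1 (set_var ''u'' (Div (Var ''u'') (Var ''R''))) (bits_state s b j) s1"
    unfolding s1_def by (rule reach_set_varI) (simp add: bits_state_def)
  have "frame {''u'', ''R''} s s1" by (simp add: s1_def bits_state_def)
  then have p1: "prepared s1" by (rule prepared_frame[OF _ _ prep]) (simp add: data_vars_def)
  have "real j < real (2 ^ b)" using j by (simp only: of_nat_less_iff)
  then have "0 \<le> s1 ''u'' 0" "s1 ''u'' 0 < 1" by (simp_all add: s1_def)
  then obtain s2 n where r2: "reach (search_time b') search_prog s1 s2" and f2: "frame search_vars s1 s2"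
    and n: "s2 ''lo'' 0 = real n" "n < N" "cdf n \<le> s1 ''u'' 0" "s1 ''u'' 0 < cdf (Suc n)"
    using reach_search[OF p1 _ _ b'] by blast
  have p2: "prepared s2" by (rule prepared_frame[OF f2 _ p1])
     (simp add: search_vars_def cdf_vars_def digit_vars_def data_vars_def)
  obtain s3 where r3: "reach point_time point_prog s2 s3"
    and out: "vec k (\<lambda>i. s3 ''out'' (int i)) = rvec (point n)"
    using reach_point[OF p2 n(1)] by blast
  have "reach (inversion_time b') inversion_prog (bits_state s b j) s3"
    unfolding inversion_prog_def inversion_time_def
    by (rule reach_mono[OF reach_Seq[OF r1 reach_Seq[OF r2 r3]]]) simp
  moreover have "cdf n \<le> real j / 2 ^ b" "real j / 2 ^ b < cdf (Suc n)"
    using n by (simp_all add: s1_def)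
  ultimately show ?thesis using out n(2) by blast
qed

lemma sampler_correct:
  fixes \<epsilon> :: real and P :: "int vec pmf"
  assumes \<epsilon>: "0 < \<epsilon>" and P: "set_pmf P \<subseteq> fund_points k M m"
    and HP: "dTV (fund_points k M m) H (pmf P) \<le> \<epsilon> / 3"
    and b: "2 * real N / \<epsilon> \<le> 2 ^ b" "\<And>i. i < b \<Longrightarrow> 2 ^ i < 2 * real N / \<epsilon>"
    and b': "N \<le> 2 ^ b'"
  shows "\<exists>Q n. samples_within sampler_prog (sampler_input k M m \<epsilon> \<xi>s Hhat U D V) n k Q \<and>
    set_pmf Q \<subseteq> fund_points k M m \<and> dTV (fund_points k M m) (pmf P) (pmf Q) \<le> \<epsilon> \<and>
    n \<le> init_time + 8 * b + inversion_time b' + 3"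
proof -
  let ?S = "fund_points k M m"
  obtain s where init: "reach init_time init_prog (sampler_input k M m \<epsilon> \<xi>s Hhat U D V) s"
    and prep: "prepared s" and s: "s ''c'' 0 = 0" "s ''u'' 0 = 0" "s ''R'' 0 = 1" "s ''eps'' 0 = \<epsilon>"
    using reach_init by blast
  obtain n0 where n0: "n0 \<le> init_time"
    "\<And>ps. run n0 (init_prog # ps, sampler_input k M m \<epsilon> \<xi>s Hhat U D V) = return_pmf (ps, s)"
    using init unfolding reach_def by blast
  have sN: "s ''N'' 0 = real N" using prep by (simp add: prepared_def)
  \<comment> \<open>The final memory and the index found become functions of j, so that the rest of
    the run is a map over \<open>uniform_bits b\<close>.\<close>
  have "\<forall>j. \<exists>s' n. j < 2 ^ b \<longrightarrow> reach (inversion_time b') inversion_prog (bits_state s b j) s' \<and>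
    vec k (\<lambda>i. s' ''out'' (int i)) = rvec (point n) \<and>
    n < N \<and> cdf n \<le> real j / 2 ^ b \<and> real j / 2 ^ b < cdf (Suc n)"
    using reach_inversion[OF prep _ b'] by blast
  then obtain \<sigma> \<nu> where final: "\<And>j. j < 2 ^ b \<Longrightarrow> reach (inversion_time b') inversion_prog (bits_state s b j) (\<sigma> j) \<and>
    vec k (\<lambda>i. \<sigma> j ''out'' (int i)) = rvec (point (\<nu> j)) \<and>
    \<nu> j < N \<and> cdf (\<nu> j) \<le> real j / 2 ^ b \<and> real j / 2 ^ b < cdf (Suc (\<nu> j))"
    by metis
  define Q where "Q = map_pmf (\<lambda>j. point (\<nu> j)) (uniform_bits b)"
  \<comment> \<open>The three \<open>Suc\<close> count the two sequence nodes of
    \<open>sampler_prog\<close> and the failing test of the bit loop.\<close>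
  define n where "n = Suc (n0 + Suc (8 * b + Suc (inversion_time b')))"
  have "run n ([sampler_prog], sampler_input k M m \<epsilon> \<xi>s Hhat U D V) =
      run (8 * b + Suc (inversion_time b')) ([bits_loop, inversion_prog], s)"
    by (simp add: n_def sampler_prog_def bind_return_pmf run_add n0(2) del: add_Suc_right)
  also have "\<dots> = bind_pmf (uniform_bits b)
      (\<lambda>j. run (Suc (inversion_time b')) ([bits_loop, inversion_prog], bits_state s b j))"
    unfolding run_add using s b(2) \<epsilon> by (subst run_bits) (simp_all add: sN field_simps bind_map_pmf del: run.simps)
  also have "\<dots> = bind_pmf (uniform_bits b) (\<lambda>j. return_pmf ([], \<sigma> j))"
  proof (rule bind_pmf_cong[OF refl])
    fix j assume "j \<in> set_pmf (uniform_bits b)"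
    then have "j < 2 ^ b" by (simp add: set_uniform_bits)
    then have "run (inversion_time b') ([inversion_prog], bits_state s b j) = return_pmf ([], \<sigma> j)"
      using final by (intro run_reach) blast
    moreover have "\<not> 2 ^ b * \<epsilon> < 2 * real N" using b(1) \<epsilon> by (simp add: field_simps)
    ultimately show "run (Suc (inversion_time b')) ([bits_loop, inversion_prog], bits_state s b j) = return_pmf ([], \<sigma> j)"
      by (simp add: bits_loop_def bits_state_def s sN bind_return_pmf)
  qed
  finally have run: "run n ([sampler_prog], sampler_input k M m \<epsilon> \<xi>s Hhat U D V) =
      map_pmf (\<lambda>j. ([], \<sigma> j)) (uniform_bits b)"
    by (simp add: map_pmf_def)
  have "map_pmf (\<lambda>j. vec k (\<lambda>i. \<sigma> j ''out'' (int i))) (uniform_bits b) =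
      map_pmf (\<lambda>j. rvec (point (\<nu> j))) (uniform_bits b)"
    using final by (intro map_pmf_cong) (auto simp: set_uniform_bits)
  then have "samples_within sampler_prog (sampler_input k M m \<epsilon> \<xi>s Hhat U D V) n k Q"
    unfolding samples_within_def run Q_def
    by (auto simp: pmf.map_comp comp_def output_vec_def)
  moreover have "set_pmf Q \<subseteq> ?S" "dTV ?S (pmf P) (pmf Q) \<le> dTV ?S H (pmf P) + real N / 2 ^ b"
    unfolding Q_def
    by (rule quantile_sampling_error[OF bij_point sum_H P]; use final cdf_eq_sum in metis)+
  \<comment> \<open>Together with the given eps/3 this makes 5/6 of eps.\<close>
  moreover have "real N / 2 ^ b \<le> \<epsilon> / 2" using b(1) \<epsilon> by (simp add: field_simps)
  ultimately have "samples_within sampler_prog (sampler_input k M m \<epsilon> \<xi>s Hhat U D V) n k Q \<and>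
    set_pmf Q \<subseteq> ?S \<and> dTV ?S (pmf P) (pmf Q) \<le> \<epsilon>"
    using HP \<epsilon> by linarith
  moreover have "n \<le> init_time + 8 * b + inversion_time b' + 3" using n0(1) by (simp add: n_def)
  ultimately show ?thesis by blast
qed

text \<open>Each stage is bounded by a multiple of X = L L' c K, which works because all four
  factors are at least 1. The cube in K comes from the linear solver, whose k rounds cost O(k^2)
  each. The coefficients obtained add up to 192, so 300 leaves room.\<close>

lemma sampler_time:
  fixes \<epsilon> :: real
  assumes \<epsilon>: "0 < \<epsilon>"
    and b: "real b \<le> 1 + 2 * max 0 (ln (2 * real N / \<epsilon>))"
    and b': "real b' \<le> 1 + 2 * max 0 (ln (real N))"
    and n: "n \<le> init_time + 8 * b + inversion_time b' + 3"
  shows "real n \<le> time_bound M T \<epsilon> * poly ([:300:] * [:1, 1:] ^ 3) (real k)"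
proof -
  define K where "K = (1 + real k) ^ 3"
  define L where "L = max 1 (ln (real N))"
  define L' where "L' = max 1 (ln (real N / \<epsilon>))"
  define c where "c = real (length \<xi>s)"
  define X where "X = L * L' * c * K"
  have "T \<noteq> {}" using zero_in_T by blast
  then have "length \<xi>s > 0" using bij_index by (auto simp: bij_betw_def)
  then have c: "1 \<le> c" by (simp add: c_def Suc_le_eq)
  have L: "1 \<le> L" "1 \<le> L'" by (simp_all add: L_def L'_def)
  have K_eq: "K = 1 + 3 * real k + 3 * (real k * real k) + real k * (real k * real k)"
    by (simp add: K_def power3_eq_cube algebra_simps)
  have k0: "0 \<le> real k" "0 \<le> real k * real k" "0 \<le> real k * (real k * real k)" by simp_all
  have K: "1 \<le> K" using K_eq k0 by linarith
  have LL: "1 \<le> L * L'" "L \<le> L * L'" "L' \<le> L * L'"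
    using L mult_mono[of 1 L 1 L'] mult_left_mono[of 1 L' L] mult_right_mono[of 1 L L'] by auto
  have "1 * 1 \<le> (L * L') * c" using LL c by (intro mult_mono) auto
  then have A: "1 \<le> L * L' * c" by simp
  then have KX: "K \<le> X" using mult_right_mono[of 1 "L * L' * c" K] K by (simp add: X_def)
  have LX: "L' \<le> X"
  proof -
    have "L' * 1 * 1 \<le> L * L' * c * K" using LL c K L by (intro mult_mono) auto
    then show ?thesis by (simp add: X_def)
  qed
  have cLX: "L * (c * K) \<le> X"
  proof -
    have "L * (c * K) \<le> (L * L') * (c * K)" using LL c K by (intro mult_right_mono) auto
    then show ?thesis by (simp add: X_def mult.assoc)
  qed
  have ln2: "ln (2 * real N / \<epsilon>) \<le> 1 + ln (real N / \<epsilon>)"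
  proof -
    have "ln (2 * (real N / \<epsilon>)) = ln 2 + ln (real N / \<epsilon>)"
      using N_pos \<epsilon> by (intro ln_mult_pos) auto
    moreover have "ln (2 :: real) \<le> 1" using ln_le_minus_one[of "2 :: real"] by simp
    ultimately show ?thesis by simp
  qed
  have b5: "real b \<le> 5 * L'" using b ln2 unfolding L'_def by linarith
  have b3: "real b' \<le> 3 * L" using b' unfolding L_def by linarith
  have "real init_time \<le> 14 * K"
    unfolding init_time_def K_eq using k0 by simp
  moreover have "real cdf_time + 8 \<le> 29 * (c * K)"
  proof -
    have "real k * (4 * real k + 22) + 16 \<le> 16 * K"
      unfolding K_eq using k0 by (simp add: algebra_simps)
    then have "c * (real k * (4 * real k + 22) + 16) \<le> c * (16 * K)" using c by (intro mult_left_mono) auto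
    moreover have "1 * 1 \<le> c * K" using c K by (intro mult_mono) auto
    ultimately show ?thesis by (simp add: cdf_time_def c_def)
  qed
  then have "real b' * (real cdf_time + 8) \<le> (3 * L) * (29 * (c * K))"
    using b3 L by (intro mult_mono) auto
  then have "real (search_time b') \<le> 87 * X + 5"
    using cLX by (simp add: search_time_def)
  moreover have "real point_time \<le> 40 * K"
    unfolding point_time_def solve_time_def step_time_def K_eq using k0 by (simp add: algebra_simps)
  moreover have "real n \<le> real init_time + 8 * real b + real (search_time b') + real point_time + 6"
    using n by (simp add: inversion_time_def)
  ultimately have "real n \<le> 300 * X" using KX LX K b5 by linarith
  also have "300 * X = time_bound M T \<epsilon> * poly ([:300:] * [:1, 1:] ^ 3) (real k)"
    by (simp add: time_bound_def Let_def abs_det card_T X_def L_def L'_def c_def K_def)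
  finally show ?thesis .
qed

end

theorem theorem3p15:
  shows "\<exists>(sampler :: prog) (pol :: real poly).
    \<forall>(k :: nat) (M :: int mat) (m :: real vec) (T :: real vec set set)
      (Hhat :: real vec set \<Rightarrow> complex) (H :: int vec \<Rightarrow> real) (P :: int vec pmf) (\<epsilon> :: real)
      (U :: int mat) (D :: int mat) (V :: int mat) (\<xi>s :: real vec list).
      M \<in> carrier_mat k k \<and> Determinant.det M \<noteq> 0 \<and> m \<in> carrier_vec k \<and>
      finite T \<and> T \<subseteq> freqs k M \<and> coset k (0\<^sub>v k) \<in> T \<and> Hhat (coset k (0\<^sub>v k)) = 1 \<and>
      (\<forall>x \<in> fund_points k M m. complex_of_real (H x) = inverse_DFT M T Hhat x) \<and>
      0 < \<epsilon> \<and> set_pmf P \<subseteq> fund_points k M m \<and>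
      dTV (fund_points k M m) H (pmf P) \<le> \<epsilon> / 3 \<and>
      smith_decomp k M U D V \<and> represents k \<xi>s T
      \<longrightarrow> (\<exists>(Q :: int vec pmf) (n :: nat).
            samples_within sampler (sampler_input k M m \<epsilon> \<xi>s Hhat U D V) n k Q \<and>
            set_pmf Q \<subseteq> fund_points k M m \<and>
            dTV (fund_points k M m) (pmf P) (pmf Q) \<le> \<epsilon> \<and>
            real n \<le> time_bound M T \<epsilon> * poly pol (real k))"
proof (intro exI[of _ sampler_prog] exI[of _ "[:300:] * [:1, 1:] ^ 3"] allI impI, elim conjE)
  fix k :: nat and M :: "int mat" and m :: "real vec" and T :: "real vec set set"
    and Hhat :: "real vec set \<Rightarrow> complex" and H :: "int vec \<Rightarrow> real" and P :: "int vec pmf"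
    and \<epsilon> :: real and U D V :: "int mat" and \<xi>s :: "real vec list"
  assume M: "M \<in> carrier_mat k k" "Determinant.det M \<noteq> 0" "m \<in> carrier_vec k"
    and T: "T \<subseteq> freqs k M" "coset k (0\<^sub>v k) \<in> T" "Hhat (coset k (0\<^sub>v k)) = 1"
    and H: "\<forall>x \<in> fund_points k M m. complex_of_real (H x) = inverse_DFT M T Hhat x"
    and \<epsilon>: "0 < \<epsilon>" and P: "set_pmf P \<subseteq> fund_points k M m"
    and HP: "dTV (fund_points k M m) H (pmf P) \<le> \<epsilon> / 3"
    and decomp: "smith_decomp k M U D V" "represents k \<xi>s T"
  interpret sampler_instance k M m U D V T Hhat H \<xi>s
    by unfold_locales (use M T H decomp in auto)
  \<comment> \<open>Two separate exponents: b is the number of random bits and depends on eps, while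
    b' bounds the rounds of the search and depends on N alone.\<close>
  obtain b where b: "2 * real N / \<epsilon> \<le> 2 ^ b" "\<And>i. i < b \<Longrightarrow> 2 ^ i < 2 * real N / \<epsilon>"
    "real b \<le> 1 + 2 * max 0 (ln (2 * real N / \<epsilon>))"
    using power_of_2_above by blast
  obtain b' where b': "real N \<le> 2 ^ b'" "real b' \<le> 1 + 2 * max 0 (ln (real N))"
    using power_of_2_above by blast
  have "N \<le> 2 ^ b'" using b'(1) by (metis of_nat_le_iff of_nat_numeral of_nat_power)
  then obtain Q n where
    "samples_within sampler_prog (sampler_input k M m \<epsilon> \<xi>s Hhat U D V) n k Q"
    "set_pmf Q \<subseteq> fund_points k M m" "dTV (fund_points k M m) (pmf P) (pmf Q) \<le> \<epsilon>"
    "n \<le> init_time + 8 * b + inversion_time b' + 3"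
    using sampler_correct[OF \<epsilon> P HP b(1,2)] by blast
  moreover from this have "real n \<le> time_bound M T \<epsilon> * poly ([:300:] * [:1, 1:] ^ 3) (real k)"
    using sampler_time[OF \<epsilon> b(3) b'(2)] by blast
  ultimately show "\<exists>Q n. samples_within sampler_prog (sampler_input k M m \<epsilon> \<xi>s Hhat U D V) n k Q \<and>
            set_pmf Q \<subseteq> fund_points k M m \<and>
            dTV (fund_points k M m) (pmf P) (pmf Q) \<le> \<epsilon> \<and>
            real n \<le> time_bound M T \<epsilon> * poly ([:300:] * [:1, 1:] ^ 3) (real k)"
    by blast
qed

end
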